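(* Let $p$ be a prime and let $C\subset\mathbb{P}^2$ be an irreducible plane curve of degree $d\geq 3$ defined over $\mathbb{F}_p$. If $p\geq 4(d-1)^2(d-2)^2$, then $C$ is not tangent-filling over $\mathbb{F}_p$.
   Context: A plane curve over a field $K$ is $C=\{F=0\}\subset\mathbb{P}^2$ for a nonzero homogeneous $F\in K[x,y,z]$ of degree $d=\deg C$. Irreducible means irreducible over the ground field (here $\mathbb{F}_p$), not necessarily over its algebraic closure. For a smooth point $Q$ of $C$, $T_QC$ denotes the (projective) tangent line to $C$ at $Q$. An irreducible projective plane curve $C$ over a finite field $\mathbb{F}_q$ is called tangent-filling (over $\mathbb{F}_q$) if every point $P\in\mathbb{P}^2(\mathbb{F}_q)$ lies on the tangent line $T_QC$ at some smooth $\mathbb{F}_q$-point $Q$ of $C$. Here $q=p$. *)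

theory Defs
  imports
    "HOL-Computational_Algebra.Polynomial_Factorial"
    "HOL-Analysis.Cartesian_Space"
    "Berlekamp_Zassenhaus.Finite_Field"
begin

section \<open>Forms in three variables\<close>

text \<open>
  The ring \<open>K[x,y,z]\<close> is represented as the iterated polynomial ring \<open>K[x][y][z]\<close>: the outermost
  indeterminate is \<open>z\<close>, the innermost one is \<open>x\<close>.
\<close>

type_synonym 'k poly3 = "'k poly poly poly"

text \<open>The coefficient of \<open>x^i y^j z^k\<close>.\<close>

definition coeff3 :: "'k::zero poly3 \<Rightarrow> nat \<Rightarrow> nat \<Rightarrow> nat \<Rightarrow> 'k"
  where "coeff3 F i j k = poly.coeff (poly.coeff (poly.coeff F k) j) i"

definition homogeneous3 :: "nat \<Rightarrow> 'k::zero poly3 \<Rightarrow> bool"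
  where "homogeneous3 d F \<longleftrightarrow> (\<forall>i j k. coeff3 F i j k \<noteq> 0 \<longrightarrow> i + j + k = d)"

definition eval3 :: "'k::comm_semiring_0 poly3 \<Rightarrow> 'k ^ 3 \<Rightarrow> 'k"
  where "eval3 F v = poly (poly (poly F [:[:v $ 3:]:]) [:v $ 2:]) (v $ 1)"

text \<open>The vector of formal partial derivatives with respect to \<open>x\<close>, \<open>y\<close>, \<open>z\<close>, evaluated at a vector.\<close>

definition gradient3 :: "'k::idom poly3 \<Rightarrow> 'k ^ 3 \<Rightarrow> 'k ^ 3"
  where "gradient3 F v =
    vector [eval3 (map_poly (map_poly pderiv) F) v, eval3 (map_poly pderiv F) v, eval3 (pderiv F) v]"

section \<open>The projective plane\<close>

text \<open>
  A point of \<open>P^2(K)\<close> is a class of nonzero vectors modulo nonzero scalars, so a point is itself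
  the set of its homogeneous coordinate vectors.
\<close>

definition proj_rel :: "('k::field ^ 3) rel"
  where "proj_rel = {(v, w). v \<noteq> 0 \<and> w \<noteq> 0 \<and> (\<exists>c. c \<noteq> 0 \<and> w = c *s v)}"

definition proj_plane :: "('k::field ^ 3) set set"
  where "proj_plane = (UNIV - {0}) // proj_rel"

section \<open>Plane curves\<close>

text \<open>
  A plane curve over \<open>K\<close> is given by a nonzero form \<open>F\<close>. All conditions on homogeneous coordinates
  below are invariant under scaling, so quantifying over all coordinate vectors of a point agrees
  with choosing one.
\<close>

definition curve_points :: "'k::field poly3 \<Rightarrow> ('k ^ 3) set set"
  where "curve_points F = {Q \<in> proj_plane. \<forall>v\<in>Q. eval3 F v = 0}"

definition smooth_points :: "'k::field poly3 \<Rightarrow> ('k ^ 3) set set"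
  where "smooth_points F = {Q \<in> curve_points F. \<forall>v\<in>Q. gradient3 F v \<noteq> 0}"

text \<open>The \<open>K\<close>-points of the projective tangent line at a smooth point \<open>Q\<close>.\<close>

definition tangent_line :: "'k::field poly3 \<Rightarrow> ('k ^ 3) set \<Rightarrow> ('k ^ 3) set set"
  where "tangent_line F Q =
    {P \<in> proj_plane. \<forall>u\<in>Q. \<forall>v\<in>P. (\<Sum>i\<in>UNIV. gradient3 F u $ i * v $ i) = 0}"

definition tangent_filling :: "'k::{field,finite} poly3 \<Rightarrow> bool"
  where "tangent_filling F \<longleftrightarrow> (\<forall>P\<in>proj_plane. \<exists>Q\<in>smooth_points F. P \<in> tangent_line F Q)"

end

theory Submission
  imports Defs "Jordan_Normal_Form.Char_Poly" "HOL-Computational_Algebra.Formal_Power_Series"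
begin

text \<open>
  Suppose that every rational point of the plane lies on the tangent at some smooth rational point, and let \<open>N\<close> be the
  number of smooth rational points. Two estimates of \<open>N\<close> contradict each other.

  The lower bound is \<open>2 N \<ge> 3 (p + 1)\<close>. The gradients at the smooth points are points of the dual plane, and the assumption
  says that they meet every line of the dual plane. A blocking set of the plane over a prime field that contains no line has at
  least \<open>3 (p + 1) / 2\<close> points (\<open>blocking_family_card\<close>, due to Blokhuis). A line of gradients would be a point \<open>P\<close> on more
  than \<open>p \<ge> d (d - 1)\<close> tangents; by Bezout the polar form of \<open>P\<close>, which has degree \<open>d - 1\<close>, would be zero. Then \<open>F\<close> would be
  constant in direction \<open>P\<close>, and the line through \<open>P\<close> and a smooth point would carry too many points of the curve
  (\<open>directional3_nonzero\<close>).

  The upper bound is \<open>4 N \<le> 5 p + 16 g\<^sup>2 + 4\<close> with \<open>2 g = (d - 1) (d - 2)\<close> (\<open>card_smooth_branches_le\<close>). The hypothesis on \<open>p\<close>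
  is \<open>16 g\<^sup>2 \<le> p\<close>, so \<open>2 N \<le> 3 p + 2\<close>. The proof follows Stoehr and Voloch: for \<open>n + 1\<close> forms \<open>f\<close> consider the determinant with the
  rows \<open>f, f', \<dots>, f\<^sup>(\<^sup>n\<^sup>-\<^sup>1\<^sup>), f\<^sup>p\<close>, where the derivatives are taken along the curve. At a rational point \<open>f\<^sup>p\<close> agrees to high order with
  the value of \<open>f\<close>, which Taylor's formula expresses by the other rows modulo \<open>t\<^sup>n\<close>. So the determinant vanishes to order
  \<open>n\<close> at each smooth rational point (\<open>frobenius_wronskian_vanishes\<close>), it is not identically zero if the forms have distinct
  orders at some point (\<open>frobenius_wronskian_nonzero\<close>), and its degree bounds \<open>N n\<close> by Bezout. The choice \<open>n = 4 g\<close> gives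
  the bound.

  Curves enter only through forms and through branches, that is, parametrisations by power series at smooth points. After
  a shear \<open>F\<close> is monic in \<open>z\<close>, and forms modulo \<open>F\<close> have unique representatives of degree below \<open>d\<close> in \<open>z\<close>; dimensions are compared
  by counting elements over the finite field. Bezout's inequality (\<open>bezout\<close>) comes from such a count.
\<close>

section \<open>Ternary forms and their evaluation\<close>

definition const3 :: "'k::zero \<Rightarrow> 'k poly3" where "const3 c = [:[:[:c:]:]:]"
definition X3 :: "'k::comm_ring_1 poly3" where "X3 = [:[:[:0, 1:]:]:]"
definition Y3 :: "'k::comm_ring_1 poly3" where "Y3 = [:[:0, 1:]:]"
definition Z3 :: "'k::comm_ring_1 poly3" where "Z3 = [:0, 1:]"

lemma poly3_induct:
  fixes P :: "'k::comm_ring_1 poly3 \<Rightarrow> bool"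
  assumes c: "\<And>c. P (const3 c)" and x: "P X3" and y: "P Y3" and z: "P Z3"
    and add: "\<And>f g. P f \<Longrightarrow> P g \<Longrightarrow> P (f + g)" and mult: "\<And>f g. P f \<Longrightarrow> P g \<Longrightarrow> P (f * g)"
  shows "P f"
proof -
  have 1: "P [:[:h:]:]" for h
  proof (induction h)
    case 0 show ?case using c[of 0] by (simp add: const3_def)
  next
    case (pCons a h)
    have "[:[:pCons a h:]:] = const3 a + X3 * [:[:h:]:]" by (simp add: const3_def X3_def)
    then show ?case using add mult c x pCons.IH by metis
  qed
  have 2: "P [:g:]" for g
  proof (induction g)
    case 0 show ?case using c[of 0] by (simp add: const3_def)
  next
    case (pCons a h)
    have "[:pCons a h:] = [:[:a:]:] + Y3 * [:h:]" by (simp add: Y3_def)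
    then show ?case using add mult 1 y pCons.IH by metis
  qed
  show ?thesis
  proof (induction f)
    case 0 show ?case using c[of 0] by (simp add: const3_def)
  next
    case (pCons a h)
    have "pCons a h = [:a:] + Z3 * h" by (simp add: Z3_def)
    then show ?case using add mult 2 z pCons.IH by metis
  qed
qed

text \<open>
  The first argument embeds the coefficients, so that one notion of evaluation covers values at points,
  restrictions to power series and to lines, and substitutions of forms.
\<close>

definition ev3 :: "('k::comm_ring_1 \<Rightarrow> 'r::comm_ring_1) \<Rightarrow> 'r \<Rightarrow> 'r \<Rightarrow> 'r \<Rightarrow> 'k poly3 \<Rightarrow> 'r" where
  "ev3 c x y z f =
    poly (map_poly (\<lambda>g. poly (map_poly (\<lambda>h. poly (map_poly c h) x) g) y) f) z"

lemma comm_ring_hom_poly_map: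
  assumes "comm_ring_hom h"
  shows "comm_ring_hom (\<lambda>p. poly (map_poly h p) a)"
proof -
  interpret comm_ring_hom h by fact
  interpret m: map_poly_comm_ring_hom h ..
  show ?thesis by unfold_locales (simp_all add: m.hom_add m.hom_mult)
qed

lemma map_poly_const: "f 0 = 0 \<Longrightarrow> map_poly f [:a:] = [:f a:]"
  by (simp add: Polynomial.map_poly_pCons)

lemma comm_ring_hom_ev3: "comm_ring_hom c \<Longrightarrow> comm_ring_hom (ev3 c x y z)"
  unfolding ev3_def[abs_def] by (intro comm_ring_hom_poly_map)

lemma ev3_const3_X3_Y3_Z3:
  assumes "comm_ring_hom c"
  shows "ev3 c x y z (const3 a) = c a" "ev3 c x y z X3 = x" "ev3 c x y z Y3 = y" "ev3 c x y z Z3 = z"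
proof -
  interpret comm_ring_hom c by fact
  interpret h1: comm_ring_hom "\<lambda>p. poly (map_poly c p) x" by (intro comm_ring_hom_poly_map assms)
  interpret h2: comm_ring_hom "\<lambda>g. poly (map_poly (\<lambda>p. poly (map_poly c p) x) g) y"
    by (intro comm_ring_hom_poly_map assms)
  show "ev3 c x y z (const3 a) = c a" "ev3 c x y z X3 = x" "ev3 c x y z Y3 = y" "ev3 c x y z Z3 = z"
    by (simp_all add: ev3_def const3_def X3_def Y3_def Z3_def Polynomial.map_poly_pCons map_poly_const one_pCons del: poly_const_conv)
qed

lemma poly3_hom_unique:
  assumes "comm_ring_hom h" "comm_ring_hom h'"
    and "\<And>a. h (const3 a) = h' (const3 a)" "h X3 = h' X3" "h Y3 = h' Y3" "h Z3 = h' Z3"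
  shows "h f = h' f"
proof -
  interpret h: comm_ring_hom h by fact
  interpret h': comm_ring_hom h' by fact
  show ?thesis by (induction f rule: poly3_induct) (auto simp: assms h.hom_add h'.hom_add h.hom_mult h'.hom_mult)
qed

lemma comm_ring_hom_id: "comm_ring_hom (\<lambda>x::'a::comm_ring_1. x)"
  by unfold_locales auto

lemma comm_ring_hom_const3: "comm_ring_hom (const3 :: 'k::comm_ring_1 \<Rightarrow> 'k poly3)"
  by unfold_locales (auto simp: const3_def one_pCons)

lemma comm_ring_hom_fps_const: "comm_ring_hom (fps_const :: 'k::comm_ring_1 \<Rightarrow> 'k fps)"
  by unfold_locales auto

lemma eval3_eq_ev3: "eval3 f v = ev3 (\<lambda>x. x) (vec_nth v 1) (vec_nth v 2) (vec_nth v 3) f"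
  by (rule poly3_hom_unique[OF _ comm_ring_hom_ev3[OF comm_ring_hom_id]], unfold_locales)
    (simp_all add: ev3_const3_X3_Y3_Z3 comm_ring_hom_id, simp_all add: eval3_def const3_def X3_def Y3_def Z3_def flip: one_pCons)

lemma map_poly_derivation:
  fixes D :: "'a::comm_ring_1 \<Rightarrow> 'a"
  assumes add: "\<And>a b. D (a + b) = D a + D b" and mult: "\<And>a b. D (a * b) = a * D b + b * D a"
  shows "map_poly D (f + g) = map_poly D f + map_poly D g"
    "map_poly D (f * g) = f * map_poly D g + g * map_poly D f"
proof -
  have [simp]: "D 0 = 0" using add[of 0 0] by simp
  have sum: "D (sum h A) = (\<Sum>x\<in>A. D (h x))" for h :: "'b \<Rightarrow> 'a" and A
    by (induction A rule: infinite_finite_induct) (auto simp: add)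
  show "map_poly D (f + g) = map_poly D f + map_poly D g"
    by (intro poly_eqI) (simp add: coeff_map_poly add)
  have "map_poly D (f * g) = f * map_poly D g + map_poly D f * g"
  proof (intro poly_eqI)
    fix n
    have "(\<Sum>i\<le>n. coeff g (n - i) * D (coeff f i)) = (\<Sum>i\<le>n. D (coeff f i) * coeff g (n - i))"
      by (simp only: mult.commute)
    then show "coeff (map_poly D (f * g)) n = coeff (f * map_poly D g + map_poly D f * g) n"
      by (simp add: coeff_map_poly coeff_mult sum mult sum.distrib)
  qed
  then show "map_poly D (f * g) = f * map_poly D g + g * map_poly D f"
    by (simp only: mult.commute)
qed

definition dx3 :: "'k::idom poly3 \<Rightarrow> 'k poly3" where "dx3 = map_poly (map_poly pderiv)"
definition dy3 :: "'k::idom poly3 \<Rightarrow> 'k poly3" where "dy3 = map_poly pderiv"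
definition dz3 :: "'k::idom poly3 \<Rightarrow> 'k poly3" where "dz3 = pderiv"

lemma d3_add: "dx3 (f + g) = dx3 f + dx3 g" "dy3 (f + g) = dy3 f + dy3 g" "dz3 (f + g) = dz3 f + dz3 g"
  and d3_mult: "dx3 (f * g) = f * dx3 g + g * dx3 f" "dy3 (f * g) = f * dy3 g + g * dy3 f"
    "dz3 (f * g) = f * dz3 g + g * dz3 f"
  by (simp_all add: dx3_def dy3_def dz3_def map_poly_derivation pderiv_add pderiv_mult)

lemma d3_base [simp]:
  "dx3 (const3 a) = 0" "dx3 X3 = 1" "dx3 Y3 = 0" "dx3 Z3 = 0"
  "dy3 (const3 a) = 0" "dy3 X3 = 0" "dy3 Y3 = 1" "dy3 Z3 = 0"
  "dz3 (const3 a) = 0" "dz3 X3 = 0" "dz3 Y3 = 0" "dz3 Z3 = 1"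
  by (simp_all add: dx3_def dy3_def dz3_def const3_def X3_def Y3_def Z3_def Polynomial.map_poly_pCons map_poly_const pderiv_pCons one_pCons)

text \<open>
  The chain rule for a derivation that kills the constants. It is applied to \<open>d/dt\<close> on power series,
  to the derivative on univariate polynomials and to the partial derivatives of a substituted form.
\<close>

lemma derivation_ev3:
  assumes "comm_ring_hom c"
    and add: "\<And>a b. D (a + b) = D a + D b" and mult: "\<And>a b. D (a * b) = a * D b + b * D a"
    and const: "\<And>a. D (c a) = 0"
  shows "D (ev3 c x y z f) =
    ev3 c x y z (dx3 f) * D x + ev3 c x y z (dy3 f) * D y + ev3 c x y z (dz3 f) * D z"
proof -
  interpret e: comm_ring_hom "ev3 c x y z" by (intro comm_ring_hom_ev3 assms)
  show ?thesis
    by (induction f rule: poly3_induct)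
      (simp_all add: e.hom_add e.hom_mult d3_add d3_mult add mult const ev3_const3_X3_Y3_Z3 assms(1) algebra_simps)
qed

section \<open>Homogeneity\<close>

lemma coeff3_eqI: "(\<And>i j k. coeff3 f i j k = coeff3 g i j k) \<Longrightarrow> f = g"
  unfolding coeff3_def by (intro poly_eqI) auto

lemma coeff3_simps [simp]:
  "coeff3 (f + g) i j k = coeff3 f i j k + coeff3 g i j k"
  "coeff3 (f' - g') i j k = coeff3 f' i j k - coeff3 g' i j k"
  "coeff3 0 i j k = 0"
  by (simp_all add: coeff3_def)

lemma coeff3_sum: "coeff3 (sum f A) i j k = (\<Sum>a\<in>A. coeff3 (f a) i j k)"
  by (simp add: coeff3_def coeff_sum)

lemma coeff3_const3_mult: "coeff3 (const3 a * f) i j k = a * coeff3 f i j k"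
  by (simp add: coeff3_def const3_def)

lemma coeff3_var_mult:
  "coeff3 (X3 * f) i j k = (if i = 0 then 0 else coeff3 f (i - 1) j k)"
  "coeff3 (Y3 * f) i j k = (if j = 0 then 0 else coeff3 f i (j - 1) k)"
  "coeff3 (Z3 * f) i j k = (if k = 0 then 0 else coeff3 f i j (k - 1))"
  by (cases i; cases j; cases k; simp add: coeff3_def X3_def Y3_def Z3_def)+

lemma coeff3_d3:
  "coeff3 (dx3 f) i j k = of_nat (i + 1) * coeff3 f (i + 1) j k"
  "coeff3 (dy3 f) i j k = of_nat (j + 1) * coeff3 f i (j + 1) k"
  "coeff3 (dz3 f) i j k = of_nat (k + 1) * coeff3 f i j (k + 1)"
proof -
  have 1: "(of_nat n :: 'a poly) = [:of_nat n:]" for n by (rule of_nat_poly)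
  have 2: "(of_nat n :: 'a poly poly) = [:[:of_nat n:]:]" for n by (simp add: of_nat_poly)
  show "coeff3 (dx3 f) i j k = of_nat (i + 1) * coeff3 f (i + 1) j k"
    "coeff3 (dy3 f) i j k = of_nat (j + 1) * coeff3 f i (j + 1) k"
    "coeff3 (dz3 f) i j k = of_nat (k + 1) * coeff3 f i j (k + 1)"
    unfolding coeff3_def dx3_def dy3_def dz3_def
    by (simp_all add: coeff_map_poly coeff_pderiv 1 2 del: of_nat_Suc)
qed

lemma homogeneous3_0 [simp]: "homogeneous3 d 0"
  by (simp add: homogeneous3_def)

lemma homogeneous3_add: "homogeneous3 d f \<Longrightarrow> homogeneous3 d g \<Longrightarrow> homogeneous3 d (f + g)"
  by (auto simp: homogeneous3_def) (metis add.right_neutral)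

lemma homogeneous3_diff: "homogeneous3 d f \<Longrightarrow> homogeneous3 d g \<Longrightarrow> homogeneous3 d (f - g :: 'k::comm_ring_1 poly3)"
  by (auto simp: homogeneous3_def) (metis diff_zero)

lemma homogeneous3_sum: "(\<And>a. a \<in> A \<Longrightarrow> homogeneous3 d (f a)) \<Longrightarrow> homogeneous3 d (sum f A)"
  by (induction A rule: infinite_finite_induct) (auto intro: homogeneous3_add)

lemma coeff3_mult:
  "coeff3 (f * g) i j k = (\<Sum>c\<le>k. \<Sum>b\<le>j. \<Sum>a\<le>i. coeff3 f a b c * coeff3 g (i - a) (j - b) (k - c))"
  by (simp add: coeff3_def coeff_mult coeff_sum)

lemma homogeneous3_mult:
  assumes "homogeneous3 d f" "homogeneous3 e g"
  shows "homogeneous3 (d + e) (f * g)"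
  unfolding homogeneous3_def
proof (intro allI impI)
  fix i j k assume "coeff3 (f * g) i j k \<noteq> 0"
  then have "(\<Sum>c\<le>k. \<Sum>b\<le>j. \<Sum>a\<le>i. coeff3 f a b c * coeff3 g (i - a) (j - b) (k - c)) \<noteq> 0"
    by (simp add: coeff3_mult)
  then obtain c where c: "c \<le> k" "(\<Sum>b\<le>j. \<Sum>a\<le>i. coeff3 f a b c * coeff3 g (i - a) (j - b) (k - c)) \<noteq> 0"
    by (metis (no_types, lifting) atMost_iff sum.neutral)
  then obtain b where b: "b \<le> j" "(\<Sum>a\<le>i. coeff3 f a b c * coeff3 g (i - a) (j - b) (k - c)) \<noteq> 0"
    by (metis (no_types, lifting) atMost_iff sum.neutral)
  then obtain a where a: "a \<le> i" "coeff3 f a b c * coeff3 g (i - a) (j - b) (k - c) \<noteq> 0"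
    by (metis (no_types, lifting) atMost_iff sum.neutral)
  then have "coeff3 f a b c \<noteq> 0" "coeff3 g (i - a) (j - b) (k - c) \<noteq> 0" by auto
  then have "a + b + c = d" "(i - a) + (j - b) + (k - c) = e"
    using assms by (auto simp: homogeneous3_def)
  then show "i + j + k = d + e" using a(1) b(1) c(1) by linarith
qed

lemma homogeneous3_const3: "homogeneous3 0 (const3 a)"
  by (auto simp: homogeneous3_def coeff3_def const3_def coeff_pCons split: nat.splits)

lemma homogeneous3_1: "homogeneous3 0 (1 :: 'k::comm_ring_1 poly3)"
proof -
  have "(1 :: 'k poly3) = const3 1" by (simp add: const3_def one_pCons)
  then show ?thesis by (metis homogeneous3_const3)
qed

lemma homogeneous3_vars: "homogeneous3 1 X3" "homogeneous3 1 Y3" "homogeneous3 1 Z3"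
  by (auto simp: homogeneous3_def coeff3_def X3_def Y3_def Z3_def coeff_pCons split: nat.splits)

lemma homogeneous3_power: "homogeneous3 d f \<Longrightarrow> homogeneous3 (n * d) (f ^ n :: 'k::comm_ring_1 poly3)"
  by (induction n) (auto simp: homogeneous3_1 intro: homogeneous3_mult)

lemma homogeneous3_prod:
  "(\<And>a. a \<in> A \<Longrightarrow> homogeneous3 (e a) (f a)) \<Longrightarrow> homogeneous3 (sum e A) (prod f A :: 'k::comm_ring_1 poly3)"
  by (induction A rule: infinite_finite_induct) (auto simp: homogeneous3_1 intro: homogeneous3_mult)

lemma homogeneous3_const3_mult: "homogeneous3 d f \<Longrightarrow> homogeneous3 d (const3 a * f)"
  using homogeneous3_mult[OF homogeneous3_const3] by fastforce

lemma homogeneous3_d3: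
  assumes "homogeneous3 m f"
  shows "homogeneous3 (m - 1) (dx3 f)" "homogeneous3 (m - 1) (dy3 f)" "homogeneous3 (m - 1) (dz3 f)"
proof -
  have *: "i + j + k = m" if "coeff3 f i j k \<noteq> 0" for i j k using assms that by (auto simp: homogeneous3_def)
  show "homogeneous3 (m - 1) (dx3 f)" "homogeneous3 (m - 1) (dy3 f)" "homogeneous3 (m - 1) (dz3 f)"
    unfolding homogeneous3_def coeff3_d3 by (fastforce dest!: *)+
qed

lemma euler3:
  assumes "homogeneous3 m f"
  shows "X3 * dx3 f + Y3 * dy3 f + Z3 * dz3 f = const3 (of_nat m) * f"
proof (rule coeff3_eqI)
  fix i j k
  show "coeff3 (X3 * dx3 f + Y3 * dy3 f + Z3 * dz3 f) i j k = coeff3 (const3 (of_nat m) * f) i j k"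
  proof (cases "coeff3 f i j k = 0")
    case True
    then show ?thesis
      by (cases i; cases j; cases k; simp add: coeff3_var_mult coeff3_const3_mult coeff3_d3)
  next
    case False
    then have "m = i + j + k" using assms by (auto simp: homogeneous3_def)
    then show ?thesis
      by (cases i; cases j; cases k; simp add: coeff3_var_mult coeff3_const3_mult coeff3_d3 ring_distribs)
  qed
qed

lemma gradient3_nth:
  "vec_nth (gradient3 F v) 1 = eval3 (dx3 F) v"
  "vec_nth (gradient3 F v) 2 = eval3 (dy3 F) v"
  "vec_nth (gradient3 F v) 3 = eval3 (dz3 F) v"
  by (simp_all add: gradient3_def dx3_def dy3_def dz3_def)

section \<open>Power series and prime fields\<close>

lemma fps_X_power_dvd_iff_nth: "fps_X ^ n dvd f \<longleftrightarrow> (\<forall>i<n. fps_nth f i = 0)" for f :: "'a::comm_ring_1 fps"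
proof
  assume "fps_X ^ n dvd f"
  then show "\<forall>i<n. fps_nth f i = 0" by (auto simp: fps_X_power_mult_nth)
next
  assume *: "\<forall>i<n. fps_nth f i = 0"
  have "f = fps_X ^ n * Abs_fps (\<lambda>i. fps_nth f (i + n))"
    using * by (intro fps_ext) (auto simp: fps_X_power_mult_nth)
  then show "fps_X ^ n dvd f" by (rule dvdI)
qed

lemma fps_X_power_dvd_if_le_subdegree: "n \<le> subdegree f \<Longrightarrow> fps_X ^ n dvd f"
  for f :: "'a::comm_ring_1 fps"
  unfolding fps_X_power_dvd_iff_nth by (intro allI impI nth_less_subdegree_zero) simp

lemma fps_nth_0_prod: "fps_nth (prod f A) 0 = (\<Prod>a\<in>A. fps_nth (f a) 0)"
  for f :: "'b \<Rightarrow> 'a::comm_ring_1 fps"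
  by (induction A rule: infinite_finite_induct) auto

lemma fps_mult_nth_lowest:
  fixes f g :: "'a::idom fps"
  assumes "fps_X ^ m dvd f" "fps_X ^ n dvd g"
  shows "fps_nth (f * g) (m + n) = fps_nth f m * fps_nth g n"
proof -
  obtain f' g' where fg: "f = fps_X ^ m * f'" "g = fps_X ^ n * g'" using assms unfolding dvd_def by auto
  have "f * g = fps_X ^ (m + n) * (f' * g')" by (simp add: fg power_add mult_ac)
  then have "fps_nth (f * g) (m + n) = fps_nth (f' * g') 0" by (simp only: fps_X_power_mult_nth) simp
  then show ?thesis by (simp add: fps_X_power_mult_nth fg)
qed

lemma of_nat_mod_ring_inject:
  assumes "a < CARD('p)" "b < CARD('p)" "(of_nat a :: 'p::prime_card mod_ring) = of_nat b"
  shows "a = b"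
proof -
  have *: "a = b" if "a \<le> b" "b < CARD('p)" "(of_nat a :: 'p mod_ring) = of_nat b" for a b
  proof -
    have "(of_nat (b - a) :: 'p mod_ring) = 0" using that by (simp add: of_nat_diff)
    then have "CARD('p) dvd b - a" by (rule of_nat_0_mod_ring_dvd)
    then show ?thesis using that by (auto dest: dvd_imp_le)
  qed
  show ?thesis using *[of a b] *[of b a] assms by (cases "a \<le> b") auto
qed

lemma power_card_mod_ring: "(a :: 'p::prime_card mod_ring) ^ CARD('p) = a"
proof (cases "a = 0")
  case True then show ?thesis by simp
next
  case False
  obtain m where m: "CARD('p) = Suc (Suc m)"
    using prime_ge_2_nat[OF prime_card[where 'a = 'p]] by (metis add_2_eq_Suc le_Suc_ex)
  have "a * inverse a = 1" using False by simp
  moreover have "nat (int (CARD('p) - 2)) = m" using m by simp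
  ultimately have "a * a ^ m = 1" using False by (simp add: inverse_mod_ring_def)
  then show ?thesis unfolding m by simp
qed

section \<open>Forms of bounded degree in \<open>z\<close>\<close>

lemma coeff3_power_mult:
  "coeff3 (X3 ^ n * f) i j k = (if i < n then 0 else coeff3 f (i - n) j k)"
  "coeff3 (Y3 ^ n * f) i j k = (if j < n then 0 else coeff3 f i (j - n) k)"
  "coeff3 (Z3 ^ n * f) i j k = (if k < n then 0 else coeff3 f i j (k - n))"
proof -
  show "coeff3 (X3 ^ n * f) i j k = (if i < n then 0 else coeff3 f (i - n) j k)"
    by (induction n arbitrary: i) (auto simp: mult.assoc coeff3_var_mult)
  show "coeff3 (Y3 ^ n * f) i j k = (if j < n then 0 else coeff3 f i (j - n) k)"
    by (induction n arbitrary: j) (auto simp: mult.assoc coeff3_var_mult)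
  show "coeff3 (Z3 ^ n * f) i j k = (if k < n then 0 else coeff3 f i j (k - n))"
    by (induction n arbitrary: k) (auto simp: mult.assoc coeff3_var_mult)
qed

text \<open>
  The factor \<open>const3 1\<close> makes the coefficients computable from the rules for products with powers of
  variables and for constants.
\<close>

definition mon3 :: "nat \<times> nat \<times> nat \<Rightarrow> 'k::comm_ring_1 poly3" where
  "mon3 = (\<lambda>(i, j, k). X3 ^ i * (Y3 ^ j * (Z3 ^ k * const3 1)))"

lemma coeff3_const3: "coeff3 (const3 c) i j k = (if i = 0 \<and> j = 0 \<and> k = 0 then c else 0)"
  by (auto simp: coeff3_def const3_def coeff_pCons split: nat.splits)

lemma coeff3_mon3:
  "coeff3 (mon3 (i, j, k)) i' j' k' = (if (i', j', k') = (i, j, k) then 1 else 0 :: 'k::comm_ring_1)"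
  by (auto simp: mon3_def coeff3_power_mult coeff3_const3)

definition exponents3 :: "nat \<Rightarrow> nat \<Rightarrow> (nat \<times> nat \<times> nat) set" where
  "exponents3 d T = {(i, j, k). i + j + k = T \<and> k < d}"

text \<open>
  Representatives of the forms of degree \<open>T\<close> modulo a form that is monic of degree \<open>d\<close> in \<open>z\<close>.
\<close>

definition reduced_forms :: "nat \<Rightarrow> nat \<Rightarrow> 'k::comm_ring_1 poly3 set" where
  "reduced_forms d T = {f. homogeneous3 T f \<and> (\<forall>k\<ge>d. coeff f k = 0)}"

lemma finite_exponents3: "finite (exponents3 d T)"
  by (rule finite_subset[of _ "{..T} \<times> {..T} \<times> {..T}"]) (auto simp: exponents3_def)

lemma card_exponents3: "card (exponents3 d T) = (\<Sum>k<d. T + 1 - k)"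
proof -
  have "bij_betw (\<lambda>(k, i). (i, T - k - i, k)) (SIGMA k:{..<d}. {..<T + 1 - k}) (exponents3 d T)"
    by (rule bij_betw_byWitness[of _ "\<lambda>(i, j, k). (k, i)"]) (auto simp: exponents3_def)
  from bij_betw_same_card[OF this] show ?thesis by simp
qed

text \<open>
  The Hilbert function of a plane curve of degree \<open>d\<close>, namely \<open>d T + 1 - (d - 1) (d - 2) / 2\<close>, in a form
  without division. At \<open>T = d - 2\<close> the last summand of \<open>card_exponents3\<close> is the first one that vanishes, so that
  the formula is still right there.
\<close>

lemma card_exponents3_eq:
  assumes "d \<le> T + 2"
  shows "2 * card (exponents3 d T) + d * (d - 1) = 2 * d * (T + 1)"
proof -
  have "2 * (\<Sum>k<d. T + 1 - k) + d * (d - 1) = 2 * d * (T + 1)"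
    using assms
  proof (induction d)
    case (Suc d)
    have a: "d * d = d * (d - 1) + d" by (cases d) auto
    have b: "T + 1 - d + d = T + 1" using Suc.prems by simp
    have "2 * (\<Sum>k<Suc d. T + 1 - k) + Suc d * (Suc d - 1)
      = (2 * (\<Sum>k<d. T + 1 - k) + d * (d - 1)) + 2 * (T + 1 - d + d)"
      using a by simp
    also have "\<dots> = 2 * Suc d * (T + 1)" using Suc unfolding b by simp
    finally show ?case .
  qed simp
  then show ?thesis by (simp add: card_exponents3)
qed

lemma reduced_formsD:
  assumes "f \<in> reduced_forms d T" "coeff3 f i j k \<noteq> 0"
  shows "(i, j, k) \<in> exponents3 d T"
  using assms by (auto simp: reduced_forms_def exponents3_def homogeneous3_def)
    (metis coeff3_def coeff_0 leI)

lemma card_reduced_forms: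
  "card (reduced_forms d T :: 'k::{comm_ring_1,finite} poly3 set) = CARD('k) ^ card (exponents3 d T)"
proof -
  let ?E = "exponents3 d T" and ?R = "reduced_forms d T :: 'k poly3 set"
  define P where "P = ?E \<rightarrow>\<^sub>E (UNIV :: 'k set)"
  define g where "g = (\<lambda>f :: 'k poly3. restrict (\<lambda>(i, j, k). coeff3 f i j k) ?E)"
  define h where "h = (\<lambda>c :: nat \<times> nat \<times> nat \<Rightarrow> 'k. \<Sum>t\<in>?E. const3 (c t) * mon3 t)"
  have hc: "coeff3 (h c) i j k = (if (i, j, k) \<in> ?E then c (i, j, k) else 0)" for c i j k
  proof -
    have "coeff3 (h c) i j k = (\<Sum>t\<in>?E. if t = (i, j, k) then c t else 0)"
      unfolding h_def coeff3_sum
    proof (rule sum.cong[OF refl])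
      fix t assume "t \<in> ?E"
      show "coeff3 (const3 (c t) * mon3 t) i j k = (if t = (i, j, k) then c t else 0)"
        by (cases t) (auto simp: coeff3_const3_mult coeff3_mon3)
    qed
    then show ?thesis by (simp add: finite_exponents3)
  qed
  have "bij_betw g ?R P"
  proof (rule bij_betw_byWitness[of _ h])
    show "\<forall>f\<in>?R. h (g f) = f"
      by (auto intro!: coeff3_eqI simp: hc g_def dest: reduced_formsD)
    show "\<forall>c\<in>P. g (h c) = c"
      by (auto simp: g_def hc P_def PiE_def extensional_def fun_eq_iff)
    show "g ` ?R \<subseteq> P" by (auto simp: g_def P_def)
    have "h c \<in> ?R" for c
    proof -
      have "homogeneous3 T (h c)" by (auto simp: homogeneous3_def hc exponents3_def)
      moreover have "coeff (h c) k = 0" if "k \<ge> d" for k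
        using that hc[of c _ _ k] by (intro poly_eqI) (simp add: coeff3_def exponents3_def)
      ultimately show ?thesis by (simp add: reduced_forms_def)
    qed
    then show "h ` P \<subseteq> ?R" by auto
  qed
  then have "card ?R = card P" by (rule bij_betw_same_card)
  also have "\<dots> = CARD('k) ^ card ?E" unfolding P_def by (simp add: card_PiE finite_exponents3)
  finally show ?thesis .
qed

lemma reduced_forms_diff: "f \<in> reduced_forms d T \<Longrightarrow> g \<in> reduced_forms d T \<Longrightarrow> f - g \<in> reduced_forms d T"
  by (auto simp: reduced_forms_def intro: homogeneous3_diff)

section \<open>Division by a form that is monic in \<open>z\<close>\<close>

locale monic_form =
  fixes F :: "'p::prime_card mod_ring poly3" and d :: nat
  assumes hom_F: "homogeneous3 d F" and lead_F: "coeff3 F 0 0 d \<noteq> 0" and prime_F: "prime_elem F"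
    and d_pos: "d \<ge> 1"
begin

lemma coeff_F_d: "coeff F d = [:[:coeff3 F 0 0 d:]:]"
proof (intro poly_eqI)
  fix j i
  have "coeff3 F i j d = 0" if "i + j > 0"
    using hom_F that by (force simp: homogeneous3_def)
  then show "coeff (coeff (coeff F d) j) i = coeff (coeff [:[:coeff3 F 0 0 d:]:] j) i"
    by (cases i; cases j; simp add: coeff3_def)
qed

lemma coeff_F_gt: "k > d \<Longrightarrow> coeff F k = 0"
proof (intro poly_eqI)
  fix j i assume "k > d"
  then have "coeff3 F i j k = 0" using hom_F by (force simp: homogeneous3_def)
  then show "coeff (coeff (coeff F k) j) i = coeff (coeff 0 j) i" by (simp add: coeff3_def)
qed

lemma degree_F: "degree F = d"
  using lead_F by (intro antisym degree_le le_degree) (auto simp: coeff_F_d coeff_F_gt)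

lemma dvd_reduced_zero:
  assumes "F dvd f" "\<forall>k\<ge>d. coeff f k = 0"
  shows "f = 0"
proof (rule ccontr)
  assume f: "f \<noteq> 0"
  obtain q where q: "f = F * q" using assms(1) by (rule dvdE)
  with f have "degree f = d + degree q" using degree_F by (auto simp: degree_mult_eq)
  with assms(2) have "lead_coeff f = 0" by simp
  with f show False by simp
qed

text \<open>
  Ordinary division by a polynomial with constant leading coefficient; each step subtracts a multiple of \<open>F\<close>
  that is itself a form of degree \<open>T\<close>.
\<close>

lemma exists_reduced:
  assumes "homogeneous3 T f"
  shows "\<exists>r\<in>reduced_forms d T. F dvd f - r"
proof -
  have "\<exists>r\<in>reduced_forms d T. F dvd f - r" if "homogeneous3 T f" "\<forall>k\<ge>n. coeff f k = 0" for n f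
    using that
  proof (induction n arbitrary: f)
    case 0
    then show ?case by (intro bexI[of _ f]) (auto simp: reduced_forms_def)
  next
    case (Suc n)
    show ?case
    proof (cases "n < d")
      case True
      then show ?thesis using Suc.prems by (intro bexI[of _ f]) (auto simp: reduced_forms_def)
    next
      case False
      define a where "a = coeff3 F 0 0 d"
      define g where "g = [:coeff f n:]"
      define h where "h = const3 (1 / a) * (Z3 ^ (n - d) * (g * F))"
      have cg: "coeff3 (g * f') i j k = coeff3 ([:coeff f n:] * f') i j k" for f' i j k by (simp add: g_def)
      have g0: "coeff3 g i j k = (if k = 0 then coeff3 f i j n else 0)" for i j k
        by (cases k) (simp_all add: g_def coeff3_def)
      have Tn: "T \<ge> n" if "g \<noteq> 0"
      proof (rule ccontr)
        assume "\<not> T \<ge> n"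
        then have "coeff3 f i j n = 0" for i j using Suc.prems(1) by (force simp: homogeneous3_def)
        then have "g = 0" by (intro coeff3_eqI) (simp add: g0)
        with that show False by simp
      qed
      have homg: "homogeneous3 (T - n) g"
        unfolding homogeneous3_def
      proof (intro allI impI)
        fix i j k assume "coeff3 g i j k \<noteq> 0"
        then have "k = 0" "i + j + n = T"
          using Suc.prems(1) by (auto simp: homogeneous3_def g0 split: if_splits)
        then show "i + j + k = T - n" by simp
      qed
      have homh: "homogeneous3 T h"
      proof (cases "g = 0")
        case False
        have "homogeneous3 ((n - d) * 1 + (T - n + d)) h" unfolding h_def
          by (intro homogeneous3_const3_mult homogeneous3_mult homogeneous3_power homogeneous3_vars homg hom_F)
        moreover have "(n - d) * 1 + (T - n + d) = T" using Tn[OF False] \<open>\<not> n < d\<close> by simp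
        ultimately show ?thesis by simp
      qed (simp add: h_def)
      have a: "a \<noteq> 0" using lead_F by (simp add: a_def)
      have "coeff h k = coeff f k" if "k \<ge> n" for k
      proof -
        have zk: "coeff (Z3 ^ m * q) k = (if k < m then 0 else coeff q (k - m))" for m and q :: "'p mod_ring poly3"
          unfolding poly_eq_iff using coeff3_power_mult(3)[of m q _ _ k] by (simp add: coeff3_def)
        have "coeff h k = [:[:1 / a:]:] * coeff (Z3 ^ (n - d) * (g * F)) k"
          by (simp add: h_def const3_def)
        also have "\<dots> = [:[:1 / a:]:] * (coeff f n * coeff F (k - (n - d)))"
          using that by (simp add: zk g_def)
        also have "\<dots> = coeff f k"
        proof (cases "k = n")
          case True
          then have kd: "k - (n - d) = d" using \<open>\<not> n < d\<close> by simp
          show ?thesis unfolding kd coeff_F_d using a True by (simp add: a_def flip: one_pCons)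
        next
          case False
          then have "k - (n - d) > d" using that \<open>\<not> n < d\<close> by simp
          then show ?thesis using Suc.prems(2) that False by (simp add: coeff_F_gt)
        qed
        finally show ?thesis .
      qed
      then have "\<forall>k\<ge>n. coeff (f - h) k = 0" by simp
      then obtain r where r: "r \<in> reduced_forms d T" "F dvd (f - h) - r"
        using Suc.IH[of "f - h"] homogeneous3_diff[OF Suc.prems(1) homh] by auto
      have "F dvd h" by (simp add: h_def)
      with r(2) have "F dvd ((f - h) - r) + h" by (rule dvd_add)
      then show ?thesis using r(1) by (intro bexI[of _ r]) (auto simp: algebra_simps)
    qed
  qed
  from this[of f "Suc (degree f)"] assms show ?thesis by (auto simp: coeff_eq_0)
qed

end

section \<open>Bezout's inequality for branches\<close>

definition lin3 :: "'k::comm_ring_1 \<Rightarrow> 'k \<Rightarrow> 'k \<Rightarrow> 'k poly3" where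
  "lin3 a b c = const3 a * X3 + const3 b * Y3 + const3 c * Z3"

lemma homogeneous3_lin3: "homogeneous3 1 (lin3 a b c)"
  unfolding lin3_def by (intro homogeneous3_add homogeneous3_const3_mult homogeneous3_vars)

type_synonym 'k germ = "'k fps \<times> 'k fps \<times> 'k fps"

abbreviation evf :: "'k::comm_ring_1 germ \<Rightarrow> 'k poly3 \<Rightarrow> 'k fps" where
  "evf \<gamma> \<equiv> ev3 fps_const (fst \<gamma>) (fst (snd \<gamma>)) (snd (snd \<gamma>))"

lemma comm_ring_hom_evf: "comm_ring_hom (evf \<gamma>)"
  by (intro comm_ring_hom_ev3 comm_ring_hom_fps_const)

interpretation evf: comm_ring_hom "evf \<gamma>" for \<gamma> :: "'k::comm_ring_1 germ"
  by (rule comm_ring_hom_evf)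

lemma evf_base [simp]: "evf \<gamma> (const3 a) = fps_const a" "evf \<gamma> X3 = fst \<gamma>" "evf \<gamma> Y3 = fst (snd \<gamma>)"
  "evf \<gamma> Z3 = snd (snd \<gamma>)"
  by (simp_all add: ev3_const3_X3_Y3_Z3 comm_ring_hom_fps_const)

definition nth3 :: "'k::comm_ring_1 germ \<Rightarrow> nat \<Rightarrow> 'k \<times> 'k \<times> 'k" where
  "nth3 \<gamma> n = (fps_nth (fst \<gamma>) n, fps_nth (fst (snd \<gamma>)) n, fps_nth (snd (snd \<gamma>)) n)"

text \<open>
  The vectors have a nonzero cross product.
\<close>

definition indep3 :: "'k::comm_ring_1 \<times> 'k \<times> 'k \<Rightarrow> 'k \<times> 'k \<times> 'k \<Rightarrow> bool" where
  "indep3 = (\<lambda>(a, b, c) (a', b', c'). a * b' \<noteq> b * a' \<or> b * c' \<noteq> c * b' \<or> c * a' \<noteq> a * c')"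

lemma nth_evf_lin3:
  "fps_nth (evf \<gamma> (lin3 a b c)) n = (case nth3 \<gamma> n of (x, y, z) \<Rightarrow> a * x + b * y + c * z)"
proof -
  show ?thesis by (simp add: lin3_def evf.hom_add evf.hom_mult nth3_def)
qed

lemma not_indep3_proportional:
  fixes x y z x' y' z' :: "'k::field"
  assumes "\<not> indep3 (x, y, z) (x', y', z')" and "(x, y, z) \<noteq> (0, 0, 0)"
  shows "\<exists>c. x' = c * x \<and> y' = c * y \<and> z' = c * z"
proof -
  have eq: "x * y' = y * x'" "y * z' = z * y'" "z * x' = x * z'" using assms(1) by (auto simp: indep3_def)
  consider "x \<noteq> 0" | "y \<noteq> 0" | "z \<noteq> 0" using assms(2) by auto
  then show ?thesis
  proof cases
    case 1 then show ?thesis using eq by (intro exI[of _ "x' / x"]) (auto simp: field_simps)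
  next
    case 2 then show ?thesis using eq by (intro exI[of _ "y' / y"]) (auto simp: field_simps)
  next
    case 3 then show ?thesis using eq by (intro exI[of _ "z' / z"]) (auto simp: field_simps)
  qed
qed

text \<open>
  The vectors \<open>e\<^sub>i \<times> n\<close> are orthogonal to \<open>n\<close>, and \<open>v \<times> (e\<^sub>i \<times> n) = - v\<^sub>i n\<close> because \<open>v\<close> is orthogonal to \<open>n\<close>;
  so one works for which \<open>v\<^sub>i \<noteq> 0\<close>.
\<close>

lemma orthogonal_independent:
  fixes v1 v2 v3 n1 n2 n3 :: "'k::field"
  assumes orth: "v1 * n1 + v2 * n2 + v3 * n3 = 0"
    and v0: "(v1, v2, v3) \<noteq> (0, 0, 0)" and n0: "(n1, n2, n3) \<noteq> (0, 0, 0)"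
  obtains w1 w2 w3 where "w1 * n1 + w2 * n2 + w3 * n3 = 0" "indep3 (v1, v2, v3) (w1, w2, w3)"
proof -
  consider "v1 \<noteq> 0" | "v2 \<noteq> 0" | "v3 \<noteq> 0" using v0 by auto
  then show ?thesis
  proof cases
    case 1
    have "indep3 (v1, v2, v3) (0, - n3, n2)"
    proof (rule ccontr)
      assume "\<not> ?thesis"
      then have "n3 = 0" "n2 = 0" using 1 by (auto simp: indep3_def)
      then show False using orth 1 n0 by auto
    qed
    then show ?thesis using that[of 0 "- n3" n2] by simp
  next
    case 2
    have "indep3 (v1, v2, v3) (n3, 0, - n1)"
    proof (rule ccontr)
      assume "\<not> ?thesis"
      then have "n3 = 0" "n1 = 0" using 2 by (auto simp: indep3_def)
      then show False using orth 2 n0 by auto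
    qed
    then show ?thesis using that[of n3 0 "- n1"] by simp
  next
    case 3
    have "indep3 (v1, v2, v3) (- n2, n1, 0)"
    proof (rule ccontr)
      assume "\<not> ?thesis"
      then have "n1 = 0" "n2 = 0" using 3 by (auto simp: indep3_def)
      then show False using orth 3 n0 by auto
    qed
    then show ?thesis using that[of "- n2" n1 0] by simp
  qed
qed

lemma indep3_separate:
  fixes v w :: "'k::comm_ring_1 \<times> 'k \<times> 'k"
  assumes "indep3 v w"
  shows "\<exists>a b c. (case v of (x, y, z) \<Rightarrow> a * x + b * y + c * z) = 0 \<and>
    (case w of (x, y, z) \<Rightarrow> a * x + b * y + c * z) \<noteq> 0"
proof -
  obtain v1 v2 v3 w1 w2 w3 where vw: "v = (v1, v2, v3)" "w = (w1, w2, w3)" by (metis prod.exhaust)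
  consider "v1 * w2 - v2 * w1 \<noteq> 0" | "v2 * w3 - v3 * w2 \<noteq> 0" | "v3 * w1 - v1 * w3 \<noteq> 0"
    using assms by (auto simp: indep3_def vw)
  then show ?thesis
  proof cases
    case 1 then show ?thesis unfolding vw
      by (intro exI[of _ "- v2"] exI[of _ v1] exI[of _ 0]) (auto simp: algebra_simps)
  next
    case 2 then show ?thesis unfolding vw
      by (intro exI[of _ 0] exI[of _ "- v3"] exI[of _ v2]) (auto simp: algebra_simps)
  next
    case 3 then show ?thesis unfolding vw
      by (intro exI[of _ v3] exI[of _ 0] exI[of _ "- v1"]) (auto simp: algebra_simps)
  qed
qed

text \<open>
  A parametrised piece \<open>\<gamma>(t)\<close> of the curve. Independence of \<open>\<gamma>(0)\<close> and \<open>\<gamma>'(0)\<close> says that \<open>t\<close> is a local parameter of the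
  projective curve: some linear form vanishes along \<open>\<gamma>\<close> to order exactly 1.
\<close>

definition branch :: "'k::idom poly3 \<Rightarrow> 'k germ \<Rightarrow> bool" where
  "branch F \<gamma> \<longleftrightarrow> evf \<gamma> F = 0 \<and> indep3 (nth3 \<gamma> 0) (nth3 \<gamma> 1)"

context monic_form
begin

text \<open>
  Jets at different branches can be prescribed independently once the degree is large. The form is a product of
  lines: through the base point of every other branch \<open>\<delta>\<close>, taken \<open>k \<delta>\<close> times; through \<open>\<gamma>(0)\<close> but not tangent to \<open>\<gamma>\<close>,
  taken \<open>e\<close> times; and lines off \<open>\<gamma>(0)\<close> that fill up the degree.
\<close>

lemma exists_form_with_prescribed_jets:
  assumes S: "finite S" "\<gamma> \<in> S" and br: "\<And>\<gamma>. \<gamma> \<in> S \<Longrightarrow> branch F \<gamma>"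
    and dist: "\<And>\<gamma> \<delta>. \<gamma> \<in> S \<Longrightarrow> \<delta> \<in> S \<Longrightarrow> \<gamma> \<noteq> \<delta> \<Longrightarrow> indep3 (nth3 \<gamma> 0) (nth3 \<delta> 0)"
    and T: "T \<ge> sum k S" and e: "e < k \<gamma>"
  shows "\<exists>E. homogeneous3 T E \<and> (\<forall>\<delta>\<in>S - {\<gamma>}. fps_X ^ k \<delta> dvd evf \<delta> E) \<and>
    fps_X ^ e dvd evf \<gamma> E \<and> fps_nth (evf \<gamma> E) e \<noteq> 0"
proof -
  have "\<exists>l. homogeneous3 1 l \<and> fps_nth (evf \<delta> l) 0 = 0 \<and> fps_nth (evf \<gamma> l) 0 \<noteq> 0" if "\<delta> \<in> S - {\<gamma>}" for \<delta>
    using indep3_separate[OF dist[of \<delta> \<gamma>]] S that by (metis homogeneous3_lin3 nth_evf_lin3 DiffD1 DiffD2 singletonI)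
  then obtain l where l: "\<And>\<delta>. \<delta> \<in> S - {\<gamma>} \<Longrightarrow> homogeneous3 1 (l \<delta>)"
    "\<And>\<delta>. \<delta> \<in> S - {\<gamma>} \<Longrightarrow> fps_nth (evf \<delta> (l \<delta>)) 0 = 0"
    "\<And>\<delta>. \<delta> \<in> S - {\<gamma>} \<Longrightarrow> fps_nth (evf \<gamma> (l \<delta>)) 0 \<noteq> 0" by metis
  obtain u where u: "homogeneous3 1 u" "fps_nth (evf \<gamma> u) 0 = 0" "fps_nth (evf \<gamma> u) 1 \<noteq> 0"
    using indep3_separate[of "nth3 \<gamma> 0" "nth3 \<gamma> 1"] br[OF S(2)] unfolding branch_def
    by (metis homogeneous3_lin3 nth_evf_lin3)
  obtain h where h: "homogeneous3 1 h" "fps_nth (evf \<gamma> h) 0 \<noteq> 0"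
  proof -
    have "fps_nth (fst \<gamma>) 0 \<noteq> 0 \<or> fps_nth (fst (snd \<gamma>)) 0 \<noteq> 0 \<or> fps_nth (snd (snd \<gamma>)) 0 \<noteq> 0"
      using br[OF S(2)] by (auto simp: branch_def indep3_def nth3_def)
    then show ?thesis using that homogeneous3_vars evf_base(2-4) by metis
  qed
  define r where "r = T - (sum k (S - {\<gamma>}) + e)"
  have "sum k S = k \<gamma> + sum k (S - {\<gamma>})" using S by (simp add: sum.remove)
  then have r: "sum k (S - {\<gamma>}) + (e + r) = T" using T e by (simp add: r_def)
  define P where "P = (\<Prod>\<delta>\<in>S - {\<gamma>}. l \<delta> ^ k \<delta>)"
  define E where "E = P * (u ^ e * h ^ r)"
  have "homogeneous3 (\<Sum>\<delta>\<in>S - {\<gamma>}. k \<delta> * 1) P"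
    unfolding P_def by (intro homogeneous3_prod homogeneous3_power l(1))
  then have "homogeneous3 ((\<Sum>\<delta>\<in>S - {\<gamma>}. k \<delta>) + (e * 1 + r * 1)) E"
    unfolding E_def by (intro homogeneous3_mult homogeneous3_power u h) simp
  then have 1: "homogeneous3 T E" using r by simp
  have 2: "fps_X ^ k \<delta> dvd evf \<delta> E" if d: "\<delta> \<in> S - {\<gamma>}" for \<delta>
  proof -
    have "fps_X dvd evf \<delta> (l \<delta>)" using l(2)[OF d] fps_X_power_dvd_iff_nth[of 1 "evf \<delta> (l \<delta>)"] by simp
    then have "fps_X ^ k \<delta> dvd evf \<delta> (l \<delta> ^ k \<delta>)" by (simp add: evf.hom_power dvd_power_same)
    moreover have "l \<delta> ^ k \<delta> dvd P" unfolding P_def using d S by (intro dvd_prodI) auto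
    then have "evf \<delta> (l \<delta> ^ k \<delta>) dvd evf \<delta> E" unfolding E_def by (auto simp: evf.hom_mult)
    ultimately show ?thesis by (rule dvd_trans)
  qed
  have u': "fps_X ^ e dvd evf \<gamma> u ^ e"
    using u(2) fps_X_power_dvd_iff_nth[of 1 "evf \<gamma> u"] by (simp add: dvd_power_same)
  have ue: "fps_nth (evf \<gamma> u ^ e) e \<noteq> 0" for e
  proof (induction e)
    case (Suc e)
    have "fps_X ^ 1 dvd evf \<gamma> u" "fps_X ^ e dvd evf \<gamma> u ^ e"
      using u(2) fps_X_power_dvd_iff_nth[of 1 "evf \<gamma> u"] by (simp_all add: dvd_power_same)
    from fps_mult_nth_lowest[OF this] u(3) Suc show ?case by simp
  qed simp
  have "fps_nth (evf \<gamma> P) 0 \<noteq> 0" "fps_nth (evf \<gamma> (h ^ r)) 0 \<noteq> 0"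
    using l(3) h(2) S by (auto simp: P_def evf.hom_prod evf.hom_power fps_nth_power_0 fps_nth_0_prod)
  then have "fps_nth (evf \<gamma> (P * h ^ r)) 0 \<noteq> 0" by (simp add: evf.hom_mult)
  then have "fps_nth (evf \<gamma> (P * h ^ r) * evf \<gamma> u ^ e) (0 + e) \<noteq> 0"
    using ue u' by (subst fps_mult_nth_lowest) auto
  moreover have E': "evf \<gamma> E = evf \<gamma> (P * h ^ r) * evf \<gamma> u ^ e"
    by (simp add: E_def evf.hom_mult evf.hom_power algebra_simps)
  ultimately have "fps_nth (evf \<gamma> E) e \<noteq> 0" by simp
  moreover have "fps_X ^ e dvd evf \<gamma> E" unfolding E' using u' by simp
  ultimately show ?thesis using 1 2 by (intro exI[of _ E]) blast
qed

text \<open>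
  Modulo \<open>F\<close>, the multiples of \<open>A\<close> have codimension \<open>d M\<close> among the forms of a large degree \<open>T\<close>, and they all
  vanish to order \<open>k \<gamma>\<close> along \<open>\<gamma>\<close>. The forms with prescribed jets show that these vanishing conditions are independent,
  so there are at most \<open>d M\<close> of them. Over a finite field the dimensions are compared by counting: linear combinations
  of the jet forms plus multiples of \<open>A\<close> are pairwise incongruent modulo \<open>F\<close>.
\<close>

lemma bezout:
  assumes S: "finite S" and br: "\<And>\<gamma>. \<gamma> \<in> S \<Longrightarrow> branch F \<gamma>"
    and dist: "\<And>\<gamma> \<delta>. \<gamma> \<in> S \<Longrightarrow> \<delta> \<in> S \<Longrightarrow> \<gamma> \<noteq> \<delta> \<Longrightarrow> indep3 (nth3 \<gamma> 0) (nth3 \<delta> 0)"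
    and A: "homogeneous3 M A" "\<not> F dvd A"
    and van: "\<And>\<gamma>. \<gamma> \<in> S \<Longrightarrow> fps_X ^ k \<gamma> dvd evf \<gamma> A"
  shows "sum k S \<le> d * M"
proof -
  let ?p = "CARD('p mod_ring)"
  \<comment> \<open>large enough for the jet forms, and for the dimension formula in degrees \<open>T\<close> and \<open>T - M\<close>\<close>
  define T where "T = M + sum k S + d"
  define Q where "Q = (SIGMA \<gamma>:S. {..<k \<gamma>})"
  have finQ: "finite Q" unfolding Q_def using S by auto
  have "\<exists>E. homogeneous3 T E \<and> (\<forall>\<delta>\<in>S - {fst q}. fps_X ^ k \<delta> dvd evf \<delta> E) \<and>
    fps_X ^ snd q dvd evf (fst q) E \<and> fps_nth (evf (fst q) E) (snd q) \<noteq> 0" if "q \<in> Q" for q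
    using that by (intro exists_form_with_prescribed_jets S br dist) (auto simp: Q_def T_def)
  then obtain E where E: "\<And>q. q \<in> Q \<Longrightarrow> homogeneous3 T (E q)"
    "\<And>q \<delta>. q \<in> Q \<Longrightarrow> \<delta> \<in> S - {fst q} \<Longrightarrow> fps_X ^ k \<delta> dvd evf \<delta> (E q)"
    "\<And>q. q \<in> Q \<Longrightarrow> fps_X ^ snd q dvd evf (fst q) (E q)"
    "\<And>q. q \<in> Q \<Longrightarrow> fps_nth (evf (fst q) (E q)) (snd q) \<noteq> 0" by metis
  define \<Psi> where "\<Psi> = (\<lambda>(c, B). (\<Sum>q\<in>Q. const3 (c q) * E q) + A * B)"
  define D where "D = (Q \<rightarrow>\<^sub>E (UNIV :: 'p mod_ring set)) \<times> (reduced_forms d (T - M) :: 'p mod_ring poly3 set)"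
  have "homogeneous3 T (\<Psi> cB)" if "cB \<in> D" for cB
  proof -
    obtain c B where cB: "cB = (c, B)" by (cases cB)
    then have "homogeneous3 (M + (T - M)) (A * B)"
      using that A by (intro homogeneous3_mult) (auto simp: D_def reduced_forms_def)
    moreover have "M + (T - M) = T" by (simp add: T_def)
    ultimately show ?thesis unfolding \<Psi>_def cB
      using E(1) by (auto intro!: homogeneous3_add homogeneous3_sum homogeneous3_const3_mult)
  qed
  then have "\<exists>r. r \<in> reduced_forms d T \<and> F dvd \<Psi> cB - r" if "cB \<in> D" for cB
    using exists_reduced that by blast
  then obtain red where red: "\<And>cB. cB \<in> D \<Longrightarrow> red cB \<in> reduced_forms d T"
    "\<And>cB. cB \<in> D \<Longrightarrow> F dvd \<Psi> cB - red cB" by metis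
  have "inj_on red D"
  proof (rule inj_onI)
    fix x y assume xy: "x \<in> D" "y \<in> D" "red x = red y"
    obtain c B c' B' where x: "x = (c, B)" and y: "y = (c', B')" by (metis prod.exhaust)
    have "F dvd (\<Psi> x - red x) - (\<Psi> y - red y)" using red(2)[OF xy(1)] red(2)[OF xy(2)] by (rule dvd_diff)
    then have "F dvd \<Psi> x - \<Psi> y" using xy by (simp add: algebra_simps)
    moreover have "\<Psi> x - \<Psi> y = (\<Sum>q\<in>Q. const3 (c q - c' q) * E q) + A * (B - B')"
    proof -
      have "const3 (c q - c' q) = const3 (c q) - const3 (c' q)" for q by (simp add: const3_def)
      then have "(\<Sum>q\<in>Q. const3 (c q - c' q) * E q)
        = (\<Sum>q\<in>Q. const3 (c q) * E q) - (\<Sum>q\<in>Q. const3 (c' q) * E q)"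
        by (simp only: left_diff_distrib sum_subtractf)
      then show ?thesis unfolding \<Psi>_def x y by (simp add: algebra_simps)
    qed
    ultimately have dv: "F dvd (\<Sum>q\<in>Q. const3 (c q - c' q) * E q) + A * (B - B')" by simp
    have z: "c (\<gamma>, i) = c' (\<gamma>, i)" if g: "\<gamma> \<in> S" and "i < k \<gamma>" for \<gamma> i
      using that(2)
    proof (induction i rule: less_induct)
      case (less i)
      have "evf \<gamma> F = 0" using br[OF g] by (simp add: branch_def)
      with dv have "evf \<gamma> ((\<Sum>q\<in>Q. const3 (c q - c' q) * E q) + A * (B - B')) = 0"
        by (auto simp only: evf.hom_mult mult_zero_left elim!: dvdE)
      then have 0: "(\<Sum>q\<in>Q. fps_const (c q - c' q) * evf \<gamma> (E q)) + evf \<gamma> (A * (B - B')) = 0"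
        by (simp only: evf.hom_add evf.hom_sum evf.hom_mult[of _ "const3 a" for a] evf_base)
      have "fps_X ^ k \<gamma> dvd evf \<gamma> (A * (B - B'))" using van[OF g] by (simp add: evf.hom_mult)
      then have a: "fps_nth (evf \<gamma> (A * (B - B'))) i = 0" using less.prems by (simp add: fps_X_power_dvd_iff_nth)
      have "(\<gamma>, i) \<in> Q" using g less.prems by (simp add: Q_def)
      have "(c q - c' q) * fps_nth (evf \<gamma> (E q)) i = 0" if q: "q \<in> Q - {(\<gamma>, i)}" for q
      proof (cases "fst q = \<gamma>")
        case False
        then have "fps_X ^ k \<gamma> dvd evf \<gamma> (E q)" using E(2) q g by auto
        then show ?thesis using less.prems by (simp add: fps_X_power_dvd_iff_nth)
      next
        case True
        show ?thesis
        proof (cases "snd q < i")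
          case t: True
          then have "c (\<gamma>, snd q) = c' (\<gamma>, snd q)" using less by auto
          then show ?thesis using True by (metis eq_iff_diff_eq_0 mult_zero_left prod.collapse)
        next
          case False
          then have "i < snd q" using q True by (cases q) auto
          then show ?thesis using E(3)[of q] q True by (simp add: fps_X_power_dvd_iff_nth)
        qed
      qed
      then have "(\<Sum>q\<in>Q. (c q - c' q) * fps_nth (evf \<gamma> (E q)) i)
        = (c (\<gamma>, i) - c' (\<gamma>, i)) * fps_nth (evf \<gamma> (E (\<gamma>, i))) i"
        using finQ \<open>(\<gamma>, i) \<in> Q\<close> by (subst sum.remove[of _ "(\<gamma>, i)"]) (auto simp: sum.neutral)
      moreover have "(\<Sum>q\<in>Q. (c q - c' q) * fps_nth (evf \<gamma> (E q)) i) = 0"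
        using arg_cong[OF 0, of "\<lambda>f. fps_nth f i"] a by (simp add: fps_sum_nth)
      ultimately show ?case using E(4)[OF \<open>(\<gamma>, i) \<in> Q\<close>] by simp
    qed
    have "c q = c' q" for q
    proof (cases "q \<in> Q")
      case True then show ?thesis using z by (auto simp: Q_def)
    next
      case False
      then have "c q = undefined" "c' q = undefined"
        using xy by (auto simp only: D_def x y mem_Sigma_iff elim: PiE_arb)
      then show ?thesis by simp
    qed
    then have cc: "c = c'" by auto
    with dv have "F dvd A * (B - B')" by (simp add: const3_def)
    then have "F dvd B - B'" using prime_F A(2) by (simp add: prime_elem_dvd_mult_iff)
    moreover have "B - B' \<in> reduced_forms d (T - M)"
      using xy by (auto simp: D_def x y intro: reduced_forms_diff)
    ultimately have "B - B' = 0" using dvd_reduced_zero unfolding reduced_forms_def by blast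
    with cc show "x = y" by (simp add: x y)
  qed
  moreover have "red ` D \<subseteq> reduced_forms d T" using red(1) by auto
  moreover have "finite (reduced_forms d T :: 'p mod_ring poly3 set)"
    using card_reduced_forms[where ?'k = "'p mod_ring", of d T] by (intro card_ge_0_finite) simp
  ultimately have "card D \<le> card (reduced_forms d T :: 'p mod_ring poly3 set)"
    by (rule card_inj_on_le)
  moreover have "card D = ?p ^ (card Q + card (exponents3 d (T - M)))"
    unfolding D_def by (simp add: card_cartesian_product card_PiE finQ card_reduced_forms power_add)
  ultimately have "?p ^ (card Q + card (exponents3 d (T - M))) \<le> ?p ^ card (exponents3 d T)"
    by (simp add: card_reduced_forms)
  moreover have "1 < ?p" using prime_card[where ?'a = 'p] prime_gt_1_nat by simp
  ultimately have le: "card Q + card (exponents3 d (T - M)) \<le> card (exponents3 d T)"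
    by (simp add: power_increasing_iff)
  have "card Q = sum k S" unfolding Q_def using S by simp
  moreover have "2 * card (exponents3 d (T - M)) + d * (d - 1) = 2 * d * (T - M + 1)"
    "2 * card (exponents3 d T) + d * (d - 1) = 2 * d * (T + 1)"
    by (rule card_exponents3_eq, simp add: T_def)+
  moreover have "2 * d * (T + 1) = 2 * d * (T - M + 1) + 2 * (d * M)"
    by (simp add: T_def algebra_simps)
  ultimately show ?thesis using le by linarith
qed

end

section \<open>Branches at smooth points\<close>

lemma poly_diff_dvd: "x - y dvd poly G x - poly G y" for x :: "'a::comm_ring_1"
proof (induction G)
  case (pCons a G)
  have "poly (pCons a G) x - poly (pCons a G) y = (x - y) * poly G x + y * (poly G x - poly G y)"
    by (simp add: algebra_simps)
  then show ?case using pCons.IH by simp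
qed simp

lemma poly_taylor2_dvd: "\<delta>\<^sup>2 dvd poly G (h + \<delta>) - poly G h - poly (pderiv G) h * \<delta>"
  for h :: "'a::idom"
proof (induction G)
  case (pCons a G)
  have "poly (pCons a G) (h + \<delta>) - poly (pCons a G) h - poly (pderiv (pCons a G)) h * \<delta>
    = (h + \<delta>) * (poly G (h + \<delta>) - poly G h - poly (pderiv G) h * \<delta>) + \<delta>\<^sup>2 * poly (pderiv G) h"
    by (simp add: pderiv_pCons algebra_simps power2_eq_square)
  then show ?case using pCons.IH by simp
qed simp

text \<open>
  Newton's iteration, one coefficient at a time: \<open>G(h + \<delta>) = G(h) + G'(h) \<delta>\<close> up to a multiple of \<open>\<delta>\<^sup>2\<close>, and \<open>G'(h)\<close> is a
  unit. The iterates stabilise coefficientwise.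
\<close>

lemma fps_hensel:
  fixes G :: "'a::field fps poly"
  assumes 0: "fps_nth (poly G 0) 0 = 0" and 1: "fps_nth (poly (pderiv G) 0) 0 \<noteq> 0"
  shows "\<exists>h. fps_nth h 0 = 0 \<and> poly G h = 0"
proof -
  define c where "c = fps_nth (poly (pderiv G) 0) 0"
  have dvd0: "fps_X ^ n dvd g \<longleftrightarrow> (\<forall>i<n. fps_nth g i = 0)" for n and g :: "'a fps"
    by (rule fps_X_power_dvd_iff_nth)
  let ?P = "\<lambda>n h. fps_nth h 0 = 0 \<and> fps_X ^ Suc n dvd poly G h"
  have step: "\<exists>h'. ?P (Suc n) h' \<and> fps_X ^ Suc n dvd h' - h" if h: "?P n h" for n h
  proof -
    define a where "a = - fps_nth (poly G h) (Suc n) / c"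
    define \<delta> where "\<delta> = fps_const a * fps_X ^ Suc n"
    have dd: "fps_X ^ Suc n dvd \<delta>" by (simp add: \<delta>_def)
    have "fps_X ^ Suc (Suc n) dvd \<delta>\<^sup>2"
      unfolding \<delta>_def power_mult_distrib power_mult[symmetric]
      by (intro dvd_mult le_imp_power_dvd) simp
    then have t: "fps_X ^ Suc (Suc n) dvd poly G (h + \<delta>) - poly G h - poly (pderiv G) h * \<delta>"
      using poly_taylor2_dvd dvd_trans by blast
    have "fps_X dvd poly (pderiv G) h - poly (pderiv G) 0"
      using poly_diff_dvd[of h 0 "pderiv G"] h dvd0[of 1 h] dvd_trans[of fps_X h] by simp
    then have ch: "fps_nth (poly (pderiv G) h) 0 = c"
      using dvd0[of 1 "poly (pderiv G) h - poly (pderiv G) 0"] by (simp add: c_def)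
    have "fps_nth (poly G h + poly (pderiv G) h * \<delta>) i = 0" if "i < Suc (Suc n)" for i
    proof (cases "i = Suc n")
      case True
      have "fps_nth (poly (pderiv G) h * \<delta>) (0 + Suc n) = fps_nth (poly (pderiv G) h) 0 * fps_nth \<delta> (Suc n)"
        by (rule fps_mult_nth_lowest) (use dd in auto)
      also have "\<dots> = c * a" by (simp add: ch \<delta>_def)
      finally show ?thesis using True 1 by (simp add: a_def c_def)
    next
      case False
      then have "i < Suc n" using that by simp
      moreover have "fps_X ^ Suc n dvd poly G h + poly (pderiv G) h * \<delta>" using h dd by simp
      ultimately show ?thesis unfolding dvd0 by blast
    qed
    then have "fps_X ^ Suc (Suc n) dvd poly G h + poly (pderiv G) h * \<delta>" unfolding dvd0 by blast
    from dvd_add[OF t this] have "fps_X ^ Suc (Suc n) dvd poly G (h + \<delta>)" by simp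
    then show ?thesis using h dd by (intro exI[of _ "h + \<delta>"]) (auto simp: \<delta>_def)
  qed
  have "\<exists>h. ?P 0 h" using 0 dvd0[of 1 "poly G 0"] by (intro exI[of _ 0]) simp
  then have "\<exists>h. \<forall>n. ?P n (h n) \<and> fps_X ^ Suc n dvd h (Suc n) - h n"
    by (intro dependent_nat_choice) (use step in auto)
  then obtain h where h: "\<And>n. ?P n (h n)" "\<And>n. fps_X ^ Suc n dvd h (Suc n) - h n" by blast
  define H where "H = Abs_fps (\<lambda>i. fps_nth (h i) i)"
  have stable: "fps_nth (h (n + m)) i = fps_nth (h n) i" if "i \<le> n" for n m i
  proof (induction m)
    case (Suc m)
    have "fps_nth (h (Suc (n + m)) - h (n + m)) i = 0"
      using h(2)[of "n + m"] that unfolding dvd0 by simp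
    then show ?case using Suc by simp
  qed simp
  have Hh: "fps_X ^ Suc n dvd H - h n" for n
    unfolding dvd0
  proof (intro allI impI)
    fix i assume "i < Suc n"
    then show "fps_nth (H - h n) i = 0" using stable[of i i "n - i"] by (simp add: H_def)
  qed
  have "fps_X ^ Suc n dvd poly G H" for n
  proof -
    have "fps_X ^ Suc n dvd poly G H - poly G (h n)" using poly_diff_dvd Hh dvd_trans by blast
    from dvd_add[OF this] h(1)[of n] show ?thesis by fastforce
  qed
  then have "fps_nth (poly G H) n = 0" for n using dvd0[of "Suc n" "poly G H"] by simp
  then have "poly G H = 0" by (intro fps_ext) simp
  moreover have "fps_nth H 0 = 0" using h(1)[of 0] by (simp add: H_def)
  ultimately show ?thesis by blast
qed

lemma fps_nth_0_evf:
  "fps_nth (evf \<gamma> f) 0 = ev3 (\<lambda>x. x) (fps_nth (fst \<gamma>) 0) (fps_nth (fst (snd \<gamma>)) 0) (fps_nth (snd (snd \<gamma>)) 0) f"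
proof (rule poly3_hom_unique)
  show "comm_ring_hom (\<lambda>f. fps_nth (evf \<gamma> f) 0)"
    by unfold_locales (simp_all add: evf.hom_add evf.hom_mult)
qed (simp_all add: comm_ring_hom_ev3 comm_ring_hom_id ev3_const3_X3_Y3_Z3)

lemma deriv_evf:
  fixes f :: "'k::idom poly3"
  shows "fps_deriv (evf \<gamma> f) = evf \<gamma> (dx3 f) * fps_deriv (fst \<gamma>)
    + evf \<gamma> (dy3 f) * fps_deriv (fst (snd \<gamma>)) + evf \<gamma> (dz3 f) * fps_deriv (snd (snd \<gamma>))"
  by (rule derivation_ev3[OF comm_ring_hom_fps_const]) (simp_all add: algebra_simps)

lemma euler_evf:
  assumes "homogeneous3 m f"
  shows "fst \<gamma> * evf \<gamma> (dx3 f) + fst (snd \<gamma>) * evf \<gamma> (dy3 f) + snd (snd \<gamma>) * evf \<gamma> (dz3 f)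
    = of_nat m * evf \<gamma> f"
proof -
  show ?thesis using arg_cong[OF euler3[OF assms], of "evf \<gamma>"]
    by (simp add: evf.hom_add evf.hom_mult fps_of_nat)
qed

definition smooth_branch :: "'k::idom poly3 \<Rightarrow> 'k germ \<Rightarrow> bool" where
  "smooth_branch F \<gamma> \<longleftrightarrow> branch F \<gamma> \<and>
    (fps_nth (evf \<gamma> (dx3 F)) 0 \<noteq> 0 \<or> fps_nth (evf \<gamma> (dy3 F)) 0 \<noteq> 0 \<or> fps_nth (evf \<gamma> (dz3 F)) 0 \<noteq> 0)"

lemma smooth_branch_imp_branch: "smooth_branch F \<gamma> \<Longrightarrow> branch F \<gamma>"
  by (simp add: smooth_branch_def)

text \<open>
  Along a branch the gradient of \<open>F\<close> is orthogonal to \<open>\<gamma>\<close>, by Euler's identity, and to \<open>\<gamma>'\<close>, by differentiating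
  \<open>F(\<gamma>) = 0\<close>. So it is a multiple of \<open>\<gamma> \<times> \<gamma>'\<close>; neither vector vanishes at \<open>t = 0\<close>, hence the factor is a unit.
\<close>

lemma smooth_branch_cross_gradient:
  fixes F :: "'k::field poly3"
  assumes F: "homogeneous3 d F" and sb: "smooth_branch F \<gamma>"
  shows "\<exists>\<kappa>. fps_nth \<kappa> 0 \<noteq> 0 \<and>
    evf \<gamma> (dx3 F) = \<kappa> * (fst (snd \<gamma>) * fps_deriv (snd (snd \<gamma>)) - snd (snd \<gamma>) * fps_deriv (fst (snd \<gamma>))) \<and>
    evf \<gamma> (dy3 F) = \<kappa> * (snd (snd \<gamma>) * fps_deriv (fst \<gamma>) - fst \<gamma> * fps_deriv (snd (snd \<gamma>))) \<and>
    evf \<gamma> (dz3 F) = \<kappa> * (fst \<gamma> * fps_deriv (fst (snd \<gamma>)) - fst (snd \<gamma>) * fps_deriv (fst \<gamma>))"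
proof -
  obtain x y z where \<gamma>: "\<gamma> = (x, y, z)" by (metis prod.exhaust)
  let ?x' = "fps_deriv x" and ?y' = "fps_deriv y" and ?z' = "fps_deriv z"
  define A where "A = evf \<gamma> (dx3 F)"
  define B where "B = evf \<gamma> (dy3 F)"
  define C where "C = evf \<gamma> (dz3 F)"
  define P where "P = y * ?z' - z * ?y'"
  define Q where "Q = z * ?x' - x * ?z'"
  define R where "R = x * ?y' - y * ?x'"
  have 1: "x * A + y * B + z * C = 0"
    using euler_evf[OF F, of \<gamma>] sb by (simp add: A_def B_def C_def \<gamma> smooth_branch_def branch_def)
  have 2: "?x' * A + ?y' * B + ?z' * C = 0"
    using deriv_evf[of \<gamma> F] sb by (simp add: A_def B_def C_def \<gamma> smooth_branch_def branch_def mult.commute)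
  have rel: "C * P = A * R" "C * Q = B * R" "A * Q = B * P"
  proof -
    have zC: "z * C = - (x * A) - y * B" "?z' * C = - (?x' * A) - ?y' * B"
      using 1 2 by (simp_all add: algebra_simps eq_neg_iff_add_eq_0)
    have "C * P = y * (?z' * C) - ?y' * (z * C)" by (simp add: P_def algebra_simps)
    then show "C * P = A * R" unfolding zC by (simp add: R_def algebra_simps)
    have "C * Q = ?x' * (z * C) - x * (?z' * C)" by (simp add: Q_def algebra_simps)
    then show "C * Q = B * R" unfolding zC by (simp add: R_def algebra_simps)
    have xA: "x * A = - (y * B) - z * C" "?x' * A = - (?y' * B) - ?z' * C"
      using 1 2 by (simp_all add: algebra_simps eq_neg_iff_add_eq_0)
    have "A * Q = z * (?x' * A) - ?z' * (x * A)" by (simp add: Q_def algebra_simps)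
    then show "A * Q = B * P" unfolding xA by (simp add: P_def algebra_simps)
  qed
  have pqr: "fps_nth P 0 \<noteq> 0 \<or> fps_nth Q 0 \<noteq> 0 \<or> fps_nth R 0 \<noteq> 0"
    using sb by (auto simp: smooth_branch_def branch_def indep3_def nth3_def \<gamma> P_def Q_def R_def)
  have abc: "fps_nth A 0 \<noteq> 0 \<or> fps_nth B 0 \<noteq> 0 \<or> fps_nth C 0 \<noteq> 0"
    using sb by (simp add: smooth_branch_def branch_def A_def B_def C_def)
  have "\<exists>\<kappa>. fps_nth \<kappa> 0 \<noteq> 0 \<and> A = \<kappa> * P \<and> B = \<kappa> * Q \<and> C = \<kappa> * R"
  proof -
    \<comment> \<open>a combination \<open>L\<close> of the components of \<open>\<gamma> \<times> \<gamma>'\<close> that is a unit\<close>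
    have "\<exists>a b c. fps_nth (a * P + b * Q + c * R) 0 \<noteq> 0"
      using pqr by (metis add.left_neutral add.right_neutral mult_1 mult_zero_left)
    then obtain a b c where unit: "fps_nth (a * P + b * Q + c * R) 0 \<noteq> 0" by blast
    define L where "L = a * P + b * Q + c * R"
    define E where "E = a * A + b * B + c * C"
    have i: "inverse L * L = 1" using inverse_mult_eq_1 unit unfolding L_def by blast
    have "L * A = a * (A * P) + b * (A * Q) + c * (A * R)" "L * B = a * (B * P) + b * (B * Q) + c * (B * R)"
      "L * C = a * (C * P) + b * (C * Q) + c * (C * R)" by (simp_all add: L_def algebra_simps)
    moreover have "a * (A * P) + b * (B * P) + c * (C * P) = E * P" "a * (A * Q) + b * (B * Q) + c * (C * Q) = E * Q"
      "a * (A * R) + b * (B * R) + c * (C * R) = E * R" by (simp_all add: E_def algebra_simps)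
    ultimately have LE: "L * A = E * P" "L * B = E * Q" "L * C = E * R" by (simp_all only: rel)
    have eq: "A = (inverse L * E) * P" "B = (inverse L * E) * Q" "C = (inverse L * E) * R"
      using LE i by (metis mult.assoc mult_1)+
    moreover have "fps_nth (inverse L * E) 0 \<noteq> 0" using abc eq by auto
    ultimately show ?thesis by blast
  qed
  then show ?thesis by (simp add: A_def B_def C_def P_def Q_def R_def \<gamma>)
qed

text \<open>
  The branch is \<open>\<gamma>(t) = v + t w + h(t) u\<close> with \<open>w\<close> a second vector in the tangent plane and \<open>u\<close> outside it; Hensel's lemma
  provides \<open>h\<close>. The linear term of \<open>F(\<gamma>) = 0\<close> shows \<open>h'(0) = 0\<close>, so that \<open>\<gamma>'(0) = w\<close>.
\<close>

lemma exists_branch: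
  fixes F :: "'k::field poly3"
  assumes F: "homogeneous3 d F" and v0: "(v1, v2, v3) \<noteq> (0, 0, 0)"
    and Fv: "ev3 (\<lambda>x. x) v1 v2 v3 F = 0"
    and n: "n1 = ev3 (\<lambda>x. x) v1 v2 v3 (dx3 F)" "n2 = ev3 (\<lambda>x. x) v1 v2 v3 (dy3 F)"
      "n3 = ev3 (\<lambda>x. x) v1 v2 v3 (dz3 F)" and n0: "(n1, n2, n3) \<noteq> (0, 0, 0)"
  shows "\<exists>\<gamma>. nth3 \<gamma> 0 = (v1, v2, v3) \<and> smooth_branch F \<gamma>"
proof -
  interpret ev: comm_ring_hom "ev3 (\<lambda>x::'k. x) v1 v2 v3" by (intro comm_ring_hom_ev3 comm_ring_hom_id)
  have orth: "v1 * n1 + v2 * n2 + v3 * n3 = 0"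
    using arg_cong[OF euler3[OF F], of "ev3 (\<lambda>x. x) v1 v2 v3"] Fv
    by (simp add: ev.hom_add ev.hom_mult n ev3_const3_X3_Y3_Z3 comm_ring_hom_id)
  obtain w1 w2 w3 where w: "w1 * n1 + w2 * n2 + w3 * n3 = 0" "indep3 (v1, v2, v3) (w1, w2, w3)"
    using orthogonal_independent[OF orth v0 n0] by blast
  obtain u1 u2 u3 where u: "u1 * n1 + u2 * n2 + u3 * n3 \<noteq> 0"
  proof -
    consider "n1 \<noteq> 0" | "n2 \<noteq> 0" | "n3 \<noteq> 0" using n0 by auto
    then show ?thesis using that[of 1 0 0] that[of 0 1 0] that[of 0 0 1] by cases auto
  qed
  define l where "l = (\<lambda>a b. fps_const a + fps_X * fps_const b :: 'k fps)"
  define \<gamma> where "\<gamma> = (\<lambda>h. (l v1 w1 + h * fps_const u1, l v2 w2 + h * fps_const u2, l v3 w3 + h * fps_const u3))"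
  define cc where "cc = (\<lambda>a. [:fps_const a:] :: 'k fps poly)"
  have cc: "comm_ring_hom cc" by unfold_locales (auto simp: cc_def one_pCons mult.commute)
  define x where "x = (\<lambda>a b u. [:l a b, fps_const u:])"
  define G where "G = (\<lambda>f. ev3 cc (x v1 w1 u1) (x v2 w2 u2) (x v3 w3 u3) f)"
  have homG: "comm_ring_hom G" unfolding G_def[abs_def] by (intro comm_ring_hom_ev3 cc)
  interpret G: comm_ring_hom G by (rule homG)
  have Gb: "G (const3 a) = cc a" "G X3 = x v1 w1 u1" "G Y3 = x v2 w2 u2" "G Z3 = x v3 w3 u3" for a
    by (simp_all add: G_def ev3_const3_X3_Y3_Z3 cc)
  have polyG: "poly (G f) h = evf (\<gamma> h) f" for f h
  proof (rule poly3_hom_unique)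
    show "comm_ring_hom (\<lambda>f. poly (G f) h)"
      by unfold_locales (simp_all add: G.hom_add G.hom_mult)
  qed (rule comm_ring_hom_evf, simp_all add: Gb, simp_all add: cc_def x_def \<gamma>_def)
  have dG: "pderiv (G F) = G (dx3 F) * [:fps_const u1:] + G (dy3 F) * [:fps_const u2:] + G (dz3 F) * [:fps_const u3:]"
    unfolding G_def by (subst derivation_ev3[where D = pderiv, OF cc])
      (simp_all add: pderiv_add pderiv_mult cc_def x_def pderiv_pCons)
  have base: "fps_nth (evf (\<gamma> h) f) 0 = ev3 (\<lambda>x. x) v1 v2 v3 f" if "fps_nth h 0 = 0" for h f
    using that by (subst fps_nth_0_evf) (simp add: \<gamma>_def l_def)
  have "\<exists>h. fps_nth h 0 = 0 \<and> poly (G F) h = 0"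
  proof (rule fps_hensel)
    show "fps_nth (poly (G F) 0) 0 = 0" by (simp add: polyG base Fv)
    show "fps_nth (poly (pderiv (G F)) 0) 0 \<noteq> 0"
      using u by (simp add: dG polyG base mult.commute flip: n)
  qed
  then obtain h where h: "fps_nth h 0 = 0" "evf (\<gamma> h) F = 0" by (auto simp: polyG)
  have "0 = fps_nth (fps_deriv (evf (\<gamma> h) F)) 0" by (simp add: h)
  also have "\<dots> = n1 * (w1 + fps_nth h 1 * u1) + n2 * (w2 + fps_nth h 1 * u2) + n3 * (w3 + fps_nth h 1 * u3)"
    unfolding deriv_evf using h(1) by (simp add: base flip: n) (simp add: \<gamma>_def l_def)
  also have "\<dots> = (w1 * n1 + w2 * n2 + w3 * n3) + fps_nth h 1 * (u1 * n1 + u2 * n2 + u3 * n3)"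
    by (simp add: algebra_simps)
  finally have h1: "fps_nth h 1 = 0" using u w(1) by simp
  have "nth3 (\<gamma> h) 0 = (v1, v2, v3)" "nth3 (\<gamma> h) 1 = (w1, w2, w3)"
    using h h1 by (simp_all add: nth3_def \<gamma>_def l_def)
  then show ?thesis using h w(2) n0 base[OF h(1)] by (intro exI[of _ "\<gamma> h"]) (simp add: smooth_branch_def branch_def n)
qed

section \<open>Wronskians with a Frobenius row\<close>

lemma det_triangular_rows:
  fixes A B :: "'a::comm_ring_1 mat"
  assumes A: "A \<in> carrier_mat N N" and B: "B \<in> carrier_mat N N"
    and rows: "\<And>k i. k < N \<Longrightarrow> i < N \<Longrightarrow> A $$ (k, i) = (\<Sum>l\<le>k. \<alpha> k l * B $$ (l, i))"
  shows "det A = (\<Prod>k<N. \<alpha> k k) * det B"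
proof -
  define T where "T = mat N N (\<lambda>(k, l). if l \<le> k then \<alpha> k l else 0)"
  have T: "T \<in> carrier_mat N N" by (simp add: T_def)
  have "A = T * B"
  proof (rule eq_matI)
    fix k i assume "k < dim_row (T * B)" "i < dim_col (T * B)"
    then have ki: "k < N" "i < N" using T B by auto
    have "(T * B) $$ (k, i) = (\<Sum>l<N. T $$ (k, l) * B $$ (l, i))"
      using T B ki by (simp add: scalar_prod_def atLeast0LessThan)
    also have "\<dots> = (\<Sum>l\<le>k. T $$ (k, l) * B $$ (l, i))"
      using ki by (intro sum.mono_neutral_right) (auto simp: T_def)
    also have "\<dots> = A $$ (k, i)" using ki rows by (auto simp: T_def intro!: sum.cong)
    finally show "A $$ (k, i) = (T * B) $$ (k, i)" by simp
  qed (use A T B in auto)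
  moreover have "det T = (\<Prod>k<N. \<alpha> k k)"
  proof -
    have "det T = prod_list (diag_mat T)" by (rule det_lower_triangular[of N]) (auto simp: T_def)
    also have "\<dots> = (\<Prod>k<N. \<alpha> k k)" by (auto simp: prod_list_diag_prod T_def atLeast0LessThan)
    finally show ?thesis .
  qed
  ultimately show ?thesis using det_mult[OF T B] by simp
qed

text \<open>
  Iterating a twisted derivation is triangular in the ordinary derivatives, with coefficients that do not depend on
  the function. Hence Wronskians formed with different derivations differ by a fixed factor, the product of the
  diagonal entries.
\<close>

lemma iterated_derivation_triangular:
  fixes s :: "nat \<Rightarrow> 'x \<Rightarrow> 'a::comm_ring_1 fps"
  assumes 0: "\<And>x. x \<in> U \<Longrightarrow> s 0 x = c * u x"
    and Suc: "\<And>k x. x \<in> U \<Longrightarrow> s (Suc k) x = a k * s k x + b * fps_deriv (s k x)"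
  obtains \<alpha> where "\<And>k x. x \<in> U \<Longrightarrow> s k x = (\<Sum>l\<le>k. \<alpha> k l * (fps_deriv ^^ l) (u x))"
    "\<And>k. \<alpha> k k = b ^ k * c"
proof -
  have "\<exists>\<alpha>. (\<forall>x\<in>U. s k x = (\<Sum>l\<le>k. \<alpha> l * (fps_deriv ^^ l) (u x))) \<and> \<alpha> k = b ^ k * c
    \<and> (\<forall>l>k. \<alpha> l = 0)" for k
  proof (induction k)
    case 0
    show ?case using assms(1) by (intro exI[of _ "\<lambda>l. if l = 0 then c else 0"]) auto
  next
    case (Suc k)
    then obtain \<alpha> where \<alpha>: "\<And>x. x \<in> U \<Longrightarrow> s k x = (\<Sum>l\<le>k. \<alpha> l * (fps_deriv ^^ l) (u x))"
      "\<alpha> k = b ^ k * c" "\<And>l. l > k \<Longrightarrow> \<alpha> l = 0" by auto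
    define \<beta> where "\<beta> = (\<lambda>l. a k * \<alpha> l + b * fps_deriv (\<alpha> l) + (if l = 0 then 0 else b * \<alpha> (l - 1)))"
    have "s (Suc k) x = (\<Sum>l\<le>Suc k. \<beta> l * (fps_deriv ^^ l) (u x))" if "x \<in> U" for x
    proof -
      have "s (Suc k) x = (\<Sum>l\<le>k. (a k * \<alpha> l + b * fps_deriv (\<alpha> l)) * (fps_deriv ^^ l) (u x))
        + (\<Sum>l\<le>k. b * \<alpha> l * (fps_deriv ^^ Suc l) (u x))"
        by (simp add: assms(2) that \<alpha>(1) fps_deriv_sum sum_distrib_left sum.distrib algebra_simps)
      also have "(\<Sum>l\<le>k. (a k * \<alpha> l + b * fps_deriv (\<alpha> l)) * (fps_deriv ^^ l) (u x))
        = (\<Sum>l\<le>Suc k. (a k * \<alpha> l + b * fps_deriv (\<alpha> l)) * (fps_deriv ^^ l) (u x))"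
        using \<alpha>(3)[of "Suc k"] by simp
      also have "(\<Sum>l\<le>k. b * \<alpha> l * (fps_deriv ^^ Suc l) (u x))
        = (\<Sum>l\<le>Suc k. (if l = 0 then 0 else b * \<alpha> (l - 1)) * (fps_deriv ^^ l) (u x))"
        by (subst sum.atMost_Suc_shift) simp
      finally show ?thesis by (simp only: \<beta>_def sum.distrib[symmetric] ring_distribs)
    qed
    moreover have "\<beta> (Suc k) = b ^ Suc k * c" using \<alpha>(2) \<alpha>(3)[of "Suc k"] by (simp add: \<beta>_def mult_ac)
    moreover have "\<beta> l = 0" if "l > Suc k" for l
      using that \<alpha>(3)[of l] \<alpha>(3)[of "l - 1"] by (simp add: \<beta>_def)
    ultimately show ?case by (intro exI[of _ \<beta>]) auto
  qed
  then obtain \<alpha> where "\<And>k. (\<forall>x\<in>U. s k x = (\<Sum>l\<le>k. \<alpha> k l * (fps_deriv ^^ l) (u x))) \<and> \<alpha> k k = b ^ k * c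
    \<and> (\<forall>l>k. \<alpha> k l = 0)" by metis
  then show ?thesis using that by blast
qed

lemma fps_nth_X_mult_deriv: "fps_nth (fps_X * fps_deriv g) e = of_nat e * fps_nth g e"
  for g :: "'a::comm_ring_1 fps"
  by (cases e) simp_all

definition falling_poly :: "nat \<Rightarrow> 'a::idom poly" where
  "falling_poly j = (\<Prod>l<j. [:- of_nat l, 1:])"

lemma poly_falling_poly_Suc:
  fixes x :: "'a::idom"
  shows "poly (falling_poly (Suc j)) x = (x - of_nat j) * poly (falling_poly j) x"
proof -
  have "falling_poly (Suc j) = falling_poly j * [:- of_nat j, 1 :: 'a:]"
    by (simp only: falling_poly_def prod.lessThan_Suc)
  then have "poly (falling_poly (Suc j)) x = poly (falling_poly j) x * poly [:- of_nat j, 1:] x"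
    by (simp only: poly_mult)
  then show ?thesis by (simp add: mult.commute)
qed

lemma nth_X_power_iterated_deriv:
  fixes f :: "'a::idom fps"
  shows "fps_nth (fps_X ^ j * (fps_deriv ^^ j) f) e = poly (falling_poly j) (of_nat e) * fps_nth f e"
proof (induction j)
  case 0 show ?case by (simp add: falling_poly_def)
next
  case (Suc j)
  let ?g = "fps_X ^ j * (fps_deriv ^^ j) f"
  have X: "fps_X * fps_deriv (fps_X ^ j) = of_nat j * (fps_X ^ j :: 'a fps)"
    by (intro fps_ext) (auto simp: fps_nth_X_mult_deriv fps_X_power_nth simp flip: fps_of_nat)
  have "fps_X * fps_deriv ?g = fps_X * fps_deriv (fps_X ^ j) * (fps_deriv ^^ j) f
    + fps_X ^ Suc j * (fps_deriv ^^ Suc j) f"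
    by (simp add: algebra_simps)
  then have "fps_X * fps_deriv ?g = of_nat j * ?g + fps_X ^ Suc j * (fps_deriv ^^ Suc j) f"
    by (subst (asm) X) (simp only: mult.assoc)
  then have "fps_X ^ Suc j * (fps_deriv ^^ Suc j) f = fps_X * fps_deriv ?g - of_nat j * ?g" by (simp only: add_diff_cancel_left')
  then have "fps_nth (fps_X ^ Suc j * (fps_deriv ^^ Suc j) f) e = (of_nat e - of_nat j) * fps_nth ?g e"
    by (simp only: fps_sub_nth fps_nth_X_mult_deriv) (simp add: algebra_simps flip: fps_of_nat)
  also have "\<dots> = (of_nat e - of_nat j) * poly (falling_poly j) (of_nat e) * fps_nth f e"
    by (simp only: Suc mult.assoc)
  also have "\<dots> = poly (falling_poly (Suc j)) (of_nat e) * fps_nth f e"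
    by (simp only: poly_falling_poly_Suc)
  finally show ?case .
qed

lemma degree_falling_poly: "degree (falling_poly j :: 'a::idom poly) = j" "lead_coeff (falling_poly j :: 'a poly) = 1"
proof -
  show 1: "lead_coeff (falling_poly j :: 'a poly) = 1"
    unfolding falling_poly_def by (subst lead_coeff_prod) simp
  show "degree (falling_poly j :: 'a poly) = j"
    unfolding falling_poly_def by (subst degree_prod_eq_sum_degree) auto
qed

lemma poly_falling_poly_of_nat:
  "poly (falling_poly k) (of_nat j :: 'a::idom) = of_nat (fact k) * of_nat (j choose k)"
proof (induction k)
  case 0 show ?case by (simp add: falling_poly_def)
next
  case (Suc k)
  have "Suc k * (j choose Suc k) = (j - k) * (j choose k)"
    by (cases j) (simp_all only: Suc_times_binomial binomial_absorb_comp diff_Suc_1, simp)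
  moreover have "fact (Suc k) * (j choose Suc k) = fact k * (Suc k * (j choose Suc k))" by (simp add: algebra_simps)
  ultimately have "fact (Suc k) * (j choose Suc k) = fact k * (j choose k) * (j - k)" by (simp only: mult_ac)
  then have "of_nat (fact (Suc k)) * of_nat (j choose Suc k) = (of_nat (fact k * (j choose k) * (j - k)) :: 'a)"
    by (metis of_nat_mult)
  also have "\<dots> = of_nat (fact k) * of_nat (j choose k) * (of_nat j - of_nat k)"
    by (cases "k \<le> j") (simp_all add: of_nat_diff binomial_eq_0)
  also have "\<dots> = poly (falling_poly (Suc k)) (of_nat j)"
    by (simp only: poly_falling_poly_Suc Suc.IH mult_ac)
  finally show ?case by simp
qed

text \<open>
  The indicial equation. If \<open>f\<close> has order \<open>o\<close>, the lowest possible coefficient of \<open>\<Sum> c\<^sub>j D\<^sup>j f\<close> is the leading coefficient of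
  \<open>f\<close> times \<open>P(o)\<close>, for a nonzero polynomial \<open>P\<close> of degree at most \<open>n\<close> that does not depend on \<open>f\<close>. Orders that are
  distinct and below \<open>p\<close> would give \<open>n + 1\<close> roots of \<open>P\<close>.
\<close>

lemma distinct_orders_no_common_ode:
  fixes c f :: "nat \<Rightarrow> 'p::prime_card mod_ring fps"
  assumes ode: "\<And>i. i \<le> n \<Longrightarrow> (\<Sum>j\<le>n. c j * (fps_deriv ^^ j) (f i)) = 0"
    and nz: "\<And>i. i \<le> n \<Longrightarrow> f i \<noteq> 0" and ord: "\<And>i. i \<le> n \<Longrightarrow> subdegree (f i) < CARD('p)"
    and inj: "inj_on (\<lambda>i. subdegree (f i)) {..n}"
    and j: "j \<le> n"
  shows "c j = 0"
proof (rule ccontr)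
  assume "c j \<noteq> 0"
  define J where "J = {j. j \<le> n \<and> c j \<noteq> 0}"
  have J: "finite J" "J \<noteq> {}" using \<open>c j \<noteq> 0\<close> j by (auto simp: J_def)
  \<comment> \<open>multiplying the equation by \<open>t\<^sup>n\<close> pairs \<open>c\<^sub>j t\<^sup>n\<^sup>-\<^sup>j\<close> with the operator \<open>t\<^sup>j D\<^sup>j\<close>, which acts on \<open>t\<^sup>o\<close> as a scalar\<close>
  define C where "C = (\<lambda>j. fps_X ^ (n - j) * c j)"
  have C: "subdegree (C j) = n - j + subdegree (c j)" "C j \<noteq> 0" if "j \<in> J" for j
    using that by (auto simp: C_def J_def)
  define \<mu> where "\<mu> = Min ((\<lambda>j. subdegree (C j)) ` J)"
  have \<mu>: "fps_X ^ \<mu> dvd C j" if "j \<le> n" for j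
  proof (cases "j \<in> J")
    case True
    then have "\<mu> \<le> subdegree (C j)" using J by (simp add: \<mu>_def)
    then show ?thesis by (auto simp: fps_X_power_dvd_iff_nth intro: nth_less_subdegree_zero)
  next
    case False then show ?thesis using that by (simp add: C_def J_def)
  qed
  define \<kappa> where "\<kappa> = (\<lambda>j. fps_nth (C j) \<mu>)"
  have "\<mu> \<in> (\<lambda>j. subdegree (C j)) ` J" unfolding \<mu>_def using J by (intro Min_in) auto
  then obtain j0 where j0: "j0 \<in> J" "\<mu> = subdegree (C j0)" by auto
  then have "\<kappa> j0 \<noteq> 0" using nth_subdegree_nonzero[OF C(2)[OF j0(1)]] by (simp add: \<kappa>_def)
  \<comment> \<open>\<open>P\<close> is nonzero: its coefficient at the largest such index is \<open>\<kappa>\<close>, as \<open>falling_poly j\<close> is monic of degree \<open>j\<close>\<close>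
  define K where "K = {j. j \<le> n \<and> \<kappa> j \<noteq> 0}"
  have K: "finite K" "j0 \<in> K" using \<open>\<kappa> j0 \<noteq> 0\<close> j0 by (auto simp: K_def J_def)
  define m where "m = Max K"
  have "K \<noteq> {}" using K(2) by auto
  then have m: "m \<in> K" unfolding m_def by (rule Max_in[OF K(1)])
  have m_max: "j \<le> m" if "j \<in> K" for j using that unfolding m_def by (rule Max_ge[OF K(1)])
  define P where "P = (\<Sum>j\<le>n. Polynomial.smult (\<kappa> j) (falling_poly j))"
  have "coeff P m = (\<Sum>j\<le>n. \<kappa> j * coeff (falling_poly j) m)" by (simp add: P_def coeff_sum)
  also have "\<dots> = (\<Sum>j\<in>{m}. \<kappa> j * coeff (falling_poly j) m)"
  proof (rule sum.mono_neutral_right)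
    show "\<forall>i\<in>{..n} - {m}. \<kappa> i * coeff (falling_poly i) m = 0"
    proof
      fix i assume i: "i \<in> {..n} - {m}"
      show "\<kappa> i * coeff (falling_poly i) m = 0"
      proof (cases "i < m")
        case True then show ?thesis by (simp add: coeff_eq_0 degree_falling_poly)
      next
        case False then show ?thesis using i m_max[of i] by (auto simp: K_def)
      qed
    qed
  qed (use m in \<open>auto simp: K_def\<close>)
  also have "\<dots> = \<kappa> m"
    using degree_falling_poly(2)[of m, where ?'a = "'p mod_ring"] by (simp add: degree_falling_poly(1))
  finally have "P \<noteq> 0" using m by (auto simp: K_def)
  have deg: "degree P \<le> n" unfolding P_def
    by (intro degree_sum_le) (auto intro: order.trans[OF degree_smult_le] simp: degree_falling_poly)
  have root: "poly P (of_nat (subdegree (f i))) = 0" if i: "i \<le> n" for i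
  proof -
    let ?o = "subdegree (f i)"
    have "0 = fps_X ^ n * (\<Sum>j\<le>n. c j * (fps_deriv ^^ j) (f i))" by (simp add: ode i)
    also have "\<dots> = (\<Sum>j\<le>n. C j * (fps_X ^ j * (fps_deriv ^^ j) (f i)))"
      unfolding sum_distrib_left
    proof (rule sum.cong[OF refl])
      fix j assume "j \<in> {..n}"
      then have "(fps_X :: 'p mod_ring fps) ^ n = fps_X ^ (n - j) * fps_X ^ j" by (simp flip: power_add)
      then show "fps_X ^ n * (c j * (fps_deriv ^^ j) (f i)) = C j * (fps_X ^ j * (fps_deriv ^^ j) (f i))"
        by (simp add: C_def mult_ac)
    qed
    finally have "0 = fps_nth (\<Sum>j\<le>n. C j * (fps_X ^ j * (fps_deriv ^^ j) (f i))) (\<mu> + ?o)" by simp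
    also have "\<dots> = (\<Sum>j\<le>n. \<kappa> j * (poly (falling_poly j) (of_nat ?o) * fps_nth (f i) ?o))"
      unfolding fps_sum_nth
    proof (rule sum.cong[OF refl])
      fix j assume j: "j \<in> {..n}"
      have "fps_X ^ ?o dvd fps_X ^ j * (fps_deriv ^^ j) (f i)"
        unfolding fps_X_power_dvd_iff_nth nth_X_power_iterated_deriv
      proof (intro allI impI)
        fix e assume "e < ?o"
        then have "fps_nth (f i) e = 0" by (rule nth_less_subdegree_zero)
        then show "poly (falling_poly j) (of_nat e) * fps_nth (f i) e = 0" by (simp only: mult_zero_right)
      qed
      moreover have "fps_X ^ \<mu> dvd C j" using \<mu> j by simp
      ultimately have "fps_nth (C j * (fps_X ^ j * (fps_deriv ^^ j) (f i))) (\<mu> + ?o)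
        = fps_nth (C j) \<mu> * fps_nth (fps_X ^ j * (fps_deriv ^^ j) (f i)) ?o"
        by (intro fps_mult_nth_lowest)
      then show "fps_nth (C j * (fps_X ^ j * (fps_deriv ^^ j) (f i))) (\<mu> + ?o)
        = \<kappa> j * (poly (falling_poly j) (of_nat ?o) * fps_nth (f i) ?o)"
        by (simp only: \<kappa>_def nth_X_power_iterated_deriv)
    qed
    also have "\<dots> = poly P (of_nat ?o) * fps_nth (f i) ?o"
      by (simp add: P_def poly_sum sum_distrib_left sum_distrib_right mult_ac)
    finally show ?thesis using nz[OF i] by simp
  qed
  have "inj_on (\<lambda>i. of_nat (subdegree (f i)) :: 'p mod_ring) {..n}"
    using inj ord by (auto simp: inj_on_def dest!: of_nat_mod_ring_inject[rotated 2])
  then have "card ((\<lambda>i. of_nat (subdegree (f i)) :: 'p mod_ring) ` {..n}) = n + 1"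
    by (simp add: card_image)
  moreover have "(\<lambda>i. of_nat (subdegree (f i)) :: 'p mod_ring) ` {..n} \<subseteq> {x. poly P x = 0}"
    using root by auto
  then have "card ((\<lambda>i. of_nat (subdegree (f i)) :: 'p mod_ring) ` {..n}) \<le> card {x. poly P x = 0}"
    by (intro card_mono) (auto simp: poly_roots_finite \<open>P \<noteq> 0\<close>)
  moreover have "card {x. poly P x = 0} \<le> degree P" by (rule card_poly_roots_bound[OF \<open>P \<noteq> 0\<close>])
  ultimately show False using deg by simp
qed

text \<open>
  The Frobenius row comes last, which makes all the row operations below lower triangular.
\<close>

definition frobenius_wronskian :: "nat \<Rightarrow> (nat \<Rightarrow> 'p::prime_card mod_ring fps) \<Rightarrow> 'p mod_ring fps mat" where
  "frobenius_wronskian n f = mat (n + 1) (n + 1)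
    (\<lambda>(k, i). if k < n then (fps_deriv ^^ k) (f i) else f i ^ CARD('p))"

lemma fps_deriv_power_card: "fps_deriv (f ^ CARD('p)) = 0" for f :: "'p::prime_card mod_ring fps"
proof -
  have "(of_nat CARD('p) :: 'p mod_ring fps) = 0" by (simp add: of_nat_card_eq_0 flip: fps_of_nat)
  then show ?thesis by (simp add: fps_deriv_power)
qed

text \<open>
  If the determinant vanishes, the rows satisfy a relation \<open>S(f) + b f\<^sup>p = 0\<close>, with \<open>S\<close> a differential operator of order
  below \<open>n\<close>. Because \<open>f\<^sup>p\<close> is a constant for \<open>d/dt\<close>, it can be eliminated: \<open>b S(f)' - b' S(f) = 0\<close>. This is a nonzero
  equation of order at most \<open>n\<close> with \<open>n + 1\<close> solutions of distinct orders.
\<close>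

lemma frobenius_wronskian_nonzero:
  fixes f :: "nat \<Rightarrow> 'p::prime_card mod_ring fps"
  assumes nz: "\<And>i. i \<le> n \<Longrightarrow> f i \<noteq> 0" and ord: "\<And>i. i \<le> n \<Longrightarrow> subdegree (f i) < CARD('p)"
    and inj: "inj_on (\<lambda>i. subdegree (f i)) {..n}"
  shows "det (frobenius_wronskian n f) \<noteq> 0"
proof
  let ?W = "frobenius_wronskian n f"
  assume "det ?W = 0"
  moreover have W: "?W \<in> carrier_mat (n + 1) (n + 1)" by (simp add: frobenius_wronskian_def)
  ultimately have "det (transpose_mat ?W) = 0" by (simp add: det_transpose)
  then obtain v where v: "v \<in> carrier_vec (n + 1)" "v \<noteq> 0\<^sub>v (n + 1)"
    "transpose_mat ?W *\<^sub>v v = 0\<^sub>v (n + 1)"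
    using det_0_iff_vec_prod_zero[of "transpose_mat ?W" "n + 1"] W by auto
  define a where "a = (\<lambda>k. if k < n then vec_index v k else 0)"
  define b where "b = vec_index v n"
  define S where "S = (\<lambda>g. \<Sum>k<n. a k * (fps_deriv ^^ k) g)"
  have eq: "S (f i) + b * f i ^ CARD('p) = 0" if i: "i \<le> n" for i
  proof -
    have "0 = vec_index (transpose_mat ?W *\<^sub>v v) i" using v i by simp
    also have "\<dots> = (\<Sum>k<n + 1. ?W $$ (k, i) * vec_index v k)"
      using W v(1) i by (simp add: scalar_prod_def atLeast0LessThan)
    also have "\<dots> = S (f i) + b * f i ^ CARD('p)"
      using i by (simp add: S_def a_def b_def frobenius_wronskian_def mult.commute)
    finally show ?thesis by simp
  qed
  show False
  proof (cases "b = 0")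
    case True
    have ak: "a k = 0" if "k \<le> n" for k
    proof (rule distinct_orders_no_common_ode[OF _ nz ord inj that])
      fix i assume "i \<le> n"
      have "(\<Sum>j\<le>n. a j * (fps_deriv ^^ j) (f i)) = S (f i)"
        unfolding S_def by (intro sum.mono_neutral_right) (auto simp: a_def)
      then show "(\<Sum>j\<le>n. a j * (fps_deriv ^^ j) (f i)) = 0" using eq[OF \<open>i \<le> n\<close>] True by simp
    qed
    then have "vec_index v k = 0" if "k < n + 1" for k
      using ak[of k] that True by (cases "k < n") (auto simp: a_def b_def less_Suc_eq)
    then have "v = 0\<^sub>v (n + 1)" using v(1) by (intro eq_vecI) auto
    with v(2) show False by simp
  next
    case False
    define c where "c = (\<lambda>j. b * fps_deriv (a j) - fps_deriv b * a j + (if j = 0 then 0 else b * a (j - 1)))"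
    have c0: "c j = 0" if "j \<le> n" for j
    proof (rule distinct_orders_no_common_ode[OF _ nz ord inj that])
      fix i assume i: "i \<le> n"
      have "S (f i) = - b * f i ^ CARD('p)" using eq[OF i] by (simp add: eq_neg_iff_add_eq_0)
      then have "fps_deriv (S (f i)) = - fps_deriv b * f i ^ CARD('p)"
        by (simp add: fps_deriv_power_card)
      then have *: "b * fps_deriv (S (f i)) - fps_deriv b * S (f i) = 0"
        using \<open>S (f i) = _\<close> by (simp add: algebra_simps)
      have "fps_deriv (S (f i)) = (\<Sum>k<n. fps_deriv (a k) * (fps_deriv ^^ k) (f i))
        + (\<Sum>k<n. a k * (fps_deriv ^^ Suc k) (f i))"
        by (simp add: S_def fps_deriv_sum sum.distrib algebra_simps)
      also have "(\<Sum>k<n. a k * (fps_deriv ^^ Suc k) (f i))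
        = (\<Sum>k\<le>n. (if k = 0 then 0 else a (k - 1)) * (fps_deriv ^^ k) (f i))"
        using sum.lessThan_Suc_shift[of "\<lambda>k. (if k = 0 then 0 else a (k - 1)) * (fps_deriv ^^ k) (f i)" n]
        by (simp add: lessThan_Suc_atMost)
      also have "(\<Sum>k<n. fps_deriv (a k) * (fps_deriv ^^ k) (f i)) = (\<Sum>k\<le>n. fps_deriv (a k) * (fps_deriv ^^ k) (f i))"
        by (intro sum.mono_neutral_left) (auto simp: a_def)
      finally have d: "fps_deriv (S (f i)) = (\<Sum>k\<le>n. fps_deriv (a k) * (fps_deriv ^^ k) (f i))
        + (\<Sum>k\<le>n. (if k = 0 then 0 else a (k - 1)) * (fps_deriv ^^ k) (f i))" .
      have s: "S (f i) = (\<Sum>k\<le>n. a k * (fps_deriv ^^ k) (f i))"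
        unfolding S_def by (intro sum.mono_neutral_left) (auto simp: a_def)
      have "(\<Sum>j\<le>n. c j * (fps_deriv ^^ j) (f i)) = b * fps_deriv (S (f i)) - fps_deriv b * S (f i)"
        unfolding d unfolding s sum_distrib_left ring_distribs sum.distrib[symmetric] sum_subtractf[symmetric]
        by (intro sum.cong) (auto simp: c_def algebra_simps)
      then show "(\<Sum>j\<le>n. c j * (fps_deriv ^^ j) (f i)) = 0" using * by simp
    qed
    \<comment> \<open>descending from the top coefficient: once \<open>a\<^sub>j = 0\<close>, the coefficient \<open>c\<^sub>j\<close> equals \<open>b a\<^sub>j\<^sub>-\<^sub>1\<close>\<close>
    have a0: "a (n - 1 - l) = 0" if "l < n" for l
      using that
    proof (induction l)
      case 0
      have "a n = 0" by (simp add: a_def)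
      then show ?case using c0[of n] 0 False by (simp add: c_def)
    next
      case (Suc l)
      have e: "n - 1 - l = Suc (n - 1 - Suc l)" using Suc.prems by simp
      have "a (n - 1 - l) = 0" using Suc by simp
      then show ?case using c0[of "n - 1 - l"] Suc.prems False by (simp add: c_def e)
    qed
    have "a k = 0" if "k < n" for k using a0[of "n - 1 - k"] that by simp
    then have "S (f 0) = 0" by (simp add: S_def)
    then show False using eq[of 0] False nz[of 0] by simp
  qed
qed

lemma fps_nth_power_card_eq_0:
  fixes u :: "'p::prime_card mod_ring fps"
  assumes "0 < j" "j < CARD('p)"
  shows "fps_nth (u ^ CARD('p)) j = 0"
proof -
  obtain i where i: "j = Suc i" using assms by (cases j) auto
  have "fps_nth (fps_deriv (u ^ CARD('p))) i = 0" by (simp add: fps_deriv_power_card)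
  then have "of_nat j * fps_nth (u ^ CARD('p)) j = 0" by (simp add: i)
  moreover have "(of_nat j :: 'p mod_ring) \<noteq> 0" using of_nat_mod_ring_inject[of j 0] assms by auto
  ultimately show ?thesis by simp
qed

text \<open>
  Modulo \<open>t\<^sup>n\<close> the Frobenius row depends on the others: \<open>f\<^sup>p = f(0)\<close> up to \<open>t\<^sup>p\<close>, by Fermat's theorem, and Taylor's formula
  at \<open>t\<close> gives \<open>f(0) = \<Sum> (- t)\<^sup>k / k! f\<^sup>(\<^sup>k\<^sup>)(t)\<close>. Rationality of the point
  enters through \<open>f(0)\<^sup>p = f(0)\<close>.
\<close>

lemma frobenius_wronskian_vanishes:
  fixes u :: "nat \<Rightarrow> 'p::prime_card mod_ring fps"
  assumes n: "n \<le> CARD('p)"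
  shows "fps_X ^ n dvd det (frobenius_wronskian n u)"
proof -
  \<comment> \<open>Taylor coefficients \<open>(- t)\<^sup>k / k!\<close>; the factorials are invertible because \<open>k < n \<le> p\<close>\<close>
  define \<tau> where "\<tau> = (\<lambda>k. fps_const ((- 1) ^ k / of_nat (fact k)) * fps_X ^ k :: 'p mod_ring fps)"
  have tay: "fps_X ^ n dvd u i ^ CARD('p) - (\<Sum>k<n. \<tau> k * (fps_deriv ^^ k) (u i))" for i
    unfolding fps_X_power_dvd_iff_nth
  proof (intro allI impI)
    fix j assume j: "j < n"
    have fk: "(of_nat (fact k) :: 'p mod_ring) \<noteq> 0" if "k < n" for k
    proof
      assume "(of_nat (fact k) :: 'p mod_ring) = 0"
      then have "CARD('p) dvd fact k" by (rule of_nat_0_mod_ring_dvd)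
      then show False using that n prime_card[where 'a = 'p] by (simp add: prime_dvd_fact_iff)
    qed
    have "fps_nth (\<Sum>k<n. \<tau> k * (fps_deriv ^^ k) (u i)) j
      = (\<Sum>k<n. (- 1) ^ k * of_nat (j choose k) * fps_nth (u i) j)"
      unfolding fps_sum_nth
    proof (rule sum.cong[OF refl])
      fix k assume "k \<in> {..<n}"
      then show "fps_nth (\<tau> k * (fps_deriv ^^ k) (u i)) j = (- 1) ^ k * of_nat (j choose k) * fps_nth (u i) j"
        using fk[of k] by (simp add: \<tau>_def mult.assoc nth_X_power_iterated_deriv poly_falling_poly_of_nat)
    qed
    also have "\<dots> = (\<Sum>k\<le>j. (- 1) ^ k * of_nat (j choose k)) * fps_nth (u i) j"
      unfolding sum_distrib_right
    proof (rule sum.mono_neutral_right)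
      show "\<forall>k\<in>{..<n} - {..j}. (- 1) ^ k * of_nat (j choose k) * fps_nth (u i) j = 0"
        by (simp add: binomial_eq_0)
    qed (use j in auto)
    also have "\<dots> = (if j = 0 then fps_nth (u i) 0 else 0)"
      by (cases "j = 0") (simp_all add: choose_alternating_sum)
    also have "\<dots> = fps_nth (u i ^ CARD('p)) j"
      using fps_nth_power_card_eq_0[of j "u i"] j n by (auto simp: fps_nth_power_0 power_card_mod_ring)
    finally show "fps_nth (u i ^ CARD('p) - (\<Sum>k<n. \<tau> k * (fps_deriv ^^ k) (u i))) j = 0" by simp
  qed
  then obtain e where e: "\<And>i. u i ^ CARD('p) - (\<Sum>k<n. \<tau> k * (fps_deriv ^^ k) (u i)) = fps_X ^ n * e i"
    unfolding dvd_def by metis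
  define B where "B = mat (n + 1) (n + 1) (\<lambda>(k, i). if k < n then (fps_deriv ^^ k) (u i) else e i)"
  define \<alpha> where "\<alpha> = (\<lambda>k l. if k < n then (if l = k then 1 else 0) else if l < n then \<tau> l else fps_X ^ n)"
  have "det (frobenius_wronskian n u) = (\<Prod>k<n + 1. \<alpha> k k) * det B"
  proof (rule det_triangular_rows[where \<alpha> = \<alpha>])
    fix k i assume ki: "k < n + 1" "i < n + 1"
    show "frobenius_wronskian n u $$ (k, i) = (\<Sum>l\<le>k. \<alpha> k l * B $$ (l, i))"
    proof (cases "k < n")
      case True
      have "(\<Sum>l\<le>k. \<alpha> k l * B $$ (l, i)) = (\<Sum>l\<le>k. if l = k then B $$ (l, i) else 0)"
        using True by (intro sum.cong) (auto simp: \<alpha>_def)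
      then show ?thesis using True ki by (simp add: frobenius_wronskian_def B_def)
    next
      case False
      then have k: "k = n" using ki by simp
      have "(\<Sum>l\<le>n. \<alpha> n l * B $$ (l, i)) = (\<Sum>l<n. \<tau> l * (fps_deriv ^^ l) (u i)) + fps_X ^ n * e i"
        using ki by (simp add: \<alpha>_def B_def flip: lessThan_Suc_atMost)
      also have "\<dots> = u i ^ CARD('p)" using e[of i] by (simp add: algebra_simps)
      finally show ?thesis using k ki by (simp add: frobenius_wronskian_def)
    qed
  qed (simp_all add: frobenius_wronskian_def B_def)
  then show ?thesis by (simp add: \<alpha>_def)
qed

lemma frobenius_wronskian_scale:
  fixes u :: "nat \<Rightarrow> 'p::prime_card mod_ring fps"
  shows "det (frobenius_wronskian n (\<lambda>i. h * u i)) = h ^ (n + CARD('p)) * det (frobenius_wronskian n u)"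
proof -
  obtain \<alpha> where \<alpha>: "\<And>k i. (fps_deriv ^^ k) (h * u i) = (\<Sum>l\<le>k. \<alpha> k l * (fps_deriv ^^ l) (u i))"
    "\<And>k. \<alpha> k k = h"
    using iterated_derivation_triangular[of UNIV "\<lambda>k i. (fps_deriv ^^ k) (h * u i)" h u "\<lambda>_. 0" 1] by auto
  define \<beta> where "\<beta> = (\<lambda>k l. if k < n then \<alpha> k l else if l < n then 0 else h ^ CARD('p))"
  have "det (frobenius_wronskian n (\<lambda>i. h * u i)) = (\<Prod>k<n + 1. \<beta> k k) * det (frobenius_wronskian n u)"
  proof (rule det_triangular_rows[where \<alpha> = \<beta>])
    fix k i assume ki: "k < n + 1" "i < n + 1"
    show "frobenius_wronskian n (\<lambda>i. h * u i) $$ (k, i) = (\<Sum>l\<le>k. \<beta> k l * frobenius_wronskian n u $$ (l, i))"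
    proof (cases "k < n")
      case True
      then show ?thesis using ki by (auto simp: frobenius_wronskian_def \<beta>_def \<alpha>(1) intro!: sum.cong)
    next
      case False
      then have k: "k = n" using ki by simp
      then show ?thesis using ki by (simp add: frobenius_wronskian_def \<beta>_def power_mult_distrib flip: lessThan_Suc_atMost)
    qed
  qed (simp_all add: frobenius_wronskian_def)
  then show ?thesis by (simp add: \<beta>_def \<alpha>(2) power_add mult.commute)
qed

section \<open>Blocking sets\<close>

lemma prod_linear_dvd:
  fixes q :: "'a::field poly"
  assumes "finite D" "\<And>x. x \<in> D \<Longrightarrow> poly q (- x) = 0"
  shows "(\<Prod>x\<in>D. [:x, 1:]) dvd q"
  using assms
proof (induction D arbitrary: q rule: finite_induct)
  case (insert x D)
  obtain q' where q: "q = [:x, 1:] * q'"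
    using insert.prems[of x] by (metis dvdE dvd_iff_poly_eq_0 insertI1)
  have "poly q' (- y) = 0" if y: "y \<in> D" for y
  proof -
    have "(x - y) * poly q' (- y) = 0" using insert.prems[of y] y by (auto simp: q)
    moreover have "x \<noteq> y" using insert.hyps y by auto
    ultimately show ?thesis by simp
  qed
  then have "(\<Prod>x\<in>D. [:x, 1:]) dvd q'" by (rule insert.IH)
  then have "[:x, 1:] * (\<Prod>x\<in>D. [:x, 1:]) dvd [:x, 1:] * q'" by (rule mult_dvd_mono[OF dvd_refl])
  then show ?case by (simp only: q prod.insert[OF insert.hyps])
qed simp

text \<open>
  A linear factor of multiplicity \<open>m\<close> divides the derivative at least \<open>m - 1\<close> times; \<open>r\<close> collects these factors.
\<close>

lemma radical_cofactor_dvd_pderiv: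
  fixes a :: "'i \<Rightarrow> 'a::field"
  assumes "finite B"
  shows "\<exists>r. (\<Prod>s\<in>B. [:a s, 1:]) = r * (\<Prod>x\<in>a ` B. [:x, 1:]) \<and> r dvd pderiv (\<Prod>s\<in>B. [:a s, 1:])"
  using assms
proof (induction B rule: finite_induct)
  case empty show ?case by (intro exI[of _ 1]) simp
next
  case (insert s B)
  define f where "f = (\<Prod>s\<in>B. [:a s, 1:])"
  define l where "l = [:a s, 1:]"
  obtain r where r: "f = r * (\<Prod>x\<in>a ` B. [:x, 1:])" "r dvd pderiv f" using insert.IH unfolding f_def by blast
  have p: "(\<Prod>s\<in>insert s B. [:a s, 1:]) = l * f" using insert.hyps by (simp add: f_def l_def)
  have l': "pderiv l = 1" by (simp add: l_def pderiv_pCons one_pCons)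
  have d: "pderiv (l * f) = f + l * pderiv f" by (simp add: pderiv_mult l')
  show ?case
  proof (cases "a s \<in> a ` B")
    case True
    then have eq: "a ` insert s B = a ` B" by auto
    have "l dvd (\<Prod>x\<in>a ` B. [:x, 1:])" unfolding l_def using True insert.hyps by (intro dvd_prodI) auto
    then have "l * r dvd f" unfolding r(1) by (metis mult.commute mult_dvd_mono dvd_refl)
    moreover have "l * r dvd l * pderiv f" using r(2) by (simp add: mult_dvd_mono)
    ultimately have "l * r dvd pderiv (l * f)" unfolding d by (rule dvd_add)
    moreover have "l * f = (l * r) * (\<Prod>x\<in>a ` insert s B. [:x, 1:])" unfolding eq by (simp add: r(1) mult_ac)
    ultimately show ?thesis unfolding p by blast
  next
    case False
    then have "(\<Prod>x\<in>a ` insert s B. [:x, 1:]) = l * (\<Prod>x\<in>a ` B. [:x, 1:])"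
      using insert.hyps by (simp add: l_def)
    then have "l * f = r * (\<Prod>x\<in>a ` insert s B. [:x, 1:])" by (simp add: r(1) mult_ac)
    moreover have "r dvd pderiv (l * f)" unfolding d using r(2) by (simp add: r(1))
    ultimately show ?thesis unfolding p by blast
  qed
qed

lemma dvd_prod_linear:
  fixes a :: "'i \<Rightarrow> 'a::field_gcd"
  assumes "finite A" "f dvd (\<Prod>s\<in>A. [:a s, 1:])"
  shows "\<exists>B c. B \<subseteq> A \<and> c \<noteq> 0 \<and> f = Polynomial.smult c (\<Prod>s\<in>B. [:a s, 1:])"
  using assms
proof (induction A arbitrary: f rule: finite_induct)
  case empty
  then have "is_unit f" by simp
  then obtain c where "f = [:c:]" "c \<noteq> 0" by (auto simp: is_unit_iff_degree elim: degree_eq_zeroE)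
  then show ?case by (intro exI[of _ "{}"] exI[of _ c]) simp
next
  case (insert s A)
  define l where "l = [:a s, 1:]"
  have l0: "l \<noteq> 0" by (simp add: l_def)
  have dv: "f dvd l * (\<Prod>s\<in>A. [:a s, 1:])" using insert unfolding l_def by simp
  show ?case
  proof (cases "poly f (- a s) = 0")
    case True
    then obtain f' where f': "f = l * f'" unfolding l_def by (metis dvdE dvd_iff_poly_eq_0)
    with dv l0 have "f' dvd (\<Prod>s\<in>A. [:a s, 1:])" by simp
    then obtain B c where B: "B \<subseteq> A" "c \<noteq> 0" "f' = Polynomial.smult c (\<Prod>s\<in>B. [:a s, 1:])"
      using insert.IH by blast
    have "finite B" "s \<notin> B" using B insert.hyps finite_subset by auto
    then have "(\<Prod>s\<in>insert s B. [:a s, 1:]) = l * (\<Prod>s\<in>B. [:a s, 1:])"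
      unfolding l_def by (rule prod.insert)
    then have "f = Polynomial.smult c (\<Prod>s\<in>insert s B. [:a s, 1:])" by (simp add: f' B(3))
    then show ?thesis using B by (intro exI[of _ "insert s B"] exI[of _ c]) auto
  next
    case False
    have "coprime f l"
    proof (rule coprimeI)
      fix e assume e: "e dvd f" "e dvd l"
      then obtain q where q: "l = e * q" by (elim dvdE)
      then have eq0: "e \<noteq> 0" "q \<noteq> 0" using l0 by auto
      have "degree l = 1" by (simp add: l_def)
      then have "degree e + degree q = 1" using q eq0 by (simp add: degree_mult_eq)
      then consider "degree e = 0" | "degree q = 0" by linarith
      then show "is_unit e"
      proof cases
        case 1
        then show ?thesis using eq0 by (simp add: is_unit_iff_degree)
      next
        case 2
        then have "is_unit q" using eq0 by (simp add: is_unit_iff_degree)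
        then have "l dvd e" by (metis q dvd_mult_unit_iff' dvd_refl mult.commute)
        with e(1) have "l dvd f" by (rule dvd_trans[rotated])
        then show ?thesis using False by (simp add: l_def dvd_iff_poly_eq_0)
      qed
    qed
    with dv have "f dvd (\<Prod>s\<in>A. [:a s, 1:])" by (simp add: coprime_dvd_mult_right_iff)
    then show ?thesis using insert.IH by blast
  qed
qed

lemma pderiv_eq_0_small_degree:
  fixes q :: "'p::prime_card mod_ring poly"
  assumes "pderiv q = 0" "degree q < CARD('p)"
  shows "degree q = 0"
proof (rule ccontr)
  assume "degree q \<noteq> 0"
  then obtain m where m: "degree q = Suc m" by (cases "degree q") auto
  have "of_nat (Suc m) * coeff q (Suc m) = 0"
    using arg_cong[OF assms(1), of "\<lambda>q. coeff q m"] by (simp add: coeff_pderiv)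
  moreover have "(of_nat (Suc m) :: 'p mod_ring) \<noteq> 0"
    using of_nat_mod_ring_inject[of "Suc m" 0] assms(2) m by auto
  ultimately have "lead_coeff q = 0" unfolding m by simp
  then have "q = 0" by simp
  then show False using m by simp
qed

text \<open>
  Redei's argument. The gap means \<open>f = X\<^sup>p g + h\<close> with \<open>deg g = k\<close> and \<open>deg h \<le> k\<close>; a common factor of \<open>g\<close> and \<open>h\<close> may be
  cancelled. The distinct linear factors of \<open>f\<close> divide \<open>X g + h\<close>, because \<open>x\<^sup>p = x\<close> at their roots, and the remaining ones
  divide \<open>g f' - g' f = g h' - g' h\<close>. So \<open>f\<close> divides \<open>(X g + h) (g h' - g' h)\<close>, whose degree is too small unless
  \<open>g h' = g' h\<close>. As \<open>g\<close> and \<open>h\<close> are coprime of degree below \<open>p\<close>, they are then constant, and \<open>X\<^sup>p g + h\<close> has a single root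
  of multiplicity \<open>p\<close>.
\<close>

lemma lacunary_fully_reducible:
  fixes a :: "'i \<Rightarrow> 'p::prime_card mod_ring"
  assumes A: "finite A" "card A = CARD('p) + k" and k: "2 * k < CARD('p)"
    and gap: "\<And>j. k < j \<Longrightarrow> j < CARD('p) \<Longrightarrow> coeff (\<Prod>s\<in>A. [:a s, 1:]) j = 0"
  shows "\<exists>x. CARD('p) \<le> card {s \<in> A. a s = x}"
proof -
  let ?p = "CARD('p)"
  define f where "f = (\<Prod>s\<in>A. [:a s, 1:])"
  define g where "g = poly_shift ?p f"
  define h where "h = poly_cutoff ?p f"
  have degf: "degree f = ?p + k" unfolding f_def using A by (subst degree_prod_eq_sum_degree) auto
  have leadf: "lead_coeff f = 1" unfolding f_def by (subst lead_coeff_prod) simp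
  have f: "f = monom 1 ?p * g + h"
    by (intro poly_eqI) (auto simp: g_def h_def coeff_monom_mult coeff_poly_shift coeff_poly_cutoff)
  have "coeff g i = 0" if "i > k" for i using that by (simp add: g_def coeff_poly_shift coeff_eq_0 degf)
  then have "degree g \<le> k" by (intro degree_le) auto
  moreover have gk: "coeff g k = 1" using leadf by (simp add: g_def coeff_poly_shift degf add.commute)
  ultimately have degg: "degree g = k" by (intro antisym le_degree) auto
  have "coeff h i = 0" if "i > k" for i
    using that gap[of i] by (auto simp: h_def coeff_poly_cutoff f_def)
  then have degh: "degree h \<le> k" by (intro degree_le) auto
  have g0: "g \<noteq> 0" using gk by auto
  define e where "e = gcd g h"
  have e0: "e \<noteq> 0" using g0 by (simp add: e_def)
  then obtain g1 h1 where gh: "g = g1 * e" "h = h1 * e" "coprime g1 h1"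
    using gcd_coprime_exists[of g h] unfolding e_def by blast
  have g10: "g1 \<noteq> 0" using g0 gh by auto
  define m where "m = degree g1"
  have dg: "k = m + degree e" using degg gh g10 e0 by (simp add: m_def degree_mult_eq)
  have dh1: "degree h1 \<le> m"
  proof (cases "h1 = 0")
    case False
    then have "degree h = degree h1 + degree e" using gh e0 by (simp add: degree_mult_eq)
    then show ?thesis using dg degh by simp
  qed simp
  define f1 where "f1 = monom 1 ?p * g1 + h1"
  have ff1: "f = f1 * e" unfolding f f1_def gh by (simp add: algebra_simps)
  have degmon: "degree (monom 1 ?p * g1) = ?p + m"
    using g10 by (simp add: degree_mult_eq degree_monom_eq m_def)
  have p0: "?p > 0" by simp
  have degf1: "degree f1 = ?p + m"
    unfolding f1_def by (subst degree_add_eq_left) (use degmon dh1 p0 in linarith, use degmon in simp)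
  have "f1 dvd (\<Prod>s\<in>A. [:a s, 1:])" using ff1 by (auto simp: f_def)
  then obtain B c where B: "B \<subseteq> A" "c \<noteq> 0" "f1 = Polynomial.smult c (\<Prod>s\<in>B. [:a s, 1:])"
    using dvd_prod_linear[OF A(1)] by blast
  have finB: "finite B" using B(1) A(1) finite_subset by blast
  have cardB: "card B = ?p + m"
  proof -
    have "degree (\<Prod>s\<in>B. [:a s, 1:]) = card B" by (subst degree_prod_eq_sum_degree) auto
    then show ?thesis using degf1 B by simp
  qed
  have polyf1: "poly f1 t = t * poly g1 t + poly h1 t" for t
    by (simp add: f1_def poly_monom power_card_mod_ring)
  have root: "poly f1 (- a s) = 0" if "s \<in> B" for s
    unfolding B(3) using that finB by (auto simp: poly_prod intro!: prod_zero)
  obtain r where r: "(\<Prod>s\<in>B. [:a s, 1:]) = r * (\<Prod>x\<in>a ` B. [:x, 1:])" "r dvd pderiv (\<Prod>s\<in>B. [:a s, 1:])"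
    using radical_cofactor_dvd_pderiv[OF finB] by blast
  define U where "U = [:0, 1:] * g1 + h1"
  define V where "V = g1 * pderiv h1 - pderiv g1 * h1"
  have "(\<Prod>x\<in>a ` B. [:x, 1:]) dvd U"
  proof (rule prod_linear_dvd)
    fix x assume "x \<in> a ` B"
    then show "poly U (- x) = 0" using root polyf1 by (auto simp: U_def)
  qed (use finB in simp)
  moreover have "r dvd V"
  proof -
    have "pderiv (monom 1 ?p :: 'p mod_ring poly) = 0" by (simp add: pderiv_monom of_nat_card_eq_0)
    then have "pderiv f1 = monom 1 ?p * pderiv g1 + pderiv h1"
      by (simp add: f1_def pderiv_add pderiv_mult)
    then have "V = g1 * pderiv f1 - pderiv g1 * f1" by (simp add: V_def f1_def algebra_simps)
    moreover have "r dvd pderiv f1" using r(2) unfolding B(3) pderiv_smult by (rule dvd_smult)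
    moreover have "r dvd f1" unfolding B(3) r(1) by (intro dvd_smult) simp
    ultimately show ?thesis by simp
  qed
  ultimately have "r * (\<Prod>x\<in>a ` B. [:x, 1:]) dvd V * U" by (intro mult_dvd_mono)
  then have dv: "f1 dvd V * U" unfolding B(3) r(1) using B(2) by (simp add: smult_dvd)
  have Um: "coeff U (Suc m) = lead_coeff g1" using dh1 by (simp add: U_def coeff_eq_0 m_def)
  then have U0: "U \<noteq> 0" using g10 by auto
  have V0: "V = 0"
  proof (rule ccontr)
    assume V: "V \<noteq> 0"
    have "?p + m \<le> degree (V * U)" using dvd_imp_degree_le[OF dv] V U0 degf1 by simp
    moreover have "degree (V * U) = degree V + degree U" using V U0 by (simp add: degree_mult_eq)
    moreover have "degree U \<le> m + 1"
    proof -
      have "degree ([:0, 1:] * g1) \<le> m + 1" using g10 by (simp add: m_def)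
      then show ?thesis unfolding U_def using dh1 by (intro degree_add_le) auto
    qed
    moreover have "degree V \<le> 2 * m - 1 \<and> m > 0"
    proof (cases "m = 0")
      case True
      then have "degree g1 = 0" "degree h1 = 0" using dh1 by (auto simp: m_def)
      then have "pderiv g1 = 0" "pderiv h1 = 0" by (auto simp: pderiv_eq_0_iff elim!: degree_eq_zeroE simp: pderiv_pCons)
      then show ?thesis using V by (simp add: V_def)
    next
      case False
      have "degree (pderiv q) \<le> m - 1" if "degree q \<le> m" for q :: "'p mod_ring poly"
        using that by (intro degree_le) (auto simp: coeff_pderiv coeff_eq_0)
      then have "degree (g1 * pderiv h1) \<le> m + (m - 1)" "degree (pderiv g1 * h1) \<le> (m - 1) + m"
        using dh1 m_def by (intro order.trans[OF degree_mult_le] add_mono; simp)+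
      then show ?thesis using False unfolding V_def by (intro conjI degree_diff_le) auto
    qed
    ultimately have "?p \<le> 2 * m" by linarith
    then show False using k dg by simp
  qed
  then have e1: "g1 * pderiv h1 = pderiv g1 * h1" by (simp add: V_def)
  have m_small: "m < ?p" using dg k by simp
  have "g1 dvd pderiv g1 * h1" by (metis e1 dvd_triv_left)
  then have "g1 dvd pderiv g1" using gh(3) by (simp add: coprime_dvd_mult_left_iff)
  then have pg: "pderiv g1 = 0"
  proof (cases "m = 0")
    case True
    then show ?thesis by (auto simp: m_def elim!: degree_eq_zeroE simp: pderiv_pCons)
  next
    case False
    have "degree (pderiv g1) \<le> m - 1"
      by (intro degree_le) (auto simp: coeff_pderiv coeff_eq_0 m_def)
    then have "degree (pderiv g1) < m" using False by simp
    then show ?thesis using \<open>g1 dvd pderiv g1\<close> by (metis dvd_imp_degree_le m_def not_le)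
  qed
  then have ph: "pderiv h1 = 0" using e1 g10 by simp
  have "degree g1 = 0" "degree h1 = 0"
    using pderiv_eq_0_small_degree[OF pg] pderiv_eq_0_small_degree[OF ph] m_small dh1 by (auto simp: m_def)
  then obtain y z where yz: "g1 = [:y:]" "h1 = [:z:]" by (metis degree_eq_zeroE)
  have y0: "y \<noteq> 0" using g10 yz by simp
  have "a s = z / y" if "s \<in> B" for s
    using root[OF that] y0 by (simp add: polyf1 yz field_simps)
  then have "B \<subseteq> {s \<in> A. a s = z / y}" using B(1) by auto
  then have "card B \<le> card {s \<in> A. a s = z / y}" using A(1) by (intro card_mono) auto
  then show ?thesis using cardB by (intro exI[of _ "z / y"]) simp
qed

text \<open>
  The polynomial \<open>G(u, c) = \<Prod> (c + a u - \<beta>)\<close> vanishes on the whole affine plane. For a fixed \<open>u\<close> it is therefore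
  \<open>(c\<^sup>p - c) q\<close> with \<open>q\<close> monic of degree \<open>k\<close>, so its coefficient at \<open>c\<^sup>j\<close> is \<open>-1\<close> for \<open>j = k + 1\<close> and \<open>0\<close> for \<open>k + 1 < j < p\<close>. As a
  polynomial in \<open>u\<close> this coefficient has degree at most \<open>p + k - j < p\<close>, so it is constant, and its coefficient at
  \<open>u\<close> to the power \<open>p + k - j\<close>, which is the coefficient of \<open>\<Prod> (X + a)\<close> at \<open>X\<^sup>j\<close>, vanishes.
\<close>

lemma affine_blocking_gap:
  fixes a \<beta> :: "'i \<Rightarrow> 'p::prime_card mod_ring"
  assumes A: "finite A" "card A = CARD('p) + k" and k: "k + 1 < CARD('p)"
    and block: "\<And>u c. \<exists>s\<in>A. c + a s * u = \<beta> s"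
    and j: "k < j" "j < CARD('p)"
  shows "coeff (\<Prod>s\<in>A. [:a s, 1:]) j = 0"
proof -
  let ?p = "CARD('p)"
  define E where "E = (\<lambda>A. \<Prod>s\<in>A. [:[:- \<beta> s, a s:], 1:])"
  define f where "f = (\<lambda>A. \<Prod>s\<in>A. [:a s, 1:])"
  have degf: "coeff (f A) j = 0" if "j > card A" for A j
  proof -
    have "degree (f A) = card A" unfolding f_def by (subst degree_prod_eq_sum_degree) auto
    then show ?thesis using that by (simp add: coeff_eq_0)
  qed
  have top: "coeff (coeff (E A) j) i = (if i + j = card A then coeff (f A) j else 0)"
    if "finite A" "i + j \<ge> card A" for A i j
    using that
  proof (induction A arbitrary: i j rule: finite_induct)
    case empty
    then show ?case by (cases i; cases j) (auto simp: E_def f_def)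
  next
    case (insert s A)
    have E: "E (insert s A) = [:[:- \<beta> s, a s:], 1:] * E A" and f: "f (insert s A) = [:a s, 1:] * f A"
      using insert.hyps by (simp_all add: E_def f_def)
    have "coeff (coeff (E (insert s A)) j) i = - \<beta> s * coeff (coeff (E A) j) i
      + (if i = 0 then 0 else a s * coeff (coeff (E A) j) (i - 1))
      + (if j = 0 then 0 else coeff (coeff (E A) (j - 1)) i)"
      unfolding E by (cases i; cases j) simp_all
    moreover have "coeff (f (insert s A)) j = a s * coeff (f A) j + (if j = 0 then 0 else coeff (f A) (j - 1))"
      unfolding f by (cases j) simp_all
    moreover have "coeff (coeff (E A) j) i = 0" using insert by simp
    moreover have "coeff (coeff (E A) j) (i - 1) = (if i + j = Suc (card A) then coeff (f A) j else 0)" if "i \<noteq> 0"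
      using insert.IH[of "i - 1" j] insert.prems insert.hyps that by auto
    moreover have "coeff (coeff (E A) (j - 1)) i = (if i + j = Suc (card A) then coeff (f A) (j - 1) else 0)" if "j \<noteq> 0"
      using insert.IH[of i "j - 1"] insert.prems insert.hyps that by auto
    ultimately show ?case using insert.hyps insert.prems degf[of A j] by auto
  qed
  \<comment> \<open>the claimed coefficient of \<open>G(u, c)\<close> at \<open>c\<^sup>j\<close>, for every \<open>u\<close>\<close>
  define v where "v = (if j = k + 1 then - 1 else 0 :: 'p mod_ring)"
  have val: "poly (coeff (E A) j) u = v" for u
  proof -
    define G where "G = (\<Prod>s\<in>A. [:a s * u - \<beta> s, 1:])"
    interpret h: comm_ring_hom "\<lambda>q :: 'p mod_ring poly. poly q u" by unfold_locales auto
    interpret hp: map_poly_comm_ring_hom "\<lambda>q :: 'p mod_ring poly. poly q u" ..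
    have "map_poly (\<lambda>q. poly q u) (E A) = G"
      unfolding E_def G_def hp.hom_prod by (intro prod.cong) (auto simp: Polynomial.map_poly_pCons algebra_simps)
    then have cG: "poly (coeff (E A) j) u = coeff G j" by (metis coeff_map_poly poly_0)
    have degG: "degree G = ?p + k" unfolding G_def using A by (subst degree_prod_eq_sum_degree) auto
    have leadG: "lead_coeff G = 1" unfolding G_def by (subst lead_coeff_prod) simp
    have rootG: "poly G c = 0" for c
    proof -
      obtain s where "s \<in> A" "c + a s * u = \<beta> s" using block by blast
      then show ?thesis unfolding G_def poly_prod using A(1)
        by (intro prod_zero) (auto simp: algebra_simps intro!: bexI[of _ s])
    qed
    \<comment> \<open>\<open>c\<^sup>p - c\<close>, which vanishes at every element of the field\<close>
    define R where "R = monom 1 ?p - [:0, 1 :: 'p mod_ring:]"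
    have p1: "?p > 1" using k by simp
    have cR: "coeff R i = (if i = ?p then 1 else if i = 1 then - 1 else 0)" for i
      using p1 by (cases i) (auto simp: R_def coeff_pCons split: nat.splits)
    have degR: "degree R = ?p" using cR by (intro antisym degree_le le_degree) auto
    have "G mod R = 0"
    proof (rule ccontr)
      assume nz: "G mod R \<noteq> 0"
      have "R \<noteq> 0" using degR p1 by auto
      then have "degree (G mod R) < ?p" using degree_mod_less[of R G] nz degR by simp
      moreover have "poly (G mod R) c = 0" for c
      proof -
        have "poly G c = poly (G div R) c * poly R c + poly (G mod R) c"
          by (metis div_mult_mod_eq poly_add poly_mult)
        moreover have "poly R c = 0" by (simp add: R_def poly_monom power_card_mod_ring)
        ultimately show ?thesis using rootG by simp
      qed
      then have "{c. poly (G mod R) c = 0} = UNIV" by auto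
      then have "?p \<le> degree (G mod R)" using card_poly_roots_bound[OF nz] by simp
      ultimately show False by simp
    qed
    then obtain q where q: "G = R * q" by (metis dvd_eq_mod_eq_0 dvdE)
    have q0: "q \<noteq> 0" using q leadG by auto
    have "degree G = degree R + degree q" using q q0 degR p1 by (subst q, intro degree_mult_eq) auto
    then have degq: "degree q = k" using degG degR by simp
    have leadq: "coeff q k = 1" using leadG q degq by (simp add: lead_coeff_mult cR degR)
    have "coeff G j = coeff (monom 1 ?p * q) j - coeff ([:0, 1:] * q) j" by (simp add: q R_def left_diff_distrib)
    also have "\<dots> = - coeff q (j - 1)" using j by (cases j) (simp_all add: coeff_monom_mult)
    also have "\<dots> = v" using j leadq degq by (cases "j = k + 1") (auto simp: v_def coeff_eq_0)
    finally show ?thesis using cG by simp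
  qed
  have deg: "degree (coeff (E A) j) \<le> ?p + k - j"
    using top[OF A(1)] A(2) by (intro degree_le) auto
  define D where "D = coeff (E A) j - [:v:]"
  have "D = 0"
  proof (rule ccontr)
    assume nz: "D \<noteq> 0"
    have "{u. poly D u = 0} = UNIV" using val by (auto simp: D_def)
    then have "?p \<le> degree D" using card_poly_roots_bound[OF nz] by simp
    moreover have "degree D \<le> ?p + k - j" unfolding D_def using deg by (intro degree_diff_le) auto
    ultimately show False using j by linarith
  qed
  then have "coeff (E A) j = [:v:]" by (simp add: D_def)
  moreover have "coeff (coeff (E A) j) (?p + k - j) = coeff (f A) j" using top[OF A(1), of "?p + k - j" j] A(2) j by simp
  moreover obtain i where "?p + k - j = Suc i" using j by (metis Suc_diff_Suc add.commute add_lessD1 trans_less_add2)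
  ultimately show ?thesis by (simp add: f_def)
qed

definition dot3 :: "'k::comm_ring_1 ^ 3 \<Rightarrow> 'k ^ 3 \<Rightarrow> 'k" where
  "dot3 u v = (\<Sum>i\<in>UNIV. vec_nth u i * vec_nth v i)"

lemma dot3_simps: "dot3 u (v + w) = dot3 u v + dot3 u w" "dot3 u (c *s v) = c * dot3 u v"
  "dot3 u (v - w) = dot3 u v - dot3 u w" "dot3 u 0 = 0"
  by (simp_all add: dot3_def sum_3 algebra_simps)

lemma dot3_adapted_basis:
  fixes b P0 :: "'k::field ^ 3"
  assumes b: "b \<noteq> 0" and P0: "P0 \<noteq> 0" "dot3 b P0 = 0"
  shows "\<exists>P1 P2. dot3 b P1 = 0 \<and> (\<forall>x. P1 \<noteq> x *s P0) \<and> dot3 b P2 = 1"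
proof -
  define n1 n2 n3 v1 v2 v3 where n: "n1 = vec_nth b 1" "n2 = vec_nth b 2" "n3 = vec_nth b 3"
    and v: "v1 = vec_nth P0 1" "v2 = vec_nth P0 2" "v3 = vec_nth P0 3"
  have dotb: "dot3 b w = n1 * vec_nth w 1 + n2 * vec_nth w 2 + n3 * vec_nth w 3" for w
    by (simp add: dot3_def sum_3 n)
  have zero: "w = 0 \<longleftrightarrow> vec_nth w 1 = 0 \<and> vec_nth w 2 = 0 \<and> vec_nth w 3 = 0" for w :: "'k ^ 3"
    by (simp add: Finite_Cartesian_Product.vec_eq_iff forall_3)
  have n0: "n1 \<noteq> 0 \<or> n2 \<noteq> 0 \<or> n3 \<noteq> 0" using b zero[of b] by (auto simp: n)
  have v0: "v1 \<noteq> 0 \<or> v2 \<noteq> 0 \<or> v3 \<noteq> 0" using P0(1) zero[of P0] by (auto simp: v)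
  have nv: "n1 * v1 + n2 * v2 + n3 * v3 = 0" using P0(2) by (simp add: dotb v)
  obtain w1 w2 w3 where w: "w1 * n1 + w2 * n2 + w3 * n3 = 0" "indep3 (v1, v2, v3) (w1, w2, w3)"
    using orthogonal_independent[of v1 n1 v2 n2 v3 n3] nv v0 n0 by (auto simp: mult.commute)
  define P1 :: "'k ^ 3" where "P1 = vector [w1, w2, w3]"
  have "dot3 b P1 = 0" using w(1) by (simp add: dotb P1_def mult.commute)
  moreover have "P1 \<noteq> x *s P0" for x
  proof
    assume eq: "P1 = x *s P0"
    have "vec_nth P1 i = x * vec_nth P0 i" for i by (simp add: eq)
    from this[of 1] this[of 2] this[of 3] have "w1 = x * v1" "w2 = x * v2" "w3 = x * v3"
      by (simp_all only: P1_def vector_3 v)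
    then show False using w(2) by (simp add: indep3_def mult_ac)
  qed
  moreover have "\<exists>P2. dot3 b P2 = 1"
  proof -
    consider "n1 \<noteq> 0" | "n2 \<noteq> 0" | "n3 \<noteq> 0" using n0 by auto
    then show ?thesis
    proof cases
      case 1 then show ?thesis by (intro exI[of _ "vector [1 / n1, 0, 0]"]) (simp add: dotb)
    next
      case 2 then show ?thesis by (intro exI[of _ "vector [0, 1 / n2, 0]"]) (simp add: dotb)
    next
      case 3 then show ?thesis by (intro exI[of _ "vector [0, 0, 1 / n3]"]) (simp add: dotb)
    qed
  qed
  ultimately show ?thesis by blast
qed

text \<open>
  Blokhuis' theorem for a family of points of the dual plane. In a minimal blocking subfamily some line \<open>P0\<close> meets a
  single member \<open>s0\<close>; with \<open>P0\<close> as line at infinity the others are affine points that block all lines except those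
  through \<open>s0\<close>. If the family is small, at least \<open>p\<close> of the affine points have the same \<open>a\<close>, hence lie on one line
  through \<open>s0\<close>, and together with \<open>s0\<close> they are more than \<open>p\<close> members on that line.
\<close>

lemma blocking_family_card:
  fixes b :: "'i \<Rightarrow> 'p::prime_card mod_ring ^ 3"
  assumes odd: "odd CARD('p)" and S: "finite S" and b0: "\<And>s. s \<in> S \<Longrightarrow> b s \<noteq> 0"
    and block: "\<And>P. P \<noteq> 0 \<Longrightarrow> \<exists>s\<in>S. dot3 (b s) P = 0"
    and noline: "\<And>P. P \<noteq> 0 \<Longrightarrow> card {s \<in> S. dot3 (b s) P = 0} \<le> CARD('p)"
  shows "3 * (CARD('p) + 1) \<le> 2 * card S"
proof (rule ccontr)
  assume small: "\<not> ?thesis"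
  let ?p = "CARD('p)"
  let ?bl = "\<lambda>T. T \<subseteq> S \<and> (\<forall>P. P \<noteq> 0 \<longrightarrow> (\<exists>s\<in>T. dot3 (b s) P = 0))"
  have "?bl S" using block by auto
  then obtain T where T: "?bl T" "\<And>T'. ?bl T' \<Longrightarrow> card T \<le> card T'"
    using ex_has_least_nat[of ?bl S card] by blast
  have finT: "finite T" using T(1) S finite_subset by blast
  have "T \<noteq> {}" using T(1) by (metis empty_iff zero_neq_one Finite_Cartesian_Product.vec_eq_iff one_index zero_index)
  then obtain s0 where s0: "s0 \<in> T" by blast
  have "\<not> ?bl (T - {s0})"
    using T(2)[of "T - {s0}"] card_Diff1_less[OF finT s0] by (metis not_le)
  then obtain P0 where P0: "P0 \<noteq> 0" "\<And>s. s \<in> T - {s0} \<Longrightarrow> dot3 (b s) P0 \<noteq> 0" using T(1) by blast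
  then have d0: "dot3 (b s0) P0 = 0" using T(1) by blast
  obtain P1 P2 where P: "dot3 (b s0) P1 = 0" "\<And>x. P1 \<noteq> x *s P0" "dot3 (b s0) P2 = 1"
    using dot3_adapted_basis[OF _ P0(1) d0] b0 s0 T(1) by blast
  define A where "A = T - {s0}"
  have finA: "finite A" using finT by (simp add: A_def)
  define a where "a = (\<lambda>s. dot3 (b s) P1 / dot3 (b s) P0)"
  define \<beta> where "\<beta> = (\<lambda>s. dot3 (b s) P2 / dot3 (b s) P0)"
  have affine: "\<exists>s\<in>A. c + a s * u = \<beta> s" for u c
  proof -
    \<comment> \<open>\<open>?P\<close> runs through the lines that avoid the point \<open>s0\<close>\<close>
    let ?P = "c *s P0 + u *s P1 - P2"
    have "dot3 (b s0) ?P = - 1" by (simp add: dot3_simps d0 P)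
    then have "?P \<noteq> 0" by (auto simp: dot3_simps)
    then obtain s where s: "s \<in> T" "dot3 (b s) ?P = 0" using T(1) by blast
    then have "s \<in> A" using \<open>dot3 (b s0) ?P = - 1\<close> by (auto simp: A_def)
    moreover have "c + a s * u = \<beta> s"
      using s(2) P0(2)[of s] \<open>s \<in> A\<close> by (simp add: dot3_simps a_def \<beta>_def A_def field_simps)
    ultimately show ?thesis by blast
  qed
  have "?p \<le> card A"
  proof -
    define G where "G = (\<Prod>s\<in>A. [:- \<beta> s, 1:])"
    have "poly G c = 0" for c
    proof -
      obtain s where "s \<in> A" "c = \<beta> s" using affine[of c 0] by auto
      then show ?thesis unfolding G_def poly_prod using finA by (intro prod_zero) auto
    qed
    then have "{c. poly G c = 0} = UNIV" by auto
    moreover have "G \<noteq> 0" using finA by (simp add: G_def)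
    ultimately have "?p \<le> degree G" using card_poly_roots_bound[of G] by simp
    also have "degree G = card A" unfolding G_def by (subst degree_prod_eq_sum_degree) auto
    finally show ?thesis .
  qed
  then obtain k where k: "card A = ?p + k" by (metis le_iff_add)
  have "card A + 1 = card T" unfolding A_def using finT s0 by (metis Suc_eq_plus1 card_Suc_Diff1)
  moreover have "card T \<le> card S" using T(1) S by (intro card_mono) auto
  moreover have "2 * card S < 3 * (?p + 1)" using small by (simp only: not_le)
  moreover have "2 * k \<le> q" if "a + 1 = t" "t \<le> s" "2 * s < 3 * (q + 1)" "a = q + k" for a t s q :: nat
    using that by presburger
  ultimately have "2 * k \<le> ?p" using k by blast
  moreover have "2 * k \<noteq> ?p" using odd by (metis dvd_triv_left)
  ultimately have k2: "2 * k < ?p" by simp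
  have "?p \<ge> 2" using prime_ge_2_nat[OF prime_card[where 'a = 'p]] .
  then have "k + 1 < ?p" using k2 odd by (cases "?p = 2") auto
  then have "\<exists>x. ?p \<le> card {s \<in> A. a s = x}"
    using affine_blocking_gap[OF finA k _ affine] by (intro lacunary_fully_reducible[OF finA k k2]) auto
  then obtain x where x: "?p \<le> card {s \<in> A. a s = x}" by blast
  \<comment> \<open>a line through \<open>s0\<close> and all points with \<open>a s = x\<close>\<close>
  let ?P = "P1 - x *s P0"
  have "insert s0 {s \<in> A. a s = x} \<subseteq> {s \<in> S. dot3 (b s) ?P = 0}"
    using T(1) s0 P0(2) by (auto simp: A_def a_def dot3_simps d0 P)
  then have "card (insert s0 {s \<in> A. a s = x}) \<le> card {s \<in> S. dot3 (b s) ?P = 0}"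
    using S by (intro card_mono) auto
  moreover have "card (insert s0 {s \<in> A. a s = x}) = Suc (card {s \<in> A. a s = x})"
    using finA by (intro card_insert_disjoint) (auto simp: A_def)
  moreover have "?P \<noteq> 0" using P(2)[of x] by simp
  ultimately show False using noline[of ?P] x by linarith
qed

section \<open>Wronskians of forms\<close>

lemma homogeneous3_det:
  fixes A :: "'k::comm_ring_1 poly3 mat"
  assumes A: "A \<in> carrier_mat N N"
    and hom: "\<And>k i. k < N \<Longrightarrow> i < N \<Longrightarrow> homogeneous3 (e k) (A $$ (k, i))"
  shows "homogeneous3 (\<Sum>k<N. e k) (det A)"
  unfolding det_def'[OF A]
proof (rule homogeneous3_sum)
  fix \<pi> assume "\<pi> \<in> {\<pi>. \<pi> permutes {0..<N}}"
  then have "\<pi> i < N" if "i < N" for i using that by (auto dest: permutes_in_image)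
  then have "homogeneous3 (\<Sum>k\<in>{0..<N}. e k) (\<Prod>k = 0..<N. A $$ (k, \<pi> k))"
    by (intro homogeneous3_prod hom) auto
  then have h: "homogeneous3 (\<Sum>k<N. e k) (\<Prod>k = 0..<N. A $$ (k, \<pi> k))"
    by (simp only: atLeast0LessThan)
  then have "homogeneous3 (\<Sum>k<N. e k) (0 - (\<Prod>k = 0..<N. A $$ (k, \<pi> k)))"
    by (intro homogeneous3_diff) auto
  with h show "homogeneous3 (\<Sum>k<N. e k) (of_int (sign \<pi>) * (\<Prod>k = 0..<N. A $$ (k, \<pi> k)))"
    by (simp add: sign_def)
qed

text \<open>
  The Frobenius Wronskian of forms, with an operator \<open>J\<close> on forms in place of \<open>d/dt\<close>.
\<close>

definition form_wronskian ::
  "('p::prime_card mod_ring poly3 \<Rightarrow> 'p mod_ring poly3) \<Rightarrow> nat \<Rightarrow> (nat \<Rightarrow> 'p mod_ring poly3) \<Rightarrow> 'p mod_ring poly3" where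
  "form_wronskian J n f = det (mat (n + 1) (n + 1) (\<lambda>(k, i). if k < n then (J ^^ k) (f i) else f i ^ CARD('p)))"

lemma iterate_homogeneous3:
  fixes J :: "'k::comm_ring_1 poly3 \<Rightarrow> 'k poly3"
  assumes J: "\<And>m f. m \<ge> 1 \<Longrightarrow> homogeneous3 m f \<Longrightarrow> homogeneous3 (m + e) (J f)"
    and m: "m \<ge> 1" and f: "homogeneous3 m f"
  shows "homogeneous3 (m + k * e) ((J ^^ k) f)"
proof (induction k)
  case (Suc k)
  have "homogeneous3 (m + k * e + e) (J ((J ^^ k) f))" using Suc m by (intro J) auto
  then show ?case by (simp add: add_ac)
qed (use f in simp)

lemma homogeneous3_form_wronskian:
  fixes f :: "nat \<Rightarrow> 'p::prime_card mod_ring poly3"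
  assumes J: "\<And>m f. m \<ge> 1 \<Longrightarrow> homogeneous3 m f \<Longrightarrow> homogeneous3 (m + e) (J f)"
    and m: "m \<ge> 1" and f: "\<And>i. i \<le> n \<Longrightarrow> homogeneous3 m (f i)"
  shows "homogeneous3 (m * (n + CARD('p)) + e * (\<Sum>k<n. k)) (form_wronskian J n f)"
proof -
  define d where "d = (\<lambda>k. if k < n then m + k * e else CARD('p) * m)"
  have "homogeneous3 (\<Sum>k<n + 1. d k) (form_wronskian J n f)"
    unfolding form_wronskian_def
  proof (rule homogeneous3_det)
    fix k i assume "k < n + 1" "i < n + 1"
    then show "homogeneous3 (d k)
      (mat (n + 1) (n + 1) (\<lambda>(k, i). if k < n then (J ^^ k) (f i) else f i ^ CARD('p)) $$ (k, i))"
      by (auto simp: d_def intro!: iterate_homogeneous3 J m f homogeneous3_power)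
  qed simp
  moreover have "(\<Sum>k<n + 1. d k) = m * (n + CARD('p)) + e * (\<Sum>k<n. k)"
    by (simp add: d_def sum.distrib sum_distrib_left algebra_simps)
  ultimately show ?thesis by simp
qed

lemma evf_form_wronskian:
  fixes f :: "nat \<Rightarrow> 'p::prime_card mod_ring poly3"
  assumes J: "\<And>m f. m \<ge> 1 \<Longrightarrow> homogeneous3 m f \<Longrightarrow> homogeneous3 (m + e) (J f)"
    and ev: "\<And>m f. homogeneous3 m f \<Longrightarrow> evf \<gamma> (J f) = of_nat m * a * evf \<gamma> f + b * fps_deriv (evf \<gamma> f)"
    and m: "m \<ge> 1" and f: "\<And>i. i \<le> n \<Longrightarrow> homogeneous3 m (f i)"
  shows "evf \<gamma> (form_wronskian J n f) = b ^ (\<Sum>k<n. k) * det (frobenius_wronskian n (\<lambda>i. evf \<gamma> (f i)))"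
proof -
  obtain \<alpha> where \<alpha>: "\<And>k i. i \<in> {..n} \<Longrightarrow> evf \<gamma> ((J ^^ k) (f i)) = (\<Sum>l\<le>k. \<alpha> k l * (fps_deriv ^^ l) (evf \<gamma> (f i)))"
    "\<And>k. \<alpha> k k = b ^ k * 1"
  proof (rule iterated_derivation_triangular[of "{..n}" "\<lambda>k i. evf \<gamma> ((J ^^ k) (f i))" 1 "\<lambda>i. evf \<gamma> (f i)"
      "\<lambda>k. of_nat (m + k * e) * a" b])
    fix k i assume "i \<in> {..n}"
    then have "homogeneous3 (m + k * e) ((J ^^ k) (f i))" by (intro iterate_homogeneous3 J m f) auto
    then show "evf \<gamma> ((J ^^ Suc k) (f i)) = of_nat (m + k * e) * a * evf \<gamma> ((J ^^ k) (f i))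
      + b * fps_deriv (evf \<gamma> ((J ^^ k) (f i)))" by (simp add: ev)
  qed auto
  let ?A = "mat (n + 1) (n + 1) (\<lambda>(k, i). if k < n then (J ^^ k) (f i) else f i ^ CARD('p))"
  define \<beta> where "\<beta> = (\<lambda>k l. if k < n then \<alpha> k l else if l < n then 0 else 1)"
  have "evf \<gamma> (form_wronskian J n f) = det (map_mat (evf \<gamma>) ?A)"
    unfolding form_wronskian_def by (simp only: evf.hom_det)
  also have "\<dots> = (\<Prod>k<n + 1. \<beta> k k) * det (frobenius_wronskian n (\<lambda>i. evf \<gamma> (f i)))"
  proof (rule det_triangular_rows[where \<alpha> = \<beta>])
    fix k i assume ki: "k < n + 1" "i < n + 1"
    show "map_mat (evf \<gamma>) ?A $$ (k, i)
      = (\<Sum>l\<le>k. \<beta> k l * frobenius_wronskian n (\<lambda>i. evf \<gamma> (f i)) $$ (l, i))"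
    proof (cases "k < n")
      case True
      then show ?thesis using ki by (auto simp: frobenius_wronskian_def \<beta>_def \<alpha>(1) intro!: sum.cong)
    next
      case False
      then have k: "k = n" using ki by simp
      then show ?thesis using ki
        by (simp add: frobenius_wronskian_def \<beta>_def evf.hom_power flip: lessThan_Suc_atMost)
    qed
  qed (simp_all add: frobenius_wronskian_def)
  also have "(\<Prod>k<n + 1. \<beta> k k) = b ^ (\<Sum>k<n. k)" by (simp add: \<beta>_def \<alpha>(2) power_sum)
  finally show ?thesis .
qed

text \<open>
  The Jacobian determinant of \<open>x\<close>, \<open>F\<close> and \<open>f\<close>, a derivation of the ring of forms that kills \<open>F\<close>; \<open>jacobian_y\<close> is the
  analogue for \<open>y\<close>.
\<close>

definition jacobian_x :: "'k::idom poly3 \<Rightarrow> 'k poly3 \<Rightarrow> 'k poly3" where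
  "jacobian_x F f = dy3 F * dz3 f - dz3 F * dy3 f"

definition jacobian_y :: "'k::idom poly3 \<Rightarrow> 'k poly3 \<Rightarrow> 'k poly3" where
  "jacobian_y F f = dz3 F * dx3 f - dx3 F * dz3 f"

lemma homogeneous3_jacobian:
  assumes F: "homogeneous3 d F" and d: "d \<ge> 2" and m: "m \<ge> 1" and f: "homogeneous3 m f"
  shows "homogeneous3 (m + (d - 2)) (jacobian_x F f)" "homogeneous3 (m + (d - 2)) (jacobian_y F f)"
proof -
  have e: "(d - 1) + (m - 1) = m + (d - 2)" using d m by simp
  note h = homogeneous3_d3[OF F] homogeneous3_d3[OF f]
  show "homogeneous3 (m + (d - 2)) (jacobian_x F f)" "homogeneous3 (m + (d - 2)) (jacobian_y F f)"
    unfolding jacobian_x_def jacobian_y_def e[symmetric]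
    by (intro homogeneous3_diff homogeneous3_mult h)+
qed

text \<open>
  With the gradient of \<open>F\<close> written as \<open>\<kappa> (\<gamma> \<times> \<gamma>')\<close>, both identities follow from Euler's identity and the chain rule
  for \<open>f\<close>. The first says \<open>J\<^sub>x f = - \<kappa> x\<^sup>m\<^sup>+\<^sup>1 (f / x\<^sup>m)'\<close>.
\<close>

lemma evf_jacobian:
  fixes F :: "'k::idom poly3" and \<gamma>
  defines "x \<equiv> fst \<gamma>" and "y \<equiv> fst (snd \<gamma>)" and "z \<equiv> snd (snd \<gamma>)"
  assumes \<kappa>: "evf \<gamma> (dx3 F) = \<kappa> * (y * fps_deriv z - z * fps_deriv y)"
    "evf \<gamma> (dy3 F) = \<kappa> * (z * fps_deriv x - x * fps_deriv z)"
    "evf \<gamma> (dz3 F) = \<kappa> * (x * fps_deriv y - y * fps_deriv x)"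
    and f: "homogeneous3 m f"
  shows "evf \<gamma> (jacobian_x F f) = of_nat m * (\<kappa> * fps_deriv x) * evf \<gamma> f + (- \<kappa> * x) * fps_deriv (evf \<gamma> f)"
    "evf \<gamma> (jacobian_y F f) = of_nat m * (\<kappa> * fps_deriv y) * evf \<gamma> f + (- \<kappa> * y) * fps_deriv (evf \<gamma> f)"
proof -
  define A B C where "A = evf \<gamma> (dx3 f)" and "B = evf \<gamma> (dy3 f)" and "C = evf \<gamma> (dz3 f)"
  have eu: "of_nat m * evf \<gamma> f = x * A + y * B + z * C"
    using euler_evf[OF f, of \<gamma>] by (simp add: A_def B_def C_def x_def y_def z_def)
  have de: "fps_deriv (evf \<gamma> f) = A * fps_deriv x + B * fps_deriv y + C * fps_deriv z"
    unfolding deriv_evf by (simp add: A_def B_def C_def x_def y_def z_def)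
  have "evf \<gamma> (jacobian_x F f) = evf \<gamma> (dy3 F) * C - evf \<gamma> (dz3 F) * B"
    by (simp add: jacobian_x_def evf.hom_minus evf.hom_mult B_def C_def)
  also have "\<dots> = \<kappa> * fps_deriv x * (x * A + y * B + z * C)
    - \<kappa> * x * (A * fps_deriv x + B * fps_deriv y + C * fps_deriv z)"
    unfolding \<kappa> by (simp add: algebra_simps)
  finally show "evf \<gamma> (jacobian_x F f) = of_nat m * (\<kappa> * fps_deriv x) * evf \<gamma> f + (- \<kappa> * x) * fps_deriv (evf \<gamma> f)"
    unfolding eu[symmetric] de[symmetric] by (simp add: mult_ac)
  have "evf \<gamma> (jacobian_y F f) = evf \<gamma> (dz3 F) * A - evf \<gamma> (dx3 F) * C"
    by (simp add: jacobian_y_def evf.hom_minus evf.hom_mult A_def C_def)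
  also have "\<dots> = \<kappa> * fps_deriv y * (x * A + y * B + z * C)
    - \<kappa> * y * (A * fps_deriv x + B * fps_deriv y + C * fps_deriv z)"
    unfolding \<kappa> by (simp add: algebra_simps)
  finally show "evf \<gamma> (jacobian_y F f) = of_nat m * (\<kappa> * fps_deriv y) * evf \<gamma> f + (- \<kappa> * y) * fps_deriv (evf \<gamma> f)"
    unfolding eu[symmetric] de[symmetric] by (simp add: mult_ac)
qed

context monic_form
begin

text \<open>
  A form that vanishes identically along a branch violates Bezout's inequality for every contact order.
\<close>

lemma evf_eq_0_imp_dvd:
  assumes "branch F \<gamma>" "homogeneous3 M f" "evf \<gamma> f = 0"
  shows "F dvd f"
proof (rule ccontr)
  assume "\<not> F dvd f"
  then have "(\<Sum>\<delta>\<in>{\<gamma>}. d * M + 1) \<le> d * M" using assms by (intro bezout[where A = f]) auto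
  then show False by simp
qed

lemma subdegree_evf_le:
  assumes "branch F \<gamma>" "f \<in> reduced_forms d m" "f \<noteq> 0"
  shows "evf \<gamma> f \<noteq> 0" "subdegree (evf \<gamma> f) \<le> d * m"
proof -
  have hom: "homogeneous3 m f" and nd: "\<not> F dvd f"
    using assms dvd_reduced_zero by (auto simp: reduced_forms_def)
  show "evf \<gamma> f \<noteq> 0" using evf_eq_0_imp_dvd[OF assms(1) hom] nd by blast
  have "(\<Sum>\<delta>\<in>{\<gamma>}. subdegree (evf \<gamma> f)) \<le> d * m"
    using assms(1) by (intro bezout[OF _ _ _ hom nd]) (auto intro: fps_X_power_dvd_if_le_subdegree)
  then show "subdegree (evf \<gamma> f) \<le> d * m" by simp
qed

text \<open>
  A reduced form is determined by its coefficients at the exponents that occur as orders: the difference of two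
  forms that agree there has an order at which its coefficient is zero.
\<close>

lemma card_orders:
  assumes "branch F \<gamma>"
  shows "card (exponents3 d m) \<le> card ((\<lambda>f. subdegree (evf \<gamma> f)) ` (reduced_forms d m - {0}))"
proof -
  let ?R = "reduced_forms d m :: 'p mod_ring poly3 set" and ?p = "CARD('p mod_ring)"
  define Ord where "Ord = (\<lambda>f. subdegree (evf \<gamma> f)) ` (?R - {0})"
  have finR: "finite ?R"
    using card_reduced_forms[where ?'k = "'p mod_ring", of d m] by (intro card_ge_0_finite) simp
  then have finO: "finite Ord" by (simp add: Ord_def)
  define g where "g = (\<lambda>f. restrict (\<lambda>k. fps_nth (evf \<gamma> f) k) Ord)"
  have "inj_on g ?R"
  proof (rule inj_onI, rule ccontr)
    fix f f' assume f: "f \<in> ?R" "f' \<in> ?R" "g f = g f'" "f \<noteq> f'"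
    then have h: "f - f' \<in> ?R - {0}" by (auto intro: reduced_forms_diff)
    let ?o = "subdegree (evf \<gamma> (f - f'))"
    have "?o \<in> Ord" using h by (auto simp: Ord_def)
    then have "fps_nth (evf \<gamma> f) ?o = fps_nth (evf \<gamma> f') ?o"
      using f(3) by (metis g_def restrict_apply')
    then have "fps_nth (evf \<gamma> (f - f')) ?o = 0" by (simp add: evf.hom_minus)
    moreover have "evf \<gamma> (f - f') \<noteq> 0" using subdegree_evf_le(1)[OF assms] h by blast
    ultimately show False using nth_subdegree_nonzero by blast
  qed
  moreover have "g ` ?R \<subseteq> Ord \<rightarrow>\<^sub>E (UNIV :: 'p mod_ring set)" by (auto simp: g_def)
  moreover have "finite (Ord \<rightarrow>\<^sub>E (UNIV :: 'p mod_ring set))" by (intro finite_PiE finO) auto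
  ultimately have "card ?R \<le> card (Ord \<rightarrow>\<^sub>E (UNIV :: 'p mod_ring set))" by (rule card_inj_on_le)
  then have "?p ^ card (exponents3 d m) \<le> ?p ^ card Ord"
    by (simp add: card_reduced_forms card_PiE finO)
  moreover have "1 < ?p" using prime_card[where ?'a = 'p] prime_gt_1_nat by simp
  ultimately show ?thesis by (simp add: power_increasing_iff Ord_def)
qed

lemma forms_with_distinct_orders:
  assumes br: "branch F \<gamma>" and r: "n + 1 + r \<le> card (exponents3 d m)"
  obtains f where "\<And>i. i \<le> n \<Longrightarrow> f i \<in> reduced_forms d m" "\<And>i. i \<le> n \<Longrightarrow> f i \<noteq> 0"
    "inj_on (\<lambda>i. subdegree (evf \<gamma> (f i))) {..n}" "\<And>i. i \<le> n \<Longrightarrow> r \<le> subdegree (evf \<gamma> (f i))"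
proof -
  define Ord where "Ord = (\<lambda>f. subdegree (evf \<gamma> f)) ` (reduced_forms d m - {0})"
  have "card Ord > 0" using card_orders[OF br, of m] r by (simp add: Ord_def)
  then have finO: "finite Ord" by (rule card_ge_0_finite)
  have "card Ord - card {..<r} \<le> card (Ord - {..<r})" by (rule diff_card_le_card_Diff) simp
  then have "n + 1 \<le> card (Ord - {..<r})" using card_orders[OF br, of m] r by (simp add: Ord_def)
  then obtain Ord' where Ord': "Ord' \<subseteq> Ord - {..<r}" "card Ord' = n + 1" "finite Ord'"
    by (rule obtain_subset_with_card_n)
  then obtain h where h: "bij_betw h {0..<n + 1} Ord'" using ex_bij_betw_nat_finite[of Ord'] by auto
  have hO: "h i \<in> Ord'" if "i \<le> n" for i using bij_betwE[OF h] that by auto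
  then have "\<exists>f\<in>reduced_forms d m - {0}. subdegree (evf \<gamma> f) = h i" if "i \<le> n" for i
    using that Ord'(1) by (force simp: Ord_def)
  then obtain f where f: "\<And>i. i \<le> n \<Longrightarrow> f i \<in> reduced_forms d m - {0} \<and> subdegree (evf \<gamma> (f i)) = h i"
    by metis
  have "inj_on (\<lambda>i. subdegree (evf \<gamma> (f i))) {..n}"
  proof (rule inj_onI)
    fix i j assume ij: "i \<in> {..n}" "j \<in> {..n}" "subdegree (evf \<gamma> (f i)) = subdegree (evf \<gamma> (f j))"
    then have "h i = h j" using f by simp
    then show "i = j" using bij_betw_imp_inj_on[OF h] ij by (auto dest: inj_onD)
  qed
  moreover have "r \<le> subdegree (evf \<gamma> (f i))" if "i \<le> n" for i
    using hO[OF that] f[OF that] Ord'(1) by auto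
  ultimately show ?thesis using that[of f] f by blast
qed

lemma coeff_power_mult_reduced:
  assumes "\<forall>k\<ge>d. coeff w k = 0"
  shows "\<forall>k\<ge>d. coeff (X3 ^ N * w) k = 0" "\<forall>k\<ge>d. coeff (Y3 ^ N * w) k = 0"
proof -
  have w: "coeff3 w i j k = 0" if "k \<ge> d" for i j k using assms that by (simp add: coeff3_def)
  have "coeff (X3 ^ N * w) k = 0" "coeff (Y3 ^ N * w) k = 0" if "k \<ge> d" for k
    using coeff3_power_mult(1)[of N w _ _ k] coeff3_power_mult(2)[of N w _ _ k] w[OF that]
    by (auto intro!: poly_eqI simp: coeff3_def)
  then show "\<forall>k\<ge>d. coeff (X3 ^ N * w) k = 0" "\<forall>k\<ge>d. coeff (Y3 ^ N * w) k = 0" by auto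
qed

text \<open>
  For the reduced representatives the congruence becomes the equation \<open>y\<^sup>N w = x\<^sup>N w'\<close>, so \<open>x\<^sup>N\<close> divides \<open>w\<close>.
\<close>

lemma divide_by_X3_power:
  assumes W: "homogeneous3 (M + N) W" "homogeneous3 (M + N) W'" and dv: "F dvd Y3 ^ N * W - X3 ^ N * W'"
  obtains A where "homogeneous3 M A" "F dvd W - X3 ^ N * A"
proof -
  obtain w where w: "w \<in> reduced_forms d (M + N)" "F dvd W - w" using exists_reduced[OF W(1)] by blast
  obtain w' where w': "w' \<in> reduced_forms d (M + N)" "F dvd W' - w'" using exists_reduced[OF W(2)] by blast
  have "F dvd (Y3 ^ N * W - X3 ^ N * W') - (Y3 ^ N * (W - w) - X3 ^ N * (W' - w'))"
    by (rule dvd_diff[OF dv dvd_diff[OF dvd_mult[OF w(2)] dvd_mult[OF w'(2)]]])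
  then have "F dvd Y3 ^ N * w - X3 ^ N * w'" by (simp add: algebra_simps)
  moreover have "\<forall>k\<ge>d. coeff (Y3 ^ N * w - X3 ^ N * w') k = 0"
    using coeff_power_mult_reduced(2)[of w N] coeff_power_mult_reduced(1)[of w' N] w w'
    by (auto simp: reduced_forms_def)
  ultimately have "Y3 ^ N * w - X3 ^ N * w' = 0" by (rule dvd_reduced_zero)
  then have eq: "Y3 ^ N * w = X3 ^ N * w'" by simp
  have w0: "coeff3 w i j k = 0" if "i < N" for i j k
  proof -
    have "coeff3 w i j k = coeff3 (Y3 ^ N * w) i (j + N) k" by (simp add: coeff3_power_mult)
    also have "\<dots> = 0" unfolding eq using that by (simp add: coeff3_power_mult)
    finally show ?thesis .
  qed
  define A where "A = map_poly (map_poly (poly_shift N)) w"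
  have shift0: "poly_shift N (0 :: 'p mod_ring poly) = 0" by (intro poly_eqI) (simp add: coeff_poly_shift)
  have cA: "coeff3 A i j k = coeff3 w (i + N) j k" for i j k
    by (simp add: coeff3_def A_def coeff_map_poly coeff_poly_shift shift0)
  have "w = X3 ^ N * A"
    by (intro coeff3_eqI) (auto simp: coeff3_power_mult cA w0)
  moreover have "homogeneous3 M A"
    using w(1) by (fastforce simp: reduced_forms_def homogeneous3_def cA)
  ultimately show ?thesis using that w(2) by blast
qed

end

section \<open>The upper bound for the number of smooth points\<close>

text \<open>
  Here \<open>g\<close> is the arithmetic genus. The reduced forms of degree \<open>m\<close> have dimension \<open>d m - g + 1 = 4 g + 1 + r\<close>, so that
  prescribing a zero of order \<open>r\<close> at one point leaves exactly the \<open>4 g + 1\<close> forms that are wanted.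
\<close>

lemma degree_multiple_above_genus:
  fixes d g :: nat
  assumes d: "d \<ge> 3" and g: "2 * g = (d - 1) * (d - 2)"
  obtains m r where "d * m = 5 * g + r" "r < d" "m \<ge> 1" "d \<le> m + 2" "2 * g = d * (d - 3) + 2" "d \<le> 2 * g + 1" "g \<ge> 1"
proof -
  obtain c where c: "d = c + 3" using d by (metis add.commute le_Suc_ex)
  have g': "2 * g = c * c + 3 * c + 2" using g by (simp add: c algebra_simps)
  define m where "m = (5 * g + (d - 1)) div d"
  define r where "r = d * m - 5 * g"
  have lo: "5 * g \<le> d * m"
  proof -
    have "5 * g + (d - 1) = d * m + (5 * g + (d - 1)) mod d" by (simp add: m_def)
    moreover have "(5 * g + (d - 1)) mod d < d" using d by simp
    ultimately show ?thesis by linarith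
  qed
  have hi: "d * m \<le> 5 * g + (d - 1)" by (simp add: m_def)
  have 1: "d * m = 5 * g + r" "r < d" using lo hi d by (auto simp: r_def)
  have "m \<ge> c + 1"
  proof (rule ccontr)
    assume "\<not> m \<ge> c + 1"
    then have "d * m \<le> d * c" by (intro mult_le_mono2) simp
    then have "2 * (5 * g) \<le> 2 * (d * c)" using lo by linarith
    moreover have "d * c = c * c + 3 * c" by (simp add: c algebra_simps)
    ultimately have "5 * (c * c + 3 * c + 2) \<le> 2 * (c * c + 3 * c)" using g' by simp
    then show False by (simp add: algebra_simps)
  qed
  then have "m \<ge> 1" "d \<le> m + 2" using c by auto
  moreover have "2 * g = d * (d - 3) + 2" using g' by (simp add: c algebra_simps)
  moreover have "d \<le> 2 * g + 1" "g \<ge> 1" using g' c by auto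
  ultimately show ?thesis using that 1 by blast
qed

text \<open>
  Bezout's inequality with \<open>n = 4 g\<close> inserted. For general \<open>n\<close> the bound for \<open>s\<close> is \<open>p + 1 + g (n + p / n)\<close>, smallest at
  \<open>n = \<surd>p\<close>, and \<open>4 g\<close> is just that in the critical case \<open>p \<approx> 16 g\<^sup>2\<close>.
\<close>

lemma point_count_arithmetic:
  fixes d g m r n N p s M :: nat
  assumes d: "d \<ge> 3" and dm: "d * m = 5 * g + r" and g: "2 * g = d * (d - 3) + 2" and g1: "g \<ge> 1"
    and n: "n = 4 * g" and N: "2 * N = n * (n - 1)" and M: "M = m * (n + p) + (d - 3) * N"
    and le: "s * n + r * (n + p) \<le> d * M"
  shows "4 * s \<le> 5 * p + 16 * g * g + 4"
proof -
  have "d * M = (d * m) * (n + p) + (d * (d - 3)) * N" by (simp add: M algebra_simps)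
  also have "d * (d - 3) = 2 * (g - 1)" using g by simp
  also have "2 * (g - 1) * N = (g - 1) * (2 * N)" by simp
  also have "2 * N = n * (n - 1)" by (rule N)
  finally have "s * n \<le> 5 * g * (n + p) + (g - 1) * (n * (n - 1))"
    using le by (simp add: dm algebra_simps)
  then have "g * (4 * s) \<le> g * (5 * (n + p) + 4 * ((g - 1) * (n - 1)))"
    by (simp add: n algebra_simps)
  then have "4 * s \<le> 5 * (n + p) + 4 * ((g - 1) * (n - 1))" using g1 by simp
  moreover obtain c where "g = c + 1" using g1 by (metis add.commute le_Suc_ex)
  ultimately show ?thesis by (simp add: n algebra_simps)
qed

lemma double_sum_lessThan: "2 * (\<Sum>k<n. k) = n * (n - 1 :: nat)"
proof (induction n)
  case (Suc n) then show ?case by (cases n) auto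
qed simp

context monic_form
begin

text \<open>
  The method of Stoehr and Voloch. Let \<open>\<omega>\<close> be the Frobenius Wronskian along a branch of \<open>n + 1 = 4 g + 1\<close> reduced forms
  of degree \<open>m\<close> that vanish to order \<open>r\<close> at a chosen smooth point and have distinct orders there. The Wronskians
  \<open>W\<close> and \<open>W'\<close> formed with the two Jacobian derivations restrict to \<open>(\<kappa> x)\<^sup>N \<omega>\<close> and \<open>(\<kappa> y)\<^sup>N \<omega>\<close>, with \<open>N = n (n - 1) / 2\<close>, so
  \<open>y\<^sup>N W = x\<^sup>N W'\<close> modulo \<open>F\<close> and \<open>W = x\<^sup>N A\<close> modulo \<open>F\<close>. The form \<open>A\<close> vanishes where \<open>\<omega>\<close> does: to order \<open>n\<close> at every smooth
  point, and to order \<open>n + r (n + p)\<close> at the chosen one, where the factors \<open>t\<^sup>r\<close> come out of the determinant. Passing from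
  \<open>W\<close> to \<open>A\<close> saves \<open>N\<close> in the degree, which removes the zeros of \<open>W\<close> on the line \<open>x = 0\<close>; without this the count
  would be too weak.
\<close>

lemma card_smooth_branches_le:
  assumes d: "d \<ge> 3" and p: "CARD('p) \<ge> 4 * (d - 1)\<^sup>2 * (d - 2)\<^sup>2"
    and S: "finite S" and sm: "\<And>\<gamma>. \<gamma> \<in> S \<Longrightarrow> smooth_branch F \<gamma>"
    and dist: "\<And>\<gamma> \<delta>. \<gamma> \<in> S \<Longrightarrow> \<delta> \<in> S \<Longrightarrow> \<gamma> \<noteq> \<delta> \<Longrightarrow> indep3 (nth3 \<gamma> 0) (nth3 \<delta> 0)"
  shows "2 * card S \<le> 3 * CARD('p) + 2"
proof (cases "S = {}")
  case False
  then obtain \<gamma>0 where \<gamma>0: "\<gamma>0 \<in> S" by blast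
  let ?p = "CARD('p)"
  define g where "g = (d - 1) * (d - 2) div 2"
  have "even ((d - 1) * (d - 2))" using d by (cases "even d") auto
  then have g2: "2 * g = (d - 1) * (d - 2)" by (simp add: g_def)
  obtain m r where mr: "d * m = 5 * g + r" "r < d" "m \<ge> 1" "d \<le> m + 2" "2 * g = d * (d - 3) + 2"
    "d \<le> 2 * g + 1" "g \<ge> 1" using degree_multiple_above_genus[OF d g2] by blast
  have pg: "16 * g * g \<le> ?p"
  proof -
    have "16 * g * g = 4 * (2 * g)\<^sup>2" by (simp add: power2_eq_square)
    also have "\<dots> = 4 * (d - 1)\<^sup>2 * (d - 2)\<^sup>2" unfolding g2 by (simp add: power_mult_distrib)
    finally show ?thesis using p by simp
  qed
  have gg: "g \<le> g * g" by simp
  define n where "n = 4 * g"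
  have np: "n \<le> ?p" using pg gg unfolding n_def by linarith
  have dmp: "d * m < ?p" using pg gg mr by linarith
  have "2 * card (exponents3 d m) + d * (d - 1) = 2 * d * (m + 1)"
    by (rule card_exponents3_eq[OF mr(4)])
  moreover have "d * (d - 1) = d * (d - 3) + 2 * d" using d by (simp add: algebra_simps flip: distrib_left)
  ultimately have card_ex: "card (exponents3 d m) = n + 1 + r"
    using mr(1,5) by (simp add: n_def algebra_simps)
  have br: "branch F \<gamma>" if "\<gamma> \<in> S" for \<gamma> using sm[OF that] by (rule smooth_branch_imp_branch)
  obtain f where f: "\<And>i. i \<le> n \<Longrightarrow> f i \<in> reduced_forms d m" "\<And>i. i \<le> n \<Longrightarrow> f i \<noteq> 0"
    "inj_on (\<lambda>i. subdegree (evf \<gamma>0 (f i))) {..n}" "\<And>i. i \<le> n \<Longrightarrow> r \<le> subdegree (evf \<gamma>0 (f i))"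
    using forms_with_distinct_orders[OF br[OF \<gamma>0], of n r m] card_ex by auto
  have homf: "homogeneous3 m (f i)" if "i \<le> n" for i using f(1)[OF that] by (simp add: reduced_forms_def)
  define W where "W = form_wronskian (jacobian_x F) n f"
  define W' where "W' = form_wronskian (jacobian_y F) n f"
  define N where "N = (\<Sum>k<n. k)"
  define \<omega> where "\<omega> = (\<lambda>\<gamma>. det (frobenius_wronskian n (\<lambda>i. evf \<gamma> (f i))))"
  have d2: "d \<ge> 2" using d by simp
  define M where "M = m * (n + ?p) + (d - 3) * N"
  have MN: "m * (n + ?p) + (d - 2) * N = M + N"
  proof -
    have "d - 2 = Suc (d - 3)" using d by simp
    then show ?thesis by (simp add: M_def)
  qed
  have "homogeneous3 (m * (n + ?p) + (d - 2) * N) W"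
    unfolding W_def N_def
    by (rule homogeneous3_form_wronskian[OF homogeneous3_jacobian(1)[OF hom_F d2] mr(3) homf])
  moreover have "homogeneous3 (m * (n + ?p) + (d - 2) * N) W'"
    unfolding W'_def N_def
    by (rule homogeneous3_form_wronskian[OF homogeneous3_jacobian(2)[OF hom_F d2] mr(3) homf])
  ultimately have homW: "homogeneous3 (M + N) W" "homogeneous3 (M + N) W'" unfolding MN by auto
  have evW: "\<exists>\<kappa>. fps_nth \<kappa> 0 \<noteq> 0 \<and> evf \<gamma> W = (\<kappa> * fst \<gamma>) ^ N * \<omega> \<gamma> \<and> evf \<gamma> W' = (\<kappa> * fst (snd \<gamma>)) ^ N * \<omega> \<gamma>"
    if \<gamma>: "\<gamma> \<in> S" for \<gamma>
  proof -
    obtain \<kappa> where \<kappa>: "fps_nth \<kappa> 0 \<noteq> 0"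
      "evf \<gamma> (dx3 F) = \<kappa> * (fst (snd \<gamma>) * fps_deriv (snd (snd \<gamma>)) - snd (snd \<gamma>) * fps_deriv (fst (snd \<gamma>)))"
      "evf \<gamma> (dy3 F) = \<kappa> * (snd (snd \<gamma>) * fps_deriv (fst \<gamma>) - fst \<gamma> * fps_deriv (snd (snd \<gamma>)))"
      "evf \<gamma> (dz3 F) = \<kappa> * (fst \<gamma> * fps_deriv (fst (snd \<gamma>)) - fst (snd \<gamma>) * fps_deriv (fst \<gamma>))"
      using smooth_branch_cross_gradient[OF hom_F sm[OF \<gamma>]] by blast
    have "evf \<gamma> W = (- \<kappa> * fst \<gamma>) ^ N * \<omega> \<gamma>"
      unfolding W_def N_def \<omega>_def
      by (rule evf_form_wronskian[OF homogeneous3_jacobian(1)[OF hom_F d2] evf_jacobian(1)[OF \<kappa>(2-4)] mr(3) homf])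
    moreover have "evf \<gamma> W' = (- \<kappa> * fst (snd \<gamma>)) ^ N * \<omega> \<gamma>"
      unfolding W'_def N_def \<omega>_def
      by (rule evf_form_wronskian[OF homogeneous3_jacobian(2)[OF hom_F d2] evf_jacobian(2)[OF \<kappa>(2-4)] mr(3) homf])
    ultimately show ?thesis using \<kappa>(1) by (intro exI[of _ "- \<kappa>"]) simp
  qed
  have "F dvd Y3 ^ N * W - X3 ^ N * W'"
  proof (rule evf_eq_0_imp_dvd[OF br[OF \<gamma>0]])
    show "homogeneous3 (N * 1 + (M + N)) (Y3 ^ N * W - X3 ^ N * W')"
      by (intro homogeneous3_diff homogeneous3_mult homogeneous3_power homogeneous3_vars homW)
    show "evf \<gamma>0 (Y3 ^ N * W - X3 ^ N * W') = 0"
      using evW[OF \<gamma>0] by (auto simp: evf.hom_minus evf.hom_mult evf.hom_power power_mult_distrib)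
  qed
  then obtain A where A: "homogeneous3 M A" "F dvd W - X3 ^ N * A"
    using divide_by_X3_power[OF homW] by blast
  have evA: "\<exists>\<kappa>. fps_nth \<kappa> 0 \<noteq> 0 \<and> evf \<gamma> A = \<kappa> ^ N * \<omega> \<gamma>" if \<gamma>: "\<gamma> \<in> S" for \<gamma>
  proof -
    obtain \<kappa> where \<kappa>: "fps_nth \<kappa> 0 \<noteq> 0" "evf \<gamma> W = (\<kappa> * fst \<gamma>) ^ N * \<omega> \<gamma>" using evW[OF \<gamma>] by blast
    have F0: "evf \<gamma> F = 0" using br[OF \<gamma>] by (simp add: branch_def)
    obtain q where "W - X3 ^ N * A = F * q" using A(2) by (rule dvdE)
    then have "evf \<gamma> (W - X3 ^ N * A) = 0" by (simp add: evf.hom_mult F0)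
    then have "fst \<gamma> ^ N * evf \<gamma> A = evf \<gamma> W" by (simp add: evf.hom_minus evf.hom_mult evf.hom_power)
    also have "\<dots> = fst \<gamma> ^ N * (\<kappa> ^ N * \<omega> \<gamma>)" by (simp only: \<kappa>(2) power_mult_distrib mult_ac)
    finally have "fst \<gamma> ^ N * evf \<gamma> A = fst \<gamma> ^ N * (\<kappa> ^ N * \<omega> \<gamma>)" .
    moreover have "fst \<gamma> \<noteq> 0"
    proof
      assume "fst \<gamma> = 0"
      then have "evf \<gamma> X3 = 0" by (subst evf_base)
      then have "F dvd X3" by (rule evf_eq_0_imp_dvd[OF br[OF \<gamma>] homogeneous3_vars(1)])
      moreover have "\<forall>k\<ge>d. coeff (X3 :: 'p mod_ring poly3) k = 0"
        using d_pos by (auto simp: X3_def coeff_pCons split: nat.splits)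
      ultimately have "(X3 :: 'p mod_ring poly3) = 0" by (rule dvd_reduced_zero)
      then show False by (simp add: X3_def)
    qed
    ultimately show ?thesis using \<kappa>(1) by auto
  qed
  have \<omega>0: "\<omega> \<gamma>0 \<noteq> 0" unfolding \<omega>_def
  proof (rule frobenius_wronskian_nonzero)
    fix i assume "i \<le> n"
    from subdegree_evf_le[OF br[OF \<gamma>0] f(1)[OF this] f(2)[OF this]] dmp
    show "evf \<gamma>0 (f i) \<noteq> 0" "subdegree (evf \<gamma>0 (f i)) < ?p" by auto
  qed (rule f(3))
  have nd: "\<not> F dvd A"
  proof
    assume "F dvd A"
    then obtain q where "A = F * q" by (rule dvdE)
    then have "evf \<gamma>0 A = 0" using br[OF \<gamma>0] by (simp add: evf.hom_mult branch_def)
    moreover obtain \<kappa> where "fps_nth \<kappa> 0 \<noteq> 0" "evf \<gamma>0 A = \<kappa> ^ N * \<omega> \<gamma>0" using evA[OF \<gamma>0] by blast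
    ultimately show False using \<omega>0 by auto
  qed
  define k where "k = (\<lambda>\<gamma>. n + (if \<gamma> = \<gamma>0 then r * (n + ?p) else 0))"
  have "sum k S \<le> d * M"
  proof (rule bezout[OF S br dist A(1) nd])
    fix \<gamma> assume \<gamma>: "\<gamma> \<in> S"
    have "fps_X ^ k \<gamma> dvd \<omega> \<gamma>"
    proof (cases "\<gamma> = \<gamma>0")
      case False
      then show ?thesis using frobenius_wronskian_vanishes[OF np] by (simp add: k_def \<omega>_def)
    next
      case True
      have "fps_X ^ r dvd evf \<gamma>0 (f i)" if "i \<le> n" for i
        by (rule fps_X_power_dvd_if_le_subdegree[OF f(4)[OF that]])
      then have "\<exists>u. evf \<gamma>0 (f i) = fps_X ^ r * u" if "i \<le> n" for i using that by (auto simp: dvd_def)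
      then obtain u where u: "\<And>i. i \<le> n \<Longrightarrow> evf \<gamma>0 (f i) = fps_X ^ r * u i" by metis
      have "frobenius_wronskian n (\<lambda>i. evf \<gamma>0 (f i)) = frobenius_wronskian n (\<lambda>i. fps_X ^ r * u i)"
        unfolding frobenius_wronskian_def by (rule eq_matI) (auto simp: u)
      then have "\<omega> \<gamma>0 = (fps_X ^ r) ^ (n + ?p) * det (frobenius_wronskian n u)"
        unfolding \<omega>_def by (simp only: frobenius_wronskian_scale)
      then have "\<omega> \<gamma>0 = fps_X ^ (r * (n + ?p)) * det (frobenius_wronskian n u)" by (simp only: power_mult)
      moreover have "fps_X ^ (r * (n + ?p) + n) dvd fps_X ^ (r * (n + ?p)) * det (frobenius_wronskian n u)"
        unfolding power_add by (rule mult_dvd_mono[OF dvd_refl frobenius_wronskian_vanishes[OF np]])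
      ultimately show ?thesis using True by (simp add: k_def add.commute)
    qed
    moreover obtain \<kappa> where "evf \<gamma> A = \<kappa> ^ N * \<omega> \<gamma>" using evA[OF \<gamma>] by blast
    ultimately show "fps_X ^ k \<gamma> dvd evf \<gamma> A" by simp
  qed
  moreover have "sum k S = card S * n + r * (n + ?p)"
    using S \<gamma>0 by (simp add: k_def sum.distrib)
  ultimately have le: "card S * n + r * (n + ?p) \<le> d * M" by simp
  have "2 * N = n * (n - 1)" unfolding N_def by (rule double_sum_lessThan)
  then have "4 * card S \<le> 5 * ?p + 16 * g * g + 4"
    by (rule point_count_arithmetic[OF d mr(1,5,7) n_def _ M_def le])
  then show ?thesis using pg by linarith
qed simp

end

section \<open>Linear changes of coordinates\<close>

lemma homogeneous3_eq_sum_monomials: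
  assumes "homogeneous3 d f"
  shows "f = (\<Sum>t\<in>exponents3 (d + 1) d. const3 (case t of (i, j, k) \<Rightarrow> coeff3 f i j k) * mon3 t)"
proof (rule coeff3_eqI)
  fix i j k
  let ?E = "exponents3 (d + 1) d"
  have "(\<Sum>t\<in>?E. coeff3 (const3 (case t of (i, j, k) \<Rightarrow> coeff3 f i j k) * mon3 t) i j k)
    = (\<Sum>t\<in>?E. if t = (i, j, k) then coeff3 f i j k else 0)"
  proof (rule sum.cong[OF refl])
    fix t assume "t \<in> ?E"
    show "coeff3 (const3 (case t of (i, j, k) \<Rightarrow> coeff3 f i j k) * mon3 t) i j k
      = (if t = (i, j, k) then coeff3 f i j k else 0)"
      by (cases t) (auto simp: coeff3_const3_mult coeff3_mon3)
  qed
  also have "\<dots> = (if (i, j, k) \<in> ?E then coeff3 f i j k else 0)" by (simp add: finite_exponents3)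
  also have "\<dots> = coeff3 f i j k" using assms by (auto simp: homogeneous3_def exponents3_def)
  finally show "coeff3 f i j k
    = coeff3 (\<Sum>t\<in>?E. const3 (case t of (i, j, k) \<Rightarrow> coeff3 f i j k) * mon3 t) i j k"
    by (simp add: coeff3_sum)
qed

lemma ev3_homogeneous3:
  assumes c: "comm_ring_hom c" and f: "homogeneous3 d f"
  shows "ev3 c x y z f = (\<Sum>(i, j, k)\<in>exponents3 (d + 1) d. c (coeff3 f i j k) * (x ^ i * (y ^ j * z ^ k)))"
proof -
  interpret c: comm_ring_hom c by fact
  interpret e: comm_ring_hom "ev3 c x y z" by (rule comm_ring_hom_ev3[OF c])
  have "ev3 c x y z f = (\<Sum>t\<in>exponents3 (d + 1) d.
      ev3 c x y z (const3 (case t of (i, j, k) \<Rightarrow> coeff3 f i j k) * mon3 t))"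
    by (subst homogeneous3_eq_sum_monomials[OF f]) (simp only: e.hom_sum)
  also have "\<dots> = (\<Sum>(i, j, k)\<in>exponents3 (d + 1) d. c (coeff3 f i j k) * (x ^ i * (y ^ j * z ^ k)))"
  proof (rule sum.cong[OF refl])
    fix t :: "nat \<times> nat \<times> nat"
    obtain i j k where t: "t = (i, j, k)" by (cases t)
    show "ev3 c x y z (const3 (case t of (i, j, k) \<Rightarrow> coeff3 f i j k) * mon3 t)
      = (case t of (i, j, k) \<Rightarrow> c (coeff3 f i j k) * (x ^ i * (y ^ j * z ^ k)))"
      by (simp add: t mon3_def e.hom_mult e.hom_power ev3_const3_X3_Y3_Z3 c)
  qed
  finally show ?thesis .
qed

lemma homogeneous3_substitute:
  assumes f: "homogeneous3 d f" and xyz: "homogeneous3 1 x" "homogeneous3 1 y" "homogeneous3 1 z"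
  shows "homogeneous3 d (ev3 const3 x y z f)"
  unfolding ev3_homogeneous3[OF comm_ring_hom_const3 f]
proof (rule homogeneous3_sum)
  fix t assume t: "t \<in> exponents3 (d + 1) d"
  obtain i j k where ijk: "t = (i, j, k)" by (cases t)
  have "homogeneous3 (i * 1 + (j * 1 + k * 1)) (x ^ i * (y ^ j * z ^ k))"
    by (intro homogeneous3_mult homogeneous3_power xyz)
  moreover have "i * 1 + (j * 1 + k * 1) = d" using t by (simp add: ijk exponents3_def)
  ultimately show "homogeneous3 d (case t of (i, j, k) \<Rightarrow> const3 (coeff3 f i j k) * (x ^ i * (y ^ j * z ^ k)))"
    by (auto simp: ijk intro: homogeneous3_const3_mult)
qed

text \<open>
  The substitution for the linear map \<open>(x, y, z) \<mapsto> (x + a z, y + b z, z)\<close>, which takes \<open>(0, 0, 1)\<close> to \<open>(a, b, 1)\<close>.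
\<close>

definition shear3 :: "'k::comm_ring_1 \<Rightarrow> 'k \<Rightarrow> 'k poly3 \<Rightarrow> 'k poly3" where
  "shear3 a b = ev3 const3 (X3 + const3 a * Z3) (Y3 + const3 b * Z3) Z3"

lemma comm_ring_hom_shear3: "comm_ring_hom (shear3 a b)"
  unfolding shear3_def by (intro comm_ring_hom_ev3 comm_ring_hom_const3)

lemma shear3_base: "shear3 a b (const3 c) = const3 c" "shear3 a b X3 = X3 + const3 a * Z3"
  "shear3 a b Y3 = Y3 + const3 b * Z3" "shear3 a b Z3 = Z3"
  by (simp_all add: shear3_def ev3_const3_X3_Y3_Z3 comm_ring_hom_const3)

lemma ev3_shear3:
  assumes c: "comm_ring_hom c"
  shows "ev3 c x y z (shear3 a b f) = ev3 c (x + c a * z) (y + c b * z) z f"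
proof (rule poly3_hom_unique)
  interpret e: comm_ring_hom "ev3 c x y z" by (rule comm_ring_hom_ev3[OF c])
  interpret s: comm_ring_hom "shear3 a b" by (rule comm_ring_hom_shear3)
  show "comm_ring_hom (\<lambda>f. ev3 c x y z (shear3 a b f))"
    by unfold_locales (simp_all add: e.hom_add e.hom_mult s.hom_add s.hom_mult)
  show "comm_ring_hom (ev3 c (x + c a * z) (y + c b * z) z)" by (rule comm_ring_hom_ev3[OF c])
  show "ev3 c x y z (shear3 a b (const3 k)) = ev3 c (x + c a * z) (y + c b * z) z (const3 k)" for k
    by (simp only: shear3_base ev3_const3_X3_Y3_Z3[OF c])
  show "ev3 c x y z (shear3 a b X3) = ev3 c (x + c a * z) (y + c b * z) z X3"
    "ev3 c x y z (shear3 a b Y3) = ev3 c (x + c a * z) (y + c b * z) z Y3"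
    "ev3 c x y z (shear3 a b Z3) = ev3 c (x + c a * z) (y + c b * z) z Z3"
    by (simp_all only: shear3_base e.hom_add e.hom_mult ev3_const3_X3_Y3_Z3[OF c])
qed

lemma shear3_inverse: "shear3 (- a) (- b) (shear3 a b f) = f" "shear3 a b (shear3 (- a) (- b) f) = f"
proof -
  have id: "ev3 const3 X3 Y3 Z3 f = f" for f :: "'a poly3"
    by (rule poly3_hom_unique[OF comm_ring_hom_ev3[OF comm_ring_hom_const3] comm_ring_hom_id])
      (simp_all add: ev3_const3_X3_Y3_Z3 comm_ring_hom_const3)
  have neg: "const3 (- a) = - const3 a" for a :: 'a by (simp add: const3_def)
  show "shear3 (- a) (- b) (shear3 a b f) = f"
    unfolding shear3_def[of "- a"] by (simp add: ev3_shear3 comm_ring_hom_const3 neg id)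
  show "shear3 a b (shear3 (- a) (- b) f) = f"
    unfolding shear3_def[of a] by (simp add: ev3_shear3 comm_ring_hom_const3 neg id)
qed

lemma irreducible_shear3:
  assumes F: "irreducible (F :: 'k::field poly3)"
  shows "irreducible (shear3 a b F)"
proof -
  interpret s: comm_ring_hom "shear3 a b :: 'k poly3 \<Rightarrow> _" by (rule comm_ring_hom_shear3)
  interpret t: comm_ring_hom "shear3 (- a) (- b) :: 'k poly3 \<Rightarrow> _" by (rule comm_ring_hom_shear3)
  have us: "is_unit (shear3 a b f)" if "is_unit f" for f
    using that by (metis dvdE dvdI s.hom_mult s.hom_one)
  have ut: "is_unit (shear3 (- a) (- b) f)" if "is_unit f" for f
    using that by (metis dvdE dvdI t.hom_mult t.hom_one)
  show ?thesis
  proof (rule irreducibleI)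
    show "shear3 a b F \<noteq> 0" using F by (metis irreducible_def shear3_inverse(1) t.hom_zero)
    show "\<not> is_unit (shear3 a b F)" using F ut by (metis irreducible_def shear3_inverse(1))
  next
    fix u v assume "shear3 a b F = u * v"
    then have "F = shear3 (- a) (- b) u * shear3 (- a) (- b) v" by (metis shear3_inverse(1) t.hom_mult)
    then have "is_unit (shear3 (- a) (- b) u) \<or> is_unit (shear3 (- a) (- b) v)"
      using F by (rule irreducibleD[rotated])
    then show "is_unit u \<or> is_unit v" using us by (metis shear3_inverse(2))
  qed
qed

lemma homogeneous3_shear3: "homogeneous3 d f \<Longrightarrow> homogeneous3 d (shear3 a b f)"
  unfolding shear3_def
  by (intro homogeneous3_substitute homogeneous3_add homogeneous3_const3_mult homogeneous3_vars)

lemma d3_shear3: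
  "dx3 (shear3 a b f) = shear3 a b (dx3 f)" "dy3 (shear3 a b f) = shear3 a b (dy3 f)"
  "dz3 (shear3 a b f) = const3 a * shear3 a b (dx3 f) + const3 b * shear3 a b (dy3 f) + shear3 a b (dz3 f)"
  unfolding shear3_def
  by (subst derivation_ev3[OF comm_ring_hom_const3]; simp add: d3_add d3_mult)+

lemma ev3_at_001:
  assumes "homogeneous3 d f"
  shows "ev3 (\<lambda>x. x) 0 0 1 f = coeff3 f 0 0 d"
proof -
  have "ev3 (\<lambda>x. x) 0 0 1 f = (\<Sum>t\<in>exponents3 (d + 1) d. if t = (0, 0, d) then coeff3 f 0 0 d else 0)"
    unfolding ev3_homogeneous3[OF comm_ring_hom_id assms]
    by (intro sum.cong) (auto simp: exponents3_def power_0_left split: if_splits)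
  also have "\<dots> = coeff3 f 0 0 d" by (simp add: finite_exponents3) (simp add: exponents3_def)
  finally show ?thesis .
qed

text \<open>
  The dehomogenisation at \<open>z = 1\<close> is a nonzero polynomial of degree less than the size of the field in both variables.
\<close>

lemma nonzero_form_nonvanishing_point:
  fixes F :: "'k::{field,finite} poly3"
  assumes F: "homogeneous3 d F" and F0: "F \<noteq> 0" and d: "d < CARD('k)"
  shows "\<exists>a b. ev3 (\<lambda>x. x) a b 1 F \<noteq> 0"
proof -
  define G where "G = poly F 1"
  have cG: "coeff (coeff G j) i = (\<Sum>k\<le>degree F. coeff3 F i j k)" for i j
    by (simp add: G_def poly_altdef coeff_sum coeff3_def)
  have vanish: "coeff (coeff G j) i = 0" if "i + j > d" for i j
    unfolding cG using F that by (intro sum.neutral) (force simp: homogeneous3_def)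
  obtain i j k where ijk: "coeff3 F i j k \<noteq> 0" using F0 coeff3_eqI[of F 0] by auto
  then have "k \<le> degree F" by (metis coeff3_def coeff_0 coeff_eq_0 not_le)
  have "coeff3 F i j k' = 0" if "k' \<noteq> k" for k'
  proof (rule ccontr)
    assume "coeff3 F i j k' \<noteq> 0"
    then have "i + j + k' = d" "i + j + k = d" using F ijk unfolding homogeneous3_def by blast+
    then show False using that by simp
  qed
  then have "(\<Sum>k'\<le>degree F. coeff3 F i j k') = (\<Sum>k'\<in>{k}. coeff3 F i j k')"
    using \<open>k \<le> degree F\<close> by (intro sum.mono_neutral_right) auto
  then have "coeff (coeff G j) i \<noteq> 0" using ijk by (simp add: cG)
  then have G0: "G \<noteq> 0" by auto
  have "degree G \<le> d" using vanish by (intro degree_le allI impI poly_eqI) auto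
  moreover have "card {c. poly G c = 0} \<le> degree G" by (rule card_poly_roots_bound[OF G0])
  moreover have "card (range (\<lambda>b :: 'k. [:b:])) = CARD('k)" by (intro card_image inj_onI) simp
  ultimately have "\<not> range (\<lambda>b :: 'k. [:b:]) \<subseteq> {c. poly G c = 0}"
    using d card_mono[OF poly_roots_finite[OF G0], of "range (\<lambda>b :: 'k. [:b:])"] by linarith
  then obtain b where b: "poly G [:b:] \<noteq> 0" by auto
  have "degree (coeff G j * [:b:] ^ j) \<le> d" for j
  proof -
    have "degree (coeff G j) \<le> d" using vanish[of _ j] by (intro degree_le) auto
    moreover have "degree ([:b:] ^ j) = 0" using degree_power_le[of "[:b:]" j] by simp
    ultimately show ?thesis using degree_mult_le[of "coeff G j" "[:b:] ^ j"] by linarith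
  qed
  then have "degree (poly G [:b:]) \<le> d" unfolding poly_altdef by (intro degree_sum_le) auto
  moreover have "card {a. poly (poly G [:b:]) a = 0} \<le> degree (poly G [:b:])"
    by (rule card_poly_roots_bound[OF b])
  ultimately have "{a. poly (poly G [:b:]) a = 0} \<noteq> UNIV" using d by (metis le_trans not_le)
  then obtain a where "poly (poly G [:b:]) a \<noteq> 0" by auto
  moreover have "ev3 (\<lambda>x. x) a b 1 F = poly (poly G [:b:]) a"
    using eval3_eq_ev3[of F "vector [a, b, 1]"] by (simp add: eval3_def G_def flip: one_pCons)
  ultimately show ?thesis by metis
qed

section \<open>Smooth rational points\<close>

text \<open>
  Coordinate vectors of pairwise different smooth points.
\<close>

definition smooth_vectors :: "'k::field poly3 \<Rightarrow> ('k ^ 3) set \<Rightarrow> bool" where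
  "smooth_vectors F S \<longleftrightarrow> (\<forall>v\<in>S. v \<noteq> 0 \<and> eval3 F v = 0 \<and> gradient3 F v \<noteq> 0) \<and>
    (\<forall>v\<in>S. \<forall>w\<in>S. \<forall>c. v \<noteq> w \<longrightarrow> w \<noteq> c *s v)"

lemma vec3_eq_0_iff: "w = 0 \<longleftrightarrow> vec_nth w 1 = 0 \<and> vec_nth w 2 = 0 \<and> vec_nth w 3 = 0"
  for w :: "'k::zero ^ 3"
  by (simp add: Finite_Cartesian_Product.vec_eq_iff forall_3)

text \<open>
  The branches are those of the sheared curve at the correspondingly moved points, so that sheared forms take the
  original values at \<open>t = 0\<close>.
\<close>

lemma branches_at_smooth_vectors:
  fixes F :: "'k::field poly3"
  assumes F: "homogeneous3 d F" and S: "smooth_vectors F S"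
  obtains \<gamma> where "\<And>v. v \<in> S \<Longrightarrow> smooth_branch (shear3 a b F) (\<gamma> v)"
    "\<And>v f. v \<in> S \<Longrightarrow> fps_nth (evf (\<gamma> v) (shear3 a b f)) 0 = eval3 f v"
    "\<And>\<delta> \<epsilon>. \<delta> \<in> \<gamma> ` S \<Longrightarrow> \<epsilon> \<in> \<gamma> ` S \<Longrightarrow> \<delta> \<noteq> \<epsilon> \<Longrightarrow> indep3 (nth3 \<delta> 0) (nth3 \<epsilon> 0)"
    "inj_on \<gamma> S"
proof -
  define x y z where "x = (\<lambda>v :: 'k ^ 3. vec_nth v 1 - a * vec_nth v 3)"
    and "y = (\<lambda>v :: 'k ^ 3. vec_nth v 2 - b * vec_nth v 3)" and "z = (\<lambda>v :: 'k ^ 3. vec_nth v 3)"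
  have ev: "ev3 (\<lambda>x. x) (x v) (y v) (z v) (shear3 a b f) = eval3 f v" for v f
    by (simp add: ev3_shear3 comm_ring_hom_id x_def y_def z_def eval3_eq_ev3)
  interpret ev: comm_ring_hom "ev3 (\<lambda>x::'k. x) p q r" for p q r
    by (intro comm_ring_hom_ev3 comm_ring_hom_id)
  have xyz0: "(x v, y v, z v) \<noteq> (0, 0, 0)" if "v \<noteq> 0" for v
    using that vec3_eq_0_iff[of v] by (auto simp: x_def y_def z_def)
  have "\<exists>\<delta>. nth3 \<delta> 0 = (x v, y v, z v) \<and> smooth_branch (shear3 a b F) \<delta>" if v: "v \<in> S" for v
  proof (rule exists_branch[OF homogeneous3_shear3[OF F] _ _ refl refl refl])
    show "(x v, y v, z v) \<noteq> (0, 0, 0)" using xyz0 v S by (auto simp: smooth_vectors_def)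
    show "ev3 (\<lambda>x. x) (x v) (y v) (z v) (shear3 a b F) = 0" using v S by (simp add: ev smooth_vectors_def)
    have "gradient3 F v \<noteq> 0" using v S by (simp add: smooth_vectors_def)
    then have "eval3 (dx3 F) v \<noteq> 0 \<or> eval3 (dy3 F) v \<noteq> 0 \<or> eval3 (dz3 F) v \<noteq> 0"
      using vec3_eq_0_iff[of "gradient3 F v"] by (simp add: gradient3_nth)
    then show "(ev3 (\<lambda>x. x) (x v) (y v) (z v) (dx3 (shear3 a b F)), ev3 (\<lambda>x. x) (x v) (y v) (z v) (dy3 (shear3 a b F)),
        ev3 (\<lambda>x. x) (x v) (y v) (z v) (dz3 (shear3 a b F))) \<noteq> (0, 0, 0)"
      by (auto simp: d3_shear3 ev ev.hom_add ev.hom_mult ev3_const3_X3_Y3_Z3 comm_ring_hom_id)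
  qed
  then obtain \<gamma> where \<gamma>: "\<And>v. v \<in> S \<Longrightarrow> nth3 (\<gamma> v) 0 = (x v, y v, z v)"
    "\<And>v. v \<in> S \<Longrightarrow> smooth_branch (shear3 a b F) (\<gamma> v)" by metis
  have 2: "fps_nth (evf (\<gamma> v) (shear3 a b f)) 0 = eval3 f v" if "v \<in> S" for v f
    using \<gamma>(1)[OF that] unfolding fps_nth_0_evf by (simp add: nth3_def ev)
  have 3: "indep3 (nth3 (\<gamma> v) 0) (nth3 (\<gamma> w) 0)" if vw: "v \<in> S" "w \<in> S" "v \<noteq> w" for v w
  proof (rule ccontr)
    assume "\<not> ?thesis"
    then have "\<not> indep3 (x v, y v, z v) (x w, y w, z w)" using \<gamma>(1) vw by simp
    moreover have "v \<noteq> 0" using vw S by (simp add: smooth_vectors_def)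
    ultimately obtain c where c: "x w = c * x v" "y w = c * y v" "z w = c * z v"
      using not_indep3_proportional xyz0 by blast
    then have "vec_nth w 1 = c * vec_nth v 1" "vec_nth w 2 = c * vec_nth v 2" "vec_nth w 3 = c * vec_nth v 3"
      by (simp_all add: x_def y_def z_def algebra_simps)
    then have "w = c *s v" by (simp add: Finite_Cartesian_Product.vec_eq_iff forall_3)
    then show False using S vw by (auto simp: smooth_vectors_def)
  qed
  have "inj_on \<gamma> S"
  proof (rule inj_onI, rule ccontr)
    fix v w assume "v \<in> S" "w \<in> S" "\<gamma> v = \<gamma> w" "v \<noteq> w"
    then have "indep3 (nth3 (\<gamma> v) 0) (nth3 (\<gamma> v) 0)" using 3 by metis
    then show False by (auto simp: indep3_def split: prod.splits)
  qed
  moreover have "indep3 (nth3 \<delta> 0) (nth3 \<epsilon> 0)" if "\<delta> \<in> \<gamma> ` S" "\<epsilon> \<in> \<gamma> ` S" "\<delta> \<noteq> \<epsilon>" for \<delta> \<epsilon>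
    using that 3 by (metis imageE)
  ultimately show ?thesis using that \<gamma>(2) 2 by blast
qed

locale irreducible_curve =
  fixes F :: "'p::prime_card mod_ring poly3" and d :: nat
  assumes irr: "irreducible F" and homF: "homogeneous3 d F" and d3: "d \<ge> 3" and dp: "d < CARD('p)"
begin

text \<open>
  As \<open>d < p\<close> some rational point \<open>(a, b, 1)\<close> lies off the curve. The shear puts it at \<open>(0, 0, 1)\<close>, which makes \<open>F\<close> monic in
  \<open>z\<close> up to a constant.
\<close>

lemma monic_shear: "\<exists>a b. monic_form (shear3 a b F) d"
proof -
  have F0: "F \<noteq> 0" using irr by auto
  have "d < CARD('p mod_ring)" using dp by simp
  then obtain a b where ab: "ev3 (\<lambda>x. x) a b 1 F \<noteq> 0"
    using nonzero_form_nonvanishing_point[OF homF F0] by blast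
  have "monic_form (shear3 a b F) d"
  proof
    show "homogeneous3 d (shear3 a b F)" by (rule homogeneous3_shear3[OF homF])
    then have "coeff3 (shear3 a b F) 0 0 d = ev3 (\<lambda>x. x) 0 0 1 (shear3 a b F)" by (simp add: ev3_at_001)
    also have "\<dots> = ev3 (\<lambda>x. x) a b 1 F" by (simp add: ev3_shear3 comm_ring_hom_id)
    finally show "coeff3 (shear3 a b F) 0 0 d \<noteq> 0" using ab by simp
    show "prime_elem (shear3 a b F)" using irreducible_shear3[OF irr] by (rule irreducible_imp_prime_elem)
    show "d \<ge> 1" using d3 by simp
  qed
  then show ?thesis by blast
qed

lemma card_smooth_vectors_le:
  assumes p: "CARD('p) \<ge> 4 * (d - 1)\<^sup>2 * (d - 2)\<^sup>2" and S: "finite S" "smooth_vectors F S"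
  shows "2 * card S \<le> 3 * CARD('p) + 2"
proof -
  obtain a b where "monic_form (shear3 a b F) d" using monic_shear by blast
  then interpret m: monic_form "shear3 a b F" d .
  obtain \<gamma> where \<gamma>: "\<And>v. v \<in> S \<Longrightarrow> smooth_branch (shear3 a b F) (\<gamma> v)"
    "\<And>\<delta> \<epsilon>. \<delta> \<in> \<gamma> ` S \<Longrightarrow> \<epsilon> \<in> \<gamma> ` S \<Longrightarrow> \<delta> \<noteq> \<epsilon> \<Longrightarrow> indep3 (nth3 \<delta> 0) (nth3 \<epsilon> 0)" "inj_on \<gamma> S"
    using branches_at_smooth_vectors[OF homF S(2), of a b] by metis
  have "2 * card (\<gamma> ` S) \<le> 3 * CARD('p) + 2"
    by (rule m.card_smooth_branches_le[OF d3 p _ _ \<gamma>(2)]) (use \<gamma>(1) S(1) in blast)+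
  then show ?thesis by (simp add: card_image[OF \<gamma>(3)])
qed

lemma card_smooth_vectors_on_curve_le:
  assumes S: "finite S" "smooth_vectors F S"
    and A: "homogeneous3 M A" "M < d" "A \<noteq> 0" "\<And>v. v \<in> S \<Longrightarrow> eval3 A v = 0"
  shows "card S \<le> d * M"
proof -
  obtain a b where "monic_form (shear3 a b F) d" using monic_shear by blast
  then interpret m: monic_form "shear3 a b F" d .
  interpret s: comm_ring_hom "shear3 a b :: 'p mod_ring poly3 \<Rightarrow> _" by (rule comm_ring_hom_shear3)
  interpret t: comm_ring_hom "shear3 (- a) (- b) :: 'p mod_ring poly3 \<Rightarrow> _" by (rule comm_ring_hom_shear3)
  obtain \<gamma> where \<gamma>: "\<And>v. v \<in> S \<Longrightarrow> smooth_branch (shear3 a b F) (\<gamma> v)"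
    "\<And>v f. v \<in> S \<Longrightarrow> fps_nth (evf (\<gamma> v) (shear3 a b f)) 0 = eval3 f v"
    "\<And>\<delta> \<epsilon>. \<delta> \<in> \<gamma> ` S \<Longrightarrow> \<epsilon> \<in> \<gamma> ` S \<Longrightarrow> \<delta> \<noteq> \<epsilon> \<Longrightarrow> indep3 (nth3 \<delta> 0) (nth3 \<epsilon> 0)" "inj_on \<gamma> S"
    using branches_at_smooth_vectors[OF homF S(2), of a b] by metis
  have hA: "homogeneous3 M (shear3 a b A)" by (rule homogeneous3_shear3[OF A(1)])
  have nd: "\<not> shear3 a b F dvd shear3 a b A"
  proof
    assume "shear3 a b F dvd shear3 a b A"
    moreover have "coeff (shear3 a b A) k = 0" if "k \<ge> d" for k
    proof (intro poly_eqI)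
      fix j i
      have "coeff3 (shear3 a b A) i j k = 0" using hA that A(2) by (force simp: homogeneous3_def)
      then show "coeff (coeff (coeff (shear3 a b A) k) j) i = coeff (coeff 0 j) i" by (simp add: coeff3_def)
    qed
    ultimately have "shear3 a b A = 0" using m.dvd_reduced_zero by blast
    then have "A = 0" by (metis shear3_inverse(1) t.hom_zero)
    with A(3) show False by simp
  qed
  have "(\<Sum>\<delta>\<in>\<gamma> ` S. 1) \<le> d * M"
  proof (rule m.bezout[OF _ _ \<gamma>(3) hA nd])
    fix \<delta> assume "\<delta> \<in> \<gamma> ` S"
    then obtain v where v: "v \<in> S" "\<delta> = \<gamma> v" by blast
    show "branch (shear3 a b F) \<delta>" using \<gamma>(1) v smooth_branch_imp_branch by blast
    show "fps_X ^ 1 dvd evf \<delta> (shear3 a b A)"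
      unfolding fps_X_power_dvd_iff_nth using \<gamma>(2) v A(4) by simp
  qed (use S(1) in blast)+
  then show ?thesis by (simp add: card_image[OF \<gamma>(4)])
qed

end

section \<open>Points on many tangents\<close>

text \<open>
  The first polar of \<open>f\<close> with respect to the point \<open>P\<close>: its zeros on a curve \<open>f = 0\<close> are the singular points and the points
  whose tangent passes through \<open>P\<close>.
\<close>

definition directional3 :: "'k::idom ^ 3 \<Rightarrow> 'k poly3 \<Rightarrow> 'k poly3" where
  "directional3 P f = const3 (vec_nth P 1) * dx3 f + const3 (vec_nth P 2) * dy3 f + const3 (vec_nth P 3) * dz3 f"

lemma eval3_directional3: "eval3 (directional3 P F) v = dot3 (gradient3 F v) P"
proof -
  interpret ev: comm_ring_hom "ev3 (\<lambda>x::'a. x) p q r" for p q r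
    by (intro comm_ring_hom_ev3 comm_ring_hom_id)
  show ?thesis
    by (simp add: directional3_def eval3_eq_ev3 ev.hom_add ev.hom_mult ev3_const3_X3_Y3_Z3 comm_ring_hom_id
        dot3_def sum_3 gradient3_nth mult.commute)
qed

lemma directional3_0 [simp]: "directional3 P 0 = 0"
  by (simp add: directional3_def dx3_def dy3_def dz3_def)

lemma directional3_commute:
  "directional3 P (dx3 f) = dx3 (directional3 P f)" "directional3 P (dy3 f) = dy3 (directional3 P f)"
  "directional3 P (dz3 f) = dz3 (directional3 P f)"
  by (rule coeff3_eqI, simp add: directional3_def coeff3_const3_mult coeff3_d3, simp add: algebra_simps)+

lemma homogeneous3_directional3: "homogeneous3 m f \<Longrightarrow> homogeneous3 (m - 1) (directional3 P f)"
  unfolding directional3_def by (intro homogeneous3_add homogeneous3_const3_mult homogeneous3_d3)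

text \<open>
  The restriction of \<open>f\<close> to the line is a polynomial in \<open>s\<close> of degree below \<open>p\<close> whose derivative vanishes.
\<close>

lemma eval3_along_line:
  fixes f :: "'p::prime_card mod_ring poly3"
  assumes f: "homogeneous3 e f" and e: "e < CARD('p)" and D: "directional3 P f = 0"
  shows "eval3 f (v + s *s P) = eval3 f v"
proof -
  define c where "c = (\<lambda>a :: 'p mod_ring. [:a:])"
  have c: "comm_ring_hom c" by unfold_locales (auto simp: c_def one_pCons)
  define x where "x = (\<lambda>i :: 3. [:vec_nth v i, vec_nth P i:])"
  define G where "G = ev3 c (x 1) (x 2) (x 3)"
  interpret G: comm_ring_hom G unfolding G_def by (rule comm_ring_hom_ev3[OF c])
  have Gb: "G (const3 a) = c a" "G X3 = x 1" "G Y3 = x 2" "G Z3 = x 3" for a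
    by (simp_all only: G_def ev3_const3_X3_Y3_Z3[OF c])
  have poly: "poly (G h) s = eval3 h (v + s *s P)" for h s
    unfolding eval3_eq_ev3
  proof (rule poly3_hom_unique[OF _ comm_ring_hom_ev3[OF comm_ring_hom_id]])
    show "comm_ring_hom (\<lambda>h. poly (G h) s)" by unfold_locales (simp_all add: G.hom_add G.hom_mult)
  qed (simp_all only: Gb ev3_const3_X3_Y3_Z3[OF comm_ring_hom_id], simp_all add: c_def x_def mult.commute)
  have "pderiv (G f) = G (dx3 f) * [:vec_nth P 1:] + G (dy3 f) * [:vec_nth P 2:] + G (dz3 f) * [:vec_nth P 3:]"
    unfolding G_def by (subst derivation_ev3[where D = pderiv, OF c])
      (simp_all add: pderiv_add pderiv_mult c_def x_def pderiv_pCons)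
  also have "\<dots> = G (directional3 P f)"
    by (simp only: directional3_def G.hom_add G.hom_mult Gb c_def mult.commute)
  finally have "pderiv (G f) = 0" by (simp add: D)
  moreover have "degree (G f) \<le> e"
    unfolding G_def ev3_homogeneous3[OF c f]
  proof (intro degree_sum_le finite_exponents3)
    fix t assume t: "t \<in> exponents3 (e + 1) e"
    obtain i j k where ijk: "t = (i, j, k)" by (cases t)
    have dx: "degree (x l ^ n) \<le> n" for l n
      using degree_power_le[of "x l" n] mult_le_mono1[of "degree (x l)" 1 n] by (simp add: x_def split: if_splits)
    have "degree (x 1 ^ i * (x 2 ^ j * x 3 ^ k)) \<le> i + (j + k)"
      by (intro order.trans[OF degree_mult_le] add_mono dx)
    also have "i + (j + k) = e" using t by (simp add: ijk exponents3_def)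
    finally have "degree (c (coeff3 f i j k) * (x 1 ^ i * (x 2 ^ j * x 3 ^ k))) \<le> e"
      using degree_mult_le[of "c (coeff3 f i j k)" "x 1 ^ i * (x 2 ^ j * x 3 ^ k)"] by (simp add: c_def)
    then show "degree (case t of (i, j, k) \<Rightarrow> c (coeff3 f i j k) * (x 1 ^ i * (x 2 ^ j * x 3 ^ k))) \<le> e"
      by (simp add: ijk)
  qed
  ultimately have "degree (G f) = 0" using e by (intro pderiv_eq_0_small_degree) auto
  then obtain q where "G f = [:q:]" by (rule degree_eq_zeroE)
  then have "poly (G f) s = poly (G f) 0" by simp
  then show ?thesis by (simp add: poly)
qed

lemma eval3_0:
  fixes f :: "'k::comm_ring_1 poly3"
  assumes f: "homogeneous3 e f" and e: "e \<ge> 1"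
  shows "eval3 f 0 = 0"
  unfolding eval3_eq_ev3 ev3_homogeneous3[OF comm_ring_hom_id f]
  using e by (intro sum.neutral) (auto simp: exponents3_def power_0_left)

context irreducible_curve
begin

text \<open>
  If the polar vanishes, so do those of the partial derivatives, and \<open>F\<close> and its gradient are constant in direction \<open>P\<close>.
  Then all \<open>p\<close> points \<open>v + s P\<close> are smooth points of the curve. They lie on a line, which meets the curve in at most \<open>d < p\<close>
  smooth points.
\<close>

lemma directional3_nonzero:
  assumes S: "smooth_vectors F S" "v \<in> S" and P: "P \<noteq> 0"
  shows "directional3 P F \<noteq> 0"
proof
  assume D: "directional3 P F = 0"
  have Dd: "directional3 P (dx3 F) = 0" "directional3 P (dy3 F) = 0" "directional3 P (dz3 F) = 0"
    unfolding directional3_commute D by (simp_all add: dx3_def dy3_def dz3_def)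
  have v: "eval3 F v = 0" "gradient3 F v \<noteq> 0" using S by (auto simp: smooth_vectors_def)
  have F0: "eval3 F (v + s *s P) = 0" for s
    using eval3_along_line[OF homF dp D] v by simp
  have d1: "d - 1 < CARD('p)" using dp by simp
  have "vec_nth (gradient3 F (v + s *s P)) i = vec_nth (gradient3 F v) i" for s i
    using homogeneous3_d3[OF homF, THEN eval3_along_line, OF d1] Dd exhaust_3[of i]
    by (auto simp: gradient3_nth)
  then have grad: "gradient3 F (v + s *s P) = gradient3 F v" for s
    by (simp add: Finite_Cartesian_Product.vec_eq_iff)
  have "eval3 (dx3 F) 0 = 0" "eval3 (dy3 F) 0 = 0" "eval3 (dz3 F) 0 = 0"
    using homogeneous3_d3[OF homF, THEN eval3_0] d3 by auto
  then have "gradient3 F 0 = 0" unfolding vec3_eq_0_iff gradient3_nth by simp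
  then have nz: "v + s *s P \<noteq> 0" for s using grad[of s] v by auto
  have vP: "v \<noteq> c *s P" for c
  proof
    assume "v = c *s P"
    then have "v + (- c) *s P = 0" by (simp add: Finite_Cartesian_Product.vec_eq_iff)
    then show False using nz by blast
  qed
  define U where "U = range (\<lambda>s. v + s *s P)"
  have inj: "inj (\<lambda>s. v + s *s P)"
    using P by (auto intro!: injI simp: Finite_Cartesian_Product.vec_eq_iff)
  then have cardU: "card U = CARD('p)" unfolding U_def by (simp add: card_image)
  have "smooth_vectors F U"
    unfolding smooth_vectors_def
  proof (intro conjI ballI allI impI)
    fix u assume "u \<in> U"
    then show "u \<noteq> 0" "eval3 F u = 0" "gradient3 F u \<noteq> 0" using nz F0 grad v by (auto simp: U_def)
  next
    fix u w c assume u: "u \<in> U" and w: "w \<in> U" and "u \<noteq> w"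
    obtain s t where st: "u = v + s *s P" "w = v + t *s P" using u w by (auto simp: U_def)
    show "w \<noteq> c *s u"
    proof
      assume "w = c *s u"
      then have "vec_nth v i + t * vec_nth P i = c * (vec_nth v i + s * vec_nth P i)" for i
        by (simp add: st Finite_Cartesian_Product.vec_eq_iff)
      then have eq: "(1 - c) * vec_nth v i = (c * s - t) * vec_nth P i" for i
        by (simp add: algebra_simps)
      show False
      proof (cases "c = 1")
        case True
        then have "(s - t) * vec_nth P i = 0" for i using eq[of i] by simp
        moreover obtain i where "vec_nth P i \<noteq> 0" using P by (auto simp: Finite_Cartesian_Product.vec_eq_iff)
        ultimately show False using \<open>u \<noteq> w\<close> st by (metis eq_iff_diff_eq_0 mult_eq_0_iff)
      next
        case False
        then have "vec_nth v i = (c * s - t) / (1 - c) * vec_nth P i" for i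
          using eq[of i] by (simp add: field_simps)
        then have "v = ((c * s - t) / (1 - c)) *s P" by (simp add: Finite_Cartesian_Product.vec_eq_iff)
        then show False using vP by blast
      qed
    qed
  qed
  moreover define l1 l2 l3 where "l1 = vec_nth v 2 * vec_nth P 3 - vec_nth v 3 * vec_nth P 2"
    and "l2 = vec_nth v 3 * vec_nth P 1 - vec_nth v 1 * vec_nth P 3"
    and "l3 = vec_nth v 1 * vec_nth P 2 - vec_nth v 2 * vec_nth P 1"
  define L where "L = lin3 l1 l2 l3"
  interpret ev: comm_ring_hom "ev3 (\<lambda>x::'p mod_ring. x) p q r" for p q r
    by (intro comm_ring_hom_ev3 comm_ring_hom_id)
  have evL: "eval3 L w = l1 * vec_nth w 1 + l2 * vec_nth w 2 + l3 * vec_nth w 3" for w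
    by (simp add: L_def lin3_def eval3_eq_ev3 ev.hom_add ev.hom_mult ev3_const3_X3_Y3_Z3 comm_ring_hom_id)
  have "eval3 L u = 0" if "u \<in> U" for u
    using that by (auto simp: U_def evL l1_def l2_def l3_def algebra_simps)
  moreover have "L \<noteq> 0"
  proof
    assume "L = 0"
    then have z: "eval3 L w = 0" for w by (simp add: eval3_def)
    have "l1 = 0" using z[of "vector [1, 0, 0]"] by (simp add: evL)
    moreover have "l2 = 0" using z[of "vector [0, 1, 0]"] by (simp add: evL)
    moreover have "l3 = 0" using z[of "vector [0, 0, 1]"] by (simp add: evL)
    ultimately have "\<not> indep3 (vec_nth P 1, vec_nth P 2, vec_nth P 3) (vec_nth v 1, vec_nth v 2, vec_nth v 3)"
      by (simp add: indep3_def l1_def l2_def l3_def mult.commute)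
    moreover have "(vec_nth P 1, vec_nth P 2, vec_nth P 3) \<noteq> (0, 0, 0)" using P vec3_eq_0_iff[of P] by simp
    ultimately obtain c where "vec_nth v 1 = c * vec_nth P 1 \<and> vec_nth v 2 = c * vec_nth P 2 \<and> vec_nth v 3 = c * vec_nth P 3"
      using not_indep3_proportional by blast
    then have "v = c *s P" by (simp add: Finite_Cartesian_Product.vec_eq_iff forall_3)
    then show False using vP by blast
  qed
  moreover have "homogeneous3 1 L" unfolding L_def by (rule homogeneous3_lin3)
  moreover have "1 < d" using d3 by simp
  moreover have "finite U" by (simp add: U_def)
  ultimately have "card U \<le> d * 1" by (intro card_smooth_vectors_on_curve_le[of U 1 L])
  then show False using cardU dp by simp
qed

end

section \<open>Tangent-filling curves\<close>

lemma proj_plane_class: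
  assumes "Q \<in> proj_plane" "v \<in> Q"
  shows "v \<noteq> 0" "Q = {c *s v | c. c \<noteq> 0}"
proof -
  obtain u where u: "u \<noteq> 0" "Q = proj_rel `` {u}"
    using assms(1) by (auto simp: proj_plane_def quotient_def)
  have Q: "Q = {c *s u | c. c \<noteq> 0}"
    using u by (auto simp: proj_rel_def)
  obtain a where a: "a \<noteq> 0" "v = a *s u" using assms(2) Q by auto
  show "v \<noteq> 0" using a u(1) by simp
  show "Q = {c *s v | c. c \<noteq> 0}"
  proof (rule Set.set_eqI, rule iffI)
    fix w assume "w \<in> Q"
    then obtain c where c: "c \<noteq> 0" "w = c *s u" using Q by blast
    then have "w = (c / a) *s v" "c / a \<noteq> 0" using a by simp_all
    then show "w \<in> {c *s v | c. c \<noteq> 0}" by blast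
  next
    fix w assume "w \<in> {c *s v | c. c \<noteq> 0}"
    then obtain c where c: "c \<noteq> 0" "w = c *s v" by blast
    then have "w = (c * a) *s u" "c * a \<noteq> 0" using a by simp_all
    then show "w \<in> Q" unfolding Q by blast
  qed
qed

text \<open>
  The vectors represent the smooth points, one vector for each.
\<close>

lemma tangent_filling_vectors:
  assumes "tangent_filling F"
  shows "\<exists>S. smooth_vectors F S \<and> (\<forall>P. P \<noteq> 0 \<longrightarrow> (\<exists>v\<in>S. dot3 (gradient3 F v) P = 0))"
proof -
  define rep where "rep = (\<lambda>Q :: ('a ^ 3) set. SOME v. v \<in> Q)"
  define S where "S = rep ` smooth_points F"
  have sub: "Q \<in> proj_plane" if "Q \<in> smooth_points F" for Q
    using that by (simp add: smooth_points_def curve_points_def)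
  have rep: "rep Q \<in> Q" if Q: "Q \<in> smooth_points F" for Q
  proof -
    obtain u where "u \<noteq> 0" "Q = proj_rel `` {u}"
      using sub[OF Q] by (auto simp: proj_plane_def quotient_def)
    then have "u \<in> Q" by (auto simp: proj_rel_def intro: exI[of _ 1])
    then show ?thesis unfolding rep_def by (rule someI)
  qed
  have "smooth_vectors F S"
    unfolding smooth_vectors_def
  proof (intro conjI ballI allI impI)
    fix v assume "v \<in> S"
    then obtain Q where Q: "Q \<in> smooth_points F" "v = rep Q" by (auto simp: S_def)
    show "v \<noteq> 0" unfolding Q(2) by (rule proj_plane_class(1)[OF sub[OF Q(1)] rep[OF Q(1)]])
    show "eval3 F v = 0" "gradient3 F v \<noteq> 0"
      using Q(1) rep[OF Q(1)] unfolding Q(2) smooth_points_def curve_points_def by blast+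
  next
    fix v w c assume "v \<in> S" "w \<in> S" "v \<noteq> w"
    then obtain Q R where Q: "Q \<in> smooth_points F" "v = rep Q" and R: "R \<in> smooth_points F" "w = rep R"
      by (auto simp: S_def)
    show "w \<noteq> c *s v"
    proof
      assume eq: "w = c *s v"
      have "w \<noteq> 0" unfolding R(2) by (rule proj_plane_class(1)[OF sub[OF R(1)] rep[OF R(1)]])
      then have "c \<noteq> 0" using eq by auto
      then have "w \<in> Q" using proj_plane_class(2)[OF sub[OF Q(1)] rep[OF Q(1)]] eq Q(2) by blast
      then have "Q = R"
        using proj_plane_class(2)[OF sub[OF Q(1)], of w] proj_plane_class(2)[OF sub[OF R(1)] rep[OF R(1)]] R(2) by simp
      then show False using Q(2) R(2) \<open>v \<noteq> w\<close> by simp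
    qed
  qed
  moreover have "\<exists>v\<in>S. dot3 (gradient3 F v) P = 0" if P: "P \<noteq> 0" for P
  proof -
    have "proj_rel `` {P} \<in> proj_plane" using P by (auto simp: proj_plane_def quotient_def)
    then obtain Q where Q: "Q \<in> smooth_points F" "proj_rel `` {P} \<in> tangent_line F Q"
      using assms unfolding tangent_filling_def by blast
    have "P \<in> proj_rel `` {P}" using P by (auto simp: proj_rel_def intro: exI[of _ 1])
    then have "dot3 (gradient3 F (rep Q)) P = 0"
      using Q(2) rep[OF Q(1)] unfolding tangent_line_def dot3_def by blast
    moreover have "rep Q \<in> S" unfolding S_def using Q(1) by (rule imageI)
    ultimately show ?thesis by blast
  qed
  ultimately show ?thesis by blast
qed

theorem theorem1p1:
  fixes F :: "'p::prime_card mod_ring poly3" and p d :: nat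
  assumes "p = CARD('p)"
    and "irreducible F"
    and "homogeneous3 d F"
    and "d \<ge> 3"
    and "p \<ge> 4 * (d - 1)\<^sup>2 * (d - 2)\<^sup>2"
  shows "\<not> tangent_filling F"
proof
  assume "tangent_filling F"
  then obtain S where S: "smooth_vectors F S" "\<And>P. P \<noteq> 0 \<Longrightarrow> \<exists>v\<in>S. dot3 (gradient3 F v) P = 0"
    using tangent_filling_vectors by blast
  have bound: "4 * (d - 1)\<^sup>2 * (d - 2)\<^sup>2 \<le> CARD('p)" using assms by simp
  have dd: "d * (d - 1) \<le> CARD('p)"
  proof -
    have "d * (d - 1) \<le> (4 * (d - 1)) * (d - 1)" using assms(4) by (intro mult_le_mono1) linarith
    also have "\<dots> = (4 * (d - 1)) * (d - 1) * 1" by simp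
    also have "\<dots> \<le> (4 * (d - 1)) * (d - 1) * (d - 2)\<^sup>2"
      using assms(4) by (intro mult_le_mono2) simp
    also have "\<dots> = 4 * (d - 1)\<^sup>2 * (d - 2)\<^sup>2" by (simp add: power2_eq_square)
    finally show ?thesis using bound by simp
  qed
  have "d * 2 \<le> d * (d - 1)" using assms(4) by (intro mult_le_mono2) linarith
  then have dp: "d < CARD('p)" "CARD('p) > 2" using dd assms(4) by linarith+
  have odd: "odd CARD('p)" using prime_card[where 'a = 'p] dp(2) by (simp add: prime_odd_nat)
  interpret irreducible_curve F d using assms dp by unfold_locales auto
  have finS: "finite S" by simp
  have "2 * card S \<le> 3 * CARD('p) + 2"
    by (rule card_smooth_vectors_le[OF bound finS S(1)])
  moreover have "3 * (CARD('p) + 1) \<le> 2 * card S"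
  proof (rule blocking_family_card[OF odd finS, of "gradient3 F"])
    fix P :: "'p mod_ring ^ 3" assume P: "P \<noteq> 0"
    then show "\<exists>v\<in>S. dot3 (gradient3 F v) P = 0" by (rule S(2))
    then obtain v where "v \<in> S" by blast
    then have nz: "directional3 P F \<noteq> 0" by (rule directional3_nonzero[OF S(1) _ P])
    have "card {v \<in> S. dot3 (gradient3 F v) P = 0} \<le> d * (d - 1)"
    proof (rule card_smooth_vectors_on_curve_le[OF _ _ homogeneous3_directional3[OF homF] _ nz])
      show "smooth_vectors F {v \<in> S. dot3 (gradient3 F v) P = 0}" using S(1) by (auto simp: smooth_vectors_def)
      show "d - 1 < d" using d3 by simp
    qed (auto simp: eval3_directional3)
    then show "card {v \<in> S. dot3 (gradient3 F v) P = 0} \<le> CARD('p)" using dd by simp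
  qed (use S(1) in \<open>auto simp: smooth_vectors_def\<close>)
  ultimately show False by simp
qed

end
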